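(* Let $\mathrm{P}$ be a convex Euclidean polygon and let $X$ be the vertex set of $\mathrm{P}$. Then every blow-up triangulation of $\mathrm{P}$ built from a geodesic path in $\mathcal{F}(\mathrm{P},X)$ is a flag simplicial complex.
   Context: Flip-graph. $\mathrm{P}\subset\mathbb{R}^2$. An arc is a line segment between two distinct points of $X$. Two distinct arcs cross when their relative interiors intersect. A triangulation of $\mathrm{P}$ with vertex set $X$ is an inclusion-maximal set of pairwise non-crossing arcs; a triangle of a triangulation $T$ is a triangle whose three edges belong to $T$. $\mathcal{F}(\mathrm{P},X)$ is the graph whose vertices are these triangulations and whose edges connect two triangulations that differ by exactly one arc (they are related by a flip, which exchanges the two diagonals of a convex quadrilateral). A geodesic path is a path whose length is the graph distance between its endpoints. Blow-up triangulation. Identify $\mathbb{R}^2$ with the plane spanned by the first two coordinates of $\mathbb{R}^3$ and let $\pi:\mathbb{R}^3\to\mathbb{R}^2$ be the orthogonal projection. Let $(T_i)_{0\le i\le k}$ be a path in $\mathcal{F}(\mathrm{P},X)$. Let $\Pi_0\subset\mathbb{R}^3$ be an embedded topological disk such that $\pi$ induces a homeomorphism $\Pi_0\to\mathrm{P}$ and the boundaries of $\Pi_0$ and $\mathrm{P}$ coincide. For $1\le i\le k$ let $Q_i$ be the quadrilateral whose diagonals are exchanged by the flip between $T_{i-1}$ and $T_i$, let $\Theta_i^-=\pi^{-1}(Q_i)\cap\Pi_{i-1}$, and let $\Theta_i^+\subset\mathbb{R}^3$ be an embedded topological disk with the same boundary as $\Theta_i^-$ such that $\pi$ induces a homeomorphism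 $\Theta_i^+\to Q_i$ and every point in the interior of $\Theta_i^+$ has a larger third coordinate than the point of $\Pi_{i-1}$ with the same image by $\pi$. Put $\Pi_i=[\Pi_{i-1}\setminus\Theta_i^-]\cup\Theta_i^+$, and let $\psi(i)$ be the closed $3$-dimensional ball bounded by the sphere $\Theta_i^-\cup\Theta_i^+$. The blow-up triangulation built from the path is the set $K$ made of the portions of $\Pi_i$ whose image by $\pi$ is a vertex, an arc, or a triangle of $T_i$ for $0\le i\le k$, together with the balls $\psi(i)$ for $1\le i\le k$. The elements of $K$ are its faces: the vertices of $K$ are the points of $X$, and its $1$-, $2$-, and $3$-dimensional elements are its arcs, triangles and tetrahedra. The faces of a face $\sigma$ of $K$ are the elements of $K$ contained in $\sigma$. A simplicial complex is flag when every subset of its vertices that induces a complete graph in its $1$-skeleton is the vertex set of one of its faces. *)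

theory Defs
  imports "HOL-Analysis.Analysis"
begin

section \<open>Flip-graphs\<close>

type_synonym plane = "real^2"

definition convex_polygon :: "plane set \<Rightarrow> bool" where
  "convex_polygon P \<longleftrightarrow> polytope P \<and> aff_dim P = 2"

definition polygon_vertices :: "plane set \<Rightarrow> plane set" where
  "polygon_vertices P = {x. x extreme_point_of P}"

text \<open>Arcs are line segments as point sets, so they carry no orientation.\<close>

definition arcs :: "plane set \<Rightarrow> plane set set" where
  "arcs X = {closed_segment a b | a b. a \<in> X \<and> b \<in> X \<and> a \<noteq> b}"

definition crossing :: "plane set \<Rightarrow> plane set \<Rightarrow> bool" where
  "crossing e f \<longleftrightarrow> e \<noteq> f \<and> rel_interior e \<inter> rel_interior f \<noteq> {}"

definition noncrossing_arcs :: "plane set \<Rightarrow> plane set set \<Rightarrow> bool" where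
  "noncrossing_arcs X T \<longleftrightarrow> T \<subseteq> arcs X \<and> (\<forall>e\<in>T. \<forall>f\<in>T. \<not> crossing e f)"

text \<open>
  For \<open>X\<close> the vertex set of a convex polygon \<open>P\<close>, these are the triangulations of \<open>P\<close> with
  vertex set \<open>X\<close>: every segment between points of \<open>X\<close> lies in \<open>P\<close>, and \<open>P = convex hull X\<close>.
\<close>

definition triangulation :: "plane set \<Rightarrow> plane set set \<Rightarrow> bool" where
  "triangulation X T \<longleftrightarrow>
     noncrossing_arcs X T \<and> (\<forall>T'. noncrossing_arcs X T' \<and> T \<subseteq> T' \<longrightarrow> T' = T)"

definition triangles :: "plane set set \<Rightarrow> plane set set" where
  "triangles T = {convex hull {a, b, c} | a b c. \<not> collinear {a, b, c} \<and>
     closed_segment a b \<in> T \<and> closed_segment b c \<in> T \<and> closed_segment a c \<in> T}"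

definition cells :: "plane set \<Rightarrow> plane set set \<Rightarrow> plane set set" where
  "cells X T = {{x} | x. x \<in> X} \<union> T \<union> triangles T"

definition flip_adjacent :: "plane set \<Rightarrow> plane set set \<Rightarrow> plane set set \<Rightarrow> bool" where
  "flip_adjacent X T T' \<longleftrightarrow> triangulation X T \<and> triangulation X T' \<and>
     (\<exists>d d'. T - T' = {d} \<and> T' - T = {d'})"

text \<open>
  The two exchanged arcs are the diagonals of the quadrilateral, which is convex and is
  therefore the convex hull of their union.
\<close>

definition flip_quad :: "plane set set \<Rightarrow> plane set set \<Rightarrow> plane set" where
  "flip_quad T T' = convex hull (\<Union>(T - T') \<union> \<Union>(T' - T))"

text \<open>The path visits \<open>T 0, \<dots>, T k\<close>; the values of \<open>T\<close> beyond \<open>k\<close> are irrelevant.\<close>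

definition flip_path :: "plane set \<Rightarrow> nat \<Rightarrow> (nat \<Rightarrow> plane set set) \<Rightarrow> bool" where
  "flip_path X k T \<longleftrightarrow>
     (\<forall>i\<le>k. triangulation X (T i)) \<and> (\<forall>i<k. flip_adjacent X (T i) (T (Suc i)))"

definition flip_distance :: "plane set \<Rightarrow> plane set set \<Rightarrow> plane set set \<Rightarrow> nat" where
  "flip_distance X A B = (LEAST n. \<exists>S. flip_path X n S \<and> S 0 = A \<and> S n = B)"

definition geodesic_flip_path :: "plane set \<Rightarrow> nat \<Rightarrow> (nat \<Rightarrow> plane set set) \<Rightarrow> bool" where
  "geodesic_flip_path X k T \<longleftrightarrow> flip_path X k T \<and> k = flip_distance X (T 0) (T k)"


section \<open>Blow-up triangulations\<close>

text \<open>
  Three-dimensional space is split as plane times third coordinate: \<open>fst\<close> is the orthogonal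
  projection, \<open>snd\<close> the third coordinate, and the plane is identified with its image
  under \<open>\<lambda>x. (x, 0)\<close>.
\<close>

type_synonym space = "plane \<times> real"

abbreviation embed :: "plane \<Rightarrow> space" where
  "embed x \<equiv> (x, 0)"

definition embedded_disk :: "space set \<Rightarrow> bool" where
  "embedded_disk D \<longleftrightarrow> cball (0::plane) 1 homeomorphic D"

text \<open>
  The intrinsic boundary of a topological disk. By invariance of domain all
  parametrizations \<open>f\<close> give the same set \<open>f ` sphere 0 1\<close>.
\<close>

definition disk_boundary :: "space set \<Rightarrow> space set" where
  "disk_boundary D = {z. \<exists>f g. homeomorphism (cball (0::plane) 1) D f g \<and> z \<in> f ` sphere 0 1}"

definition projects_homeomorphically :: "space set \<Rightarrow> plane set \<Rightarrow> bool" where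
  "projects_homeomorphically S R \<longleftrightarrow> (\<exists>g. homeomorphism S R fst g)"

definition portion :: "space set \<Rightarrow> plane set \<Rightarrow> space set" where
  "portion S c = S \<inter> fst -` c"

definition initial_disk :: "plane set \<Rightarrow> space set \<Rightarrow> bool" where
  "initial_disk P S \<longleftrightarrow> embedded_disk S \<and> projects_homeomorphically S P \<and>
     disk_boundary S = embed ` frontier P"

text \<open>\<open>C\<close> is a possible upper disk above the quadrilateral \<open>Q\<close> for the current surface \<open>S\<close>.\<close>

definition cap_above :: "space set \<Rightarrow> plane set \<Rightarrow> space set \<Rightarrow> bool" where
  "cap_above S Q C \<longleftrightarrow> embedded_disk C \<and> disk_boundary C = disk_boundary (portion S Q) \<and>
     projects_homeomorphically C Q \<and>
     (\<forall>z \<in> C - disk_boundary C. \<forall>w \<in> S. fst w = fst z \<longrightarrow> snd w < snd z)"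

text \<open>\<open>S i\<close> is the \<open>i\<close>-th surface and \<open>C i\<close>, for \<open>1 \<le> i \<le> k\<close>, the upper disk of the \<open>i\<close>-th flip.\<close>

definition blow_up_surfaces ::
  "plane set \<Rightarrow> nat \<Rightarrow> (nat \<Rightarrow> plane set set) \<Rightarrow> (nat \<Rightarrow> space set) \<Rightarrow> (nat \<Rightarrow> space set) \<Rightarrow> bool" where
  "blow_up_surfaces P k T S C \<longleftrightarrow> initial_disk P (S 0) \<and>
     (\<forall>i\<in>{1..k}. let Q = flip_quad (T (i - 1)) (T i) in
        cap_above (S (i - 1)) Q (C i) \<and>
        S i = (S (i - 1) - portion (S (i - 1)) Q) \<union> C i)"

text \<open>The closed ball bounded by an embedded sphere: the sphere and its bounded side.\<close>

definition ball_bounded_by :: "space set \<Rightarrow> space set" where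
  "ball_bounded_by B = B \<union> inside B"

definition blow_up_faces ::
  "plane set \<Rightarrow> nat \<Rightarrow> (nat \<Rightarrow> plane set set) \<Rightarrow> (nat \<Rightarrow> space set) \<Rightarrow> (nat \<Rightarrow> space set)
    \<Rightarrow> space set set" where
  "blow_up_faces X k T S C =
     {portion (S i) c | i c. i \<le> k \<and> c \<in> cells X (T i)} \<union>
     {ball_bounded_by (portion (S (i - 1)) (flip_quad (T (i - 1)) (T i)) \<union> C i) | i. i \<in> {1..k}}"

definition blow_up_triangulation ::
  "plane set \<Rightarrow> plane set \<Rightarrow> nat \<Rightarrow> (nat \<Rightarrow> plane set set) \<Rightarrow> space set set \<Rightarrow> bool" where
  "blow_up_triangulation P X k T K \<longleftrightarrow>
     (\<exists>S C. blow_up_surfaces P k T S C \<and> K = blow_up_faces X k T S C)"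


section \<open>Flag simplicial complexes with curved faces\<close>

text \<open>
  The analogue of \<^const>\<open>simplicial_complex\<close> for faces that are only homeomorphic images of
  simplices. Each face together with the elements of \<open>K\<close> it contains is a homeomorphic copy of a
  simplex with its faces, and two faces meet in a common face or not at all. The empty face
  is not an element of \<open>K\<close>.
\<close>

definition faces_of :: "'a set set \<Rightarrow> 'a set \<Rightarrow> 'a set set" where
  "faces_of K \<sigma> = {\<tau> \<in> K. \<tau> \<subseteq> \<sigma>}"

definition curved_simplicial_complex :: "'a::euclidean_space set set \<Rightarrow> bool" where
  "curved_simplicial_complex K \<longleftrightarrow> finite K \<and> {} \<notin> K \<and>
     (\<forall>\<sigma>\<in>K. \<exists>n (\<Delta>::'a set) f g. n simplex \<Delta> \<and> homeomorphism \<Delta> \<sigma> f g \<and>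
        faces_of K \<sigma> = {f ` F | F. F face_of \<Delta> \<and> F \<noteq> {}}) \<and>
     (\<forall>\<sigma>\<in>K. \<forall>\<tau>\<in>K. \<sigma> \<inter> \<tau> = {} \<or> \<sigma> \<inter> \<tau> \<in> faces_of K \<sigma> \<inter> faces_of K \<tau>)"

definition complex_vertices :: "'a set set \<Rightarrow> 'a set" where
  "complex_vertices K = {v. {v} \<in> K}"

definition face_vertices :: "'a set set \<Rightarrow> 'a set \<Rightarrow> 'a set" where
  "face_vertices K \<sigma> = {v. {v} \<in> faces_of K \<sigma>}"

text \<open>Adjacency in the 1-skeleton: the 1-dimensional faces are those with two vertices.\<close>

definition skeleton_adjacent :: "'a set set \<Rightarrow> 'a \<Rightarrow> 'a \<Rightarrow> bool" where
  "skeleton_adjacent K v w \<longleftrightarrow> v \<noteq> w \<and> (\<exists>e\<in>K. face_vertices K e = {v, w})"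

text \<open>The empty clique corresponds to the empty face, which \<open>K\<close> does not list.\<close>

definition flag :: "'a set set \<Rightarrow> bool" where
  "flag K \<longleftrightarrow> (\<forall>A. A \<subseteq> complex_vertices K \<and> A \<noteq> {} \<and> pairwise (skeleton_adjacent K) A \<longrightarrow>
     (\<exists>\<sigma>\<in>K. face_vertices K \<sigma> = A))"

end

theory Submission
  imports Defs
begin

text \<open>
  Number the vertices of the polygon in cyclic order, so that a triangulation becomes a maximal set
  of pairwise non-interleaved chords \<open>(i, j)\<close>, \<open>i < j\<close>. A monotone map of the vertices contracts
  triangulations to triangulations, and a flip survives the contraction only when the four corners
  of its quadrilateral stay distinct. Hence two suitably chosen contractions never both see the same
  flip. Gluing the two contracted paths along a chord shows that an arc lost along a geodesic never
  returns; concatenating them shows that three arcs bounding a triangle which each occur along a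
  geodesic also occur simultaneously.

  The surfaces of a blow-up triangulation are graphs of functions that increase along the path, and
  each ball is the region between two consecutive graphs. Since no arc returns, two faces meet
  exactly in the face spanned by their common vertices. A clique of three vertices spans a triangle
  of some triangulation; for four vertices the diagonal of the quadrilateral that occurs first has
  to be flipped into the other one while all sides are present; and for five vertices the five
  diagonals of a pentagon, in which consecutive ones cross, would alternate in time around a cycle
  of odd length.
\<close>

section \<open>Chord triangulations\<close>

text \<open>Shortness of the path is used only through strict inequality. Each flip survives in at
  most one of two contractions, so a rearranged path is never longer; the real work is to exhibit a
  flip that survives in neither. Both shortcuts are proved for configurations with a corner numbered
  0, which is general enough because the cyclic numbering may start at any vertex. Maximality of a
  set of chords does not pass easily through contraction and gluing. It is therefore replaced by a
  local criterion: every chord with vertices below it is the long side of a triangle of the set.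

  On the topological side, invariance of domain identifies the intrinsic boundary of a disk with the
  part over the frontier of its projection, so the abstract disks become graphs that agree along the
  sides of each quadrilateral. There the vertical fibres of a ball shrink to points, which is the
  delicate place when the ball is compared with a straight tetrahedron. The complex itself depends
  on the geodesic only through two facts: the times at which an arc is present form an interval, and
  pairwise joined triples of vertices are joined simultaneously.\<close>

definition interleaved :: "nat \<times> nat \<Rightarrow> nat \<times> nat \<Rightarrow> bool" where
  "interleaved e f \<longleftrightarrow>
     fst e < fst f \<and> fst f < snd e \<and> snd e < snd f \<or>
     fst f < fst e \<and> fst e < snd f \<and> snd f < snd e"

definition chords :: "nat set \<Rightarrow> (nat \<times> nat) set" where
  "chords V = {(i, j). i \<in> V \<and> j \<in> V \<and> i < j}"

text \<open>Vertex sets are arbitrary sets of numbers, so that contracted and cut-off polygons are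
  covered. Polygon sides count as chords too; nothing interleaves with them, so they belong to every
  triangulation.\<close>

definition chord_triangulation :: "nat set \<Rightarrow> (nat \<times> nat) set \<Rightarrow> bool" where
  "chord_triangulation V E \<longleftrightarrow> E \<subseteq> chords V \<and> (\<forall>e\<in>E. \<forall>f\<in>E. \<not> interleaved e f) \<and>
     (\<forall>e\<in>chords V. (\<forall>f\<in>E. \<not> interleaved e f) \<longrightarrow> e \<in> E)"

definition chord_flip :: "nat set \<Rightarrow> ((nat \<times> nat) set \<times> (nat \<times> nat) set) set" where
  "chord_flip V = {(E, F). chord_triangulation V E \<and> chord_triangulation V F \<and>
     (\<exists>d d'. E - F = {d} \<and> F - E = {d'})}"

lemma mem_chords [simp]: "(i, j) \<in> chords V \<longleftrightarrow> i \<in> V \<and> j \<in> V \<and> i < j"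
  by (simp add: chords_def)

lemma interleaved_Pair [simp]:
  "interleaved (i, j) (k, l) \<longleftrightarrow> i < k \<and> k < j \<and> j < l \<or> k < i \<and> i < l \<and> l < j"
  by (simp add: interleaved_def)

lemma interleaved_sym: "interleaved e f \<longleftrightarrow> interleaved f e"
  by (auto simp: interleaved_def)

lemma chord_triangulation_chords: "chord_triangulation V E \<Longrightarrow> E \<subseteq> chords V"
  by (simp add: chord_triangulation_def)

lemma chord_triangulation_memD:
  "chord_triangulation V E \<Longrightarrow> (i, j) \<in> E \<Longrightarrow> i \<in> V \<and> j \<in> V \<and> i < j"
  by (auto simp: chord_triangulation_def)

lemma chord_triangulation_noncrossing:
  "chord_triangulation V E \<Longrightarrow> e \<in> E \<Longrightarrow> f \<in> E \<Longrightarrow> \<not> interleaved e f"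
  by (auto simp: chord_triangulation_def)

lemma chord_triangulation_maximal:
  "chord_triangulation V E \<Longrightarrow> e \<in> chords V \<Longrightarrow> (\<And>f. f \<in> E \<Longrightarrow> \<not> interleaved e f) \<Longrightarrow> e \<in> E"
  by (auto simp: chord_triangulation_def)

lemma chord_triangulation_subset_eq:
  assumes "chord_triangulation V E" "chord_triangulation V F" "E \<subseteq> F"
  shows "E = F"
  using assms unfolding chord_triangulation_def by blast

text \<open>The chord from the smallest to the largest vertex interleaves with nothing and serves as
  enclosing chord for every pair.\<close>

lemma chord_triangulation_cover:
  assumes "chord_triangulation V E" "finite V" "x \<in> V" "y \<in> V" "x < y"
  shows "\<exists>i j. (i, j) \<in> E \<and> i \<le> x \<and> y \<le> j"
proof -
  have "V \<noteq> {}" using assms by auto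
  then have m: "Min V \<le> x" "y \<le> Max V" "Min V \<in> V" "Max V \<in> V"
    using assms by (simp_all add: Min_in Max_in)
  have "(Min V, Max V) \<in> E"
  proof (rule chord_triangulation_maximal[OF assms(1)])
    show "(Min V, Max V) \<in> chords V" using m assms(5) unfolding mem_chords by linarith
    fix f assume "f \<in> E"
    then have "fst f \<in> V" "snd f \<in> V"
      using chord_triangulation_memD[OF assms(1), of "fst f" "snd f"] by auto
    then have "Min V \<le> fst f" "snd f \<le> Max V" using assms(2) by auto
    then show "\<not> interleaved (Min V, Max V) f" by (auto simp: interleaved_def)
  qed
  then show ?thesis using m by blast
qed

text \<open>This is the third corner of the triangle below \<open>(i, j)\<close>. The farthest
  neighbour \<open>k\<close> of \<open>i\<close> before \<open>j\<close> works: a chord crossing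
  \<open>(k, j)\<close> but neither \<open>(i, k)\<close> nor \<open>(i, j)\<close> would start at
  \<open>i\<close> and end between \<open>k\<close> and \<open>j\<close>.\<close>

lemma chord_triangulation_apex:
  assumes E: "chord_triangulation V E" and fin: "finite V"
    and ij: "(i, j) \<in> E" and v: "v \<in> V" "i < v" "v < j"
  shows "\<exists>k. i < k \<and> k < j \<and> (i, k) \<in> E \<and> (k, j) \<in> E"
proof -
  let ?K = "{k. (i, k) \<in> E \<and> k < j}"
  have i: "i \<in> V" and j: "j \<in> V" using chord_triangulation_memD[OF E ij] by auto
  \<comment> \<open>The successor of \<open>i\<close> is joined to \<open>i\<close> by a polygon
    side, which makes \<open>?K\<close> nonempty.\<close>
  define s where "s = Min {u \<in> V. i < u}"
  have s: "s \<in> V" "i < s" "s \<le> v" and smin: "\<And>u. u \<in> V \<Longrightarrow> i < u \<Longrightarrow> s \<le> u"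
  proof -
    have "s \<in> {u \<in> V. i < u}" unfolding s_def using v fin by (intro Min_in) auto
    then show "s \<in> V" "i < s" by auto
    show "s \<le> u" if "u \<in> V" "i < u" for u unfolding s_def using that fin by (intro Min_le) auto
    then show "s \<le> v" using v by auto
  qed
  have "(i, s) \<in> E"
  proof (rule chord_triangulation_maximal[OF E])
    show "(i, s) \<in> chords V" using i s by auto
    fix f assume "f \<in> E"
    then have "fst f \<in> V" "snd f \<in> V"
      using chord_triangulation_memD[OF E, of "fst f" "snd f"] by auto
    then show "\<not> interleaved (i, s) f" using smin by (fastforce simp: interleaved_def)
  qed
  then have ne: "s \<in> ?K" using s v by auto
  have fK: "finite ?K" by (rule finite_subset[of _ "{..<j}"]) auto
  define k where "k = Max ?K"
  have "k \<in> ?K" unfolding k_def using fK ne by (intro Max_in) auto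
  then have k: "(i, k) \<in> E" "k < j" by auto
  have kmax: "y \<le> k" if "(i, y) \<in> E" "y < j" for y
    unfolding k_def using fK that by (intro Max_ge) auto
  have ik: "i < k" "k \<in> V" using chord_triangulation_memD[OF E k(1)] by auto
  have "(k, j) \<in> E"
  proof (rule chord_triangulation_maximal[OF E])
    show "(k, j) \<in> chords V" using ik j k by auto
    fix f assume f: "f \<in> E"
    obtain x y where xy: "f = (x, y)" by (cases f)
    have n1: "\<not> interleaved (i, k) f" "\<not> interleaved (i, j) f"
      using chord_triangulation_noncrossing[OF E] k ij f by auto
    show "\<not> interleaved (k, j) f"
    proof
      assume "interleaved (k, j) f"
      then have "x = i \<and> k < y \<and> y < j" using n1 xy ik k by auto
      then show False using kmax[of y] f xy by auto
    qed
  qed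
  then show ?thesis using k ik by blast
qed

text \<open>Local form of maximality. A chord free of crossings is compared with the shortest chord
  of \<open>E\<close> enclosing it; if the two differed, the apex of the latter would produce a
  shorter enclosing chord or a crossing.\<close>

lemma chord_triangulationI:
  assumes "E \<subseteq> chords V" and nc: "\<And>e f. e \<in> E \<Longrightarrow> f \<in> E \<Longrightarrow> \<not> interleaved e f"
    and cover: "\<And>x y. x \<in> V \<Longrightarrow> y \<in> V \<Longrightarrow> x < y \<Longrightarrow> \<exists>i j. (i, j) \<in> E \<and> i \<le> x \<and> y \<le> j"
    and apex: "\<And>i j v. (i, j) \<in> E \<Longrightarrow> v \<in> V \<Longrightarrow> i < v \<Longrightarrow> v < j \<Longrightarrow>
       \<exists>k. i < k \<and> k < j \<and> (i, k) \<in> E \<and> (k, j) \<in> E"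
  shows "chord_triangulation V E"
  unfolding chord_triangulation_def
proof (intro conjI ballI impI)
  fix e assume e: "e \<in> chords V" and free: "\<forall>f\<in>E. \<not> interleaved e f"
  obtain x y where xy: "e = (x, y)" "x \<in> V" "y \<in> V" "x < y" using e by (cases e) auto
  let ?P = "\<lambda>e. e \<in> E \<and> fst e \<le> x \<and> y \<le> snd e"
  obtain i' j' where "?P (i', j')" using cover[OF xy(2-4)] by auto
  from ex_has_least_nat[of ?P, OF this, of "\<lambda>e. snd e - fst e"]
  obtain e0 where e0: "?P e0" and least: "\<And>e'. ?P e' \<Longrightarrow> snd e0 - fst e0 \<le> snd e' - fst e'"
    by blast
  obtain i j where ij: "e0 = (i, j)" by (cases e0)
  show "e \<in> E"
  proof (rule ccontr)
    assume "e \<notin> E"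
    then have "\<exists>v\<in>V. i < v \<and> v < j"
    proof (cases "i < x")
      case True
      then show ?thesis using xy e0 ij by (intro bexI[of _ x]) auto
    next
      case False
      then have "y < j" using \<open>e \<notin> E\<close> e0 ij xy by (cases "y = j") auto
      then show ?thesis using xy e0 ij by (intro bexI[of _ y]) auto
    qed
    then obtain k where k: "i < k" "k < j" "(i, k) \<in> E" "(k, j) \<in> E"
      using apex e0 ij by blast
    \<comment> \<open>By minimality the apex lies strictly between \<open>x\<close> and
      \<open>y\<close>. Since neither \<open>(i, k)\<close> nor \<open>(k, j)\<close> may cross
      \<open>e\<close>, both ends of \<open>e\<close> are then those of the enclosing chord.\<close>
    have "x < k" using least[of "(k, j)"] k e0 ij by fastforce
    moreover have "k < y" using least[of "(i, k)"] k e0 ij by fastforce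
    ultimately have "\<not> i < x" "\<not> y < j" using free k xy by fastforce+
    then have "e = (i, j)" using e0 ij xy by auto
    then show False using \<open>e \<notin> E\<close> e0 ij by auto
  qed
qed (use assms in auto)

section \<open>Contractions\<close>

definition contract :: "(nat \<Rightarrow> nat) \<Rightarrow> (nat \<times> nat) set \<Rightarrow> (nat \<times> nat) set" where
  "contract f E = {(f i, f j) | i j. (i, j) \<in> E \<and> f i < f j}"

lemma contractI: "(i, j) \<in> E \<Longrightarrow> f i < f j \<Longrightarrow> (f i, f j) \<in> contract f E"
  by (auto simp: contract_def)

lemma contractE:
  assumes "e \<in> contract f E"
  obtains i j where "e = (f i, f j)" "(i, j) \<in> E" "f i < f j"
  using assms by (auto simp: contract_def)

text \<open>A strict inequality between images of a monotone map pulls back, so crossings of images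
  come from crossings. The apex condition is inherited from a well chosen preimage of the
  chord.\<close>

lemma chord_triangulation_contract:
  assumes E: "chord_triangulation V E" and fin: "finite V" and f: "mono f"
  shows "chord_triangulation (f ` V) (contract f E)"
proof (rule chord_triangulationI)
  have mono: "x < y" if "f x < f y" for x y
    using monoD[OF f, of y x] that by (meson leD leI)
  show "contract f E \<subseteq> chords (f ` V)"
    using chord_triangulation_memD[OF E] by (auto simp: contract_def)
  show "\<not> interleaved d e" if "d \<in> contract f E" "e \<in> contract f E" for d e
  proof -
    obtain i j where d: "d = (f i, f j)" "(i, j) \<in> E" using \<open>d \<in> _\<close> by (rule contractE)
    obtain k l where e: "e = (f k, f l)" "(k, l) \<in> E" using \<open>e \<in> _\<close> by (rule contractE)
    show ?thesis
      using chord_triangulation_noncrossing[OF E d(2) e(2)] mono d(1) e(1) by auto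
  qed
  show "\<exists>i j. (i, j) \<in> contract f E \<and> i \<le> x \<and> y \<le> j"
    if h: "x \<in> f ` V" "y \<in> f ` V" "x < y" for x y
  proof -
    obtain x' where x': "x = f x'" "x' \<in> V" using h(1) by blast
    obtain y' where y': "y = f y'" "y' \<in> V" using h(2) by blast
    note xy = x'(1) y'(1) x'(2) y'(2)
    have "x' < y'" using mono[of x' y'] h xy by simp
    then obtain i j where ij: "(i, j) \<in> E" "i \<le> x'" "y' \<le> j"
      using chord_triangulation_cover[OF E fin xy(3,4)] by blast
    have "f i \<le> x" "y \<le> f j" using ij xy monoD[OF f] by auto
    then show ?thesis using contractI[OF ij(1), of f] h by force
  qed
  show "\<exists>k. i < k \<and> k < j \<and> (i, k) \<in> contract f E \<and> (k, j) \<in> contract f E"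
    if ij: "(i, j) \<in> contract f E" and w: "w \<in> f ` V" "i < w" "w < j" for i j w
  proof -
    \<comment> \<open>The shortest preimage of the chord is taken: if its apex collapsed onto one
      end, one of its two halves would be a shorter preimage.\<close>
    let ?P = "\<lambda>e. e \<in> E \<and> f (fst e) = i \<and> f (snd e) = j"
    have "\<exists>i' j'. ?P (i', j')" using ij by (auto simp: contract_def)
    then obtain i' j' where "?P (i', j')" by blast
    from ex_has_least_nat[of ?P, OF this, of "\<lambda>e. snd e - fst e"]
    obtain e0 where e0: "?P e0" and least: "\<And>e. ?P e \<Longrightarrow> snd e0 - fst e0 \<le> snd e - fst e"
      by blast
    obtain a b where ab: "e0 = (a, b)" by (cases e0)
    have abE: "(a, b) \<in> E" "f a = i" "f b = j" using e0 ab by auto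
    obtain v where v: "v \<in> V" "w = f v" using w by auto
    have "a < v" "v < b" using w v abE mono by auto
    then obtain k where k: "a < k" "k < b" "(a, k) \<in> E" "(k, b) \<in> E"
      using chord_triangulation_apex[OF E fin abE(1) v(1)] by blast
    have "i \<le> f k" "f k \<le> j" using k abE monoD[OF f] by (metis less_imp_le)+
    moreover have "f k \<noteq> i" using least[of "(k, b)"] k abE ab by auto
    moreover have "f k \<noteq> j" using least[of "(a, k)"] k abE ab by auto
    ultimately have "i < f k" "f k < j" by auto
    then show ?thesis using contractI[OF k(3), of f] contractI[OF k(4), of f] abE by auto
  qed
qed

text \<open>Weaker than a flip, so that it survives contraction and union with a fixed set; between
  two triangulations it amounts to equality or a flip.\<close>

definition near :: "'a set \<Rightarrow> 'a set \<Rightarrow> bool" where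
  "near E F \<longleftrightarrow> (\<exists>d d'. E \<subseteq> insert d F \<and> F \<subseteq> insert d' E)"

lemma near_Un: "near E F \<Longrightarrow> near (E \<union> G) (F \<union> G)"
  unfolding near_def by blast

lemma near_flip:
  assumes "chord_triangulation V E" "chord_triangulation V F" "near E F"
  shows "E = F \<or> (E, F) \<in> chord_flip V"
proof (rule disjCI)
  assume "(E, F) \<notin> chord_flip V"
  obtain d d' where "E \<subseteq> insert d F" "F \<subseteq> insert d' E" using assms(3) by (auto simp: near_def)
  then have "E - F = {} \<or> E - F = {d}" "F - E = {} \<or> F - E = {d'}" by auto
  then show "E = F"
    using \<open>(E, F) \<notin> _\<close> chord_triangulation_subset_eq[OF assms(1,2)]
      chord_triangulation_subset_eq[OF assms(2,1)] assms(1,2)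
    unfolding chord_flip_def by blast
qed

lemma chord_flip_sym: "(E, F) \<in> chord_flip V \<longleftrightarrow> (F, E) \<in> chord_flip V"
  by (auto simp: chord_flip_def)

lemma near_contract:
  assumes "(E, F) \<in> chord_flip V"
  shows "near (contract f E) (contract f F)"
proof -
  obtain d d' where d: "E - F = {d}" "F - E = {d'}" using assms by (auto simp: chord_flip_def)
  have key: "contract f G \<subseteq> insert (f (fst c), f (snd c)) (contract f H)" if "G - H = {c}" for G H c
  proof
    fix e assume "e \<in> contract f G"
    then obtain i j where ij: "e = (f i, f j)" "(i, j) \<in> G" "f i < f j" by (rule contractE)
    show "e \<in> insert (f (fst c), f (snd c)) (contract f H)"
    proof (cases "(i, j) \<in> H")
      case True
      then show ?thesis using contractI[of i j H f] ij by simp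
    next
      case False
      then have "(i, j) \<in> G - H" using ij(2) by simp
      then have "(i, j) = c" unfolding that by simp
      then show ?thesis using ij by auto
    qed
  qed
  show ?thesis unfolding near_def using key[OF d(1)] key[OF d(2)] by (intro exI conjI)
qed

text \<open>So two contractions that both see a flip are both injective on the corners of its quadrilateral.\<close>

lemma contract_flip_interleaved:
  assumes EF: "(E, F) \<in> chord_flip V" and fin: "finite V" and f: "mono f"
    and ne: "contract f E \<noteq> contract f F" and d: "d \<in> E" "d \<notin> F" and d': "d' \<in> F" "d' \<notin> E"
  shows "interleaved (f (fst d), f (snd d)) (f (fst d'), f (snd d'))"
proof -
  have tri: "chord_triangulation V E" "chord_triangulation V F"
    using EF by (auto simp: chord_flip_def)
  obtain c c' where c: "E - F = {c}" "F - E = {c'}" using EF by (auto simp: chord_flip_def)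
  have u: "e = d" if "e \<in> E" "e \<notin> F" for e
    using c(1) d that by (metis DiffI singletonD)
  have u': "e = d'" if "e \<in> F" "e \<notin> E" for e
    using c(2) d' that by (metis DiffI singletonD)
  note tE = chord_triangulation_contract[OF tri(1) fin f]
  note tF = chord_triangulation_contract[OF tri(2) fin f]
  \<comment> \<open>A chord that disappears can only be the image of the removed one. Maximality
    yields a chord crossing it, which is new and hence the image of the inserted one.\<close>
  have "\<not> contract f E \<subseteq> contract f F"
    using chord_triangulation_subset_eq[OF tE tF] ne by blast
  then obtain e where e: "e \<in> contract f E" "e \<notin> contract f F" by blast
  obtain i j where ij: "e = (f i, f j)" "(i, j) \<in> E" "f i < f j" using e(1) by (rule contractE)
  have "(i, j) \<notin> F" using ij e contractI by blast
  then have ed: "e = (f (fst d), f (snd d))" using u[of "(i,j)"] ij by auto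
  obtain g where g: "g \<in> contract f F" "interleaved e g"
    using chord_triangulation_maximal[OF tF, of e] e chord_triangulation_chords[OF tE] by blast
  have gE: "g \<notin> contract f E" using chord_triangulation_noncrossing[OF tE e(1)] g(2) by blast
  obtain k l where kl: "g = (f k, f l)" "(k, l) \<in> F" "f k < f l" using g(1) by (rule contractE)
  have "(k, l) \<notin> E" using kl gE contractI by blast
  then have "g = (f (fst d'), f (snd d'))" using u'[of "(k,l)"] kl by auto
  then show ?thesis using g(2) ed by simp
qed

text \<open>The two exchanged chords cross by maximality. A chord crossing a side of the
  quadrilateral on their four ends also crosses one of them, so no chord common to \<open>E\<close>
  and \<open>F\<close> crosses a side, and maximality puts the sides into both.\<close>

lemma chord_flip_quad:
  assumes EF: "(E, F) \<in> chord_flip V"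
  shows "\<exists>p q r s. p < q \<and> q < r \<and> r < s \<and> {p, q, r, s} \<subseteq> V \<and>
     (E - F = {(p, r)} \<and> F - E = {(q, s)} \<or> E - F = {(q, s)} \<and> F - E = {(p, r)}) \<and>
     {(p, q), (q, r), (r, s), (p, s)} \<subseteq> E \<inter> F"
proof -
  have tri: "chord_triangulation V E" "chord_triangulation V F"
    using EF by (auto simp: chord_flip_def)
  obtain d d' where d: "E - F = {d}" "F - E = {d'}" using EF by (auto simp: chord_flip_def)
  have dm: "d \<in> E" "d \<notin> F" "d' \<in> F" "d' \<notin> E" using d by blast+
  obtain i j where ij: "d = (i, j)" by (cases d)
  obtain k l where kl: "d' = (k, l)" by (cases d')
  have eF: "e \<in> insert d' E" if "e \<in> F" for e using d(2) that by blast
  have "\<exists>f\<in>F. interleaved d f"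
    using chord_triangulation_maximal[OF tri(2), of d] dm chord_triangulation_chords[OF tri(1)] by blast
  then have X: "interleaved d d'"
    using chord_triangulation_noncrossing[OF tri(1), of d] dm eF by blast
  have V: "i \<in> V" "j \<in> V" "k \<in> V" "l \<in> V" "i < j" "k < l"
    using dm ij kl chord_triangulation_memD[OF tri(1), of i j] chord_triangulation_memD[OF tri(2), of k l]
    by blast+
  have main: "{(p, q), (q, r), (r, s), (p, s)} \<subseteq> E \<inter> F"
    if o: "p < q" "q < r" "r < s" and W: "{p,q,r,s} \<subseteq> V"
      and D: "d = (p, r) \<and> d' = (q, s) \<or> d = (q, s) \<and> d' = (p, r)" for p q r s
  proof -
    have nc: "\<not> interleaved e (p, r)" "\<not> interleaved e (q, s)" if "e \<in> E" "e \<in> F" for e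
      using D chord_triangulation_noncrossing[OF tri(1) that(1) dm(1)]
        chord_triangulation_noncrossing[OF tri(2) that(2) dm(3)] by blast+
    have key: "c \<in> E \<inter> F" if c: "c \<in> {(p, q), (q, r), (r, s), (p, s)}" for c
    proof -
      have 1: "\<not> interleaved c e" if "e \<in> E" "e \<in> F" for e
        using nc[OF that] c o by (cases e) auto
      have 2: "\<not> interleaved c (p, r)" "\<not> interleaved c (q, s)"
        using c o by auto
      have 3: "e \<in> E \<Longrightarrow> e \<notin> F \<Longrightarrow> e = d" "e \<in> F \<Longrightarrow> e \<notin> E \<Longrightarrow> e = d'" for e
        using d by blast+
      have E: "\<not> interleaved c e" if "e \<in> E" for e using 1[OF that] 2 3[of e] D that by blast
      have F: "\<not> interleaved c e" if "e \<in> F" for e using 1[OF _ that] 2 3[of e] D that by blast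
      have "c \<in> chords V" using c o W by auto
      then show ?thesis
        using chord_triangulation_maximal[OF tri(1) _ E] chord_triangulation_maximal[OF tri(2) _ F]
        by blast
    qed
    then show ?thesis by blast
  qed
  show ?thesis
  proof (cases "i < k")
    case True
    then have o: "i < k" "k < j" "j < l" using X ij kl by auto
    have "E - F = {(i, j)} \<and> F - E = {(k, l)}" using d ij kl by blast
    moreover have "{i, k, j, l} \<subseteq> V" using V by blast
    moreover from this have "{(i, k), (k, j), (j, l), (i, l)} \<subseteq> E \<inter> F"
      using main[OF o] ij kl by blast
    ultimately show ?thesis using o by blast
  next
    case False
    then have o: "k < i" "i < l" "l < j" using X ij kl by auto
    have "E - F = {(i, j)} \<and> F - E = {(k, l)}" using d ij kl by blast
    moreover have "{k, i, l, j} \<subseteq> V" using V by blast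
    moreover from this have "{(k, i), (i, l), (l, j), (k, j)} \<subseteq> E \<inter> F"
      using main[OF o] ij kl by blast
    ultimately show ?thesis using o by blast
  qed
qed

section \<open>Cutting along a chord and gluing\<close>

definition inner_part :: "nat set \<Rightarrow> nat \<Rightarrow> nat \<Rightarrow> nat set" where
  "inner_part V p q = V \<inter> {p..q}"

definition outer_part :: "nat set \<Rightarrow> nat \<Rightarrow> nat \<Rightarrow> nat set" where
  "outer_part V p q = V \<inter> ({..p} \<union> {q..})"

lemma near_Un': "near E F \<Longrightarrow> near (G \<union> E) (G \<union> F)"
  using near_Un[of E F G] by (simp add: Un_commute)

lemma chord_triangulation_glue:
  assumes fin: "finite V" and pq: "p \<in> V" "q \<in> V" "p < q"
    and E: "chord_triangulation (inner_part V p q) E" and F: "chord_triangulation (outer_part V p q) F"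
  shows "chord_triangulation V (E \<union> F)"
proof -
  have finI: "finite (inner_part V p q)" "finite (outer_part V p q)" using fin by (auto simp: inner_part_def outer_part_def)
  have mE: "i \<in> V \<and> j \<in> V \<and> p \<le> i \<and> i < j \<and> j \<le> q" if "(i, j) \<in> E" for i j
    using chord_triangulation_memD[OF E that] by (auto simp: inner_part_def)
  have mF: "i \<in> V \<and> j \<in> V \<and> (i \<le> p \<or> q \<le> i) \<and> i < j \<and> (j \<le> p \<or> q \<le> j)" if "(i, j) \<in> F" for i j
    using chord_triangulation_memD[OF F that] by (auto simp: outer_part_def)
  \<comment> \<open>\<open>(p, q)\<close> is the longest chord of the inner part and interleaves
    with nothing there.\<close>
  have pqE: "(p, q) \<in> E"
    using pq mE by (intro chord_triangulation_maximal[OF E]) (fastforce simp: inner_part_def interleaved_def)+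
  show "chord_triangulation V (E \<union> F)"
  proof (rule chord_triangulationI)
    show "E \<union> F \<subseteq> chords V" using mE mF by auto
    have cr: "\<not> interleaved e f" if "e \<in> E" "f \<in> F" for e f
      using mE[of "fst e" "snd e"] mF[of "fst f" "snd f"] that by (auto simp: interleaved_def)
    show "\<not> interleaved e f" if "e \<in> E \<union> F" "f \<in> E \<union> F" for e f
      using that cr cr[of f e] interleaved_sym[of e f] chord_triangulation_noncrossing[OF E]
        chord_triangulation_noncrossing[OF F] by blast
    show "\<exists>i j. (i, j) \<in> E \<union> F \<and> i \<le> x \<and> y \<le> j" if xy: "x \<in> V" "y \<in> V" "x < y" for x y
    proof (cases "p \<le> x \<and> y \<le> q")
      case True then show ?thesis using pqE by auto
    next
      case False
      \<comment> \<open>Ends lying strictly inside \<open>(p, q)\<close> are pushed outwards to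
        \<open>p\<close> or \<open>q\<close>, so that a cover found in the outer part also covers
        the original pair.\<close>
      define x' where "x' = (if p < x \<and> x < q then p else x)"
      define y' where "y' = (if p < y \<and> y < q then q else y)"
      have "x' \<in> outer_part V p q" "y' \<in> outer_part V p q" "x' < y'" "x' \<le> x" "y \<le> y'"
        using xy pq False by (auto simp: x'_def y'_def outer_part_def)
      then show ?thesis using chord_triangulation_cover[OF F finI(2), of x' y'] by (meson UnCI order_trans)
    qed
    show "\<exists>k. i < k \<and> k < j \<and> (i, k) \<in> E \<union> F \<and> (k, j) \<in> E \<union> F"
      if ij: "(i, j) \<in> E \<union> F" and v: "v \<in> V" "i < v" "v < j" for i j v
    proof (cases "(i, j) \<in> E")
      case True
      then have "v \<in> inner_part V p q" using mE[OF True] v by (auto simp: inner_part_def)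
      then show ?thesis using chord_triangulation_apex[OF E finI(1) True] v by blast
    next
      case False
      then have ijF: "(i, j) \<in> F" using ij by auto
      show ?thesis
      proof (cases "(i, j) = (p, q)")
        case True then show ?thesis using False pqE by auto
      next
        case ne: False
        \<comment> \<open>A vertex strictly between \<open>p\<close> and \<open>q\<close> is
          invisible to the outer part. As \<open>(i, j)\<close> then encloses \<open>(p, q)\<close>
          and differs from it, one of \<open>p\<close>, \<open>q\<close> lies strictly below
          \<open>(i, j)\<close> and replaces it.\<close>
        define w where "w = (if v \<in> outer_part V p q then v else if i < p then p else q)"
        have "w \<in> outer_part V p q" "i < w" "w < j"
          using v mF[OF ijF] pq ne by (auto simp: w_def outer_part_def)
        then show ?thesis using chord_triangulation_apex[OF F finI(2) ijF] by blast
      qed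
    qed
  qed
qed

lemma chord_triangulation_split:
  assumes E: "chord_triangulation V E" and pq: "(p, q) \<in> E"
  shows "chord_triangulation (inner_part V p q) (E \<inter> chords (inner_part V p q))"
    and "chord_triangulation (outer_part V p q) (E \<inter> chords (outer_part V p q))"
    and "E = (E \<inter> chords (inner_part V p q)) \<union> (E \<inter> chords (outer_part V p q))"
proof -
  have pqV: "p \<in> V" "q \<in> V" "p < q" using chord_triangulation_memD[OF E pq] by auto
  have cases: "(i, j) \<in> chords (inner_part V p q) \<or> (i, j) \<in> chords (outer_part V p q)" if "(i, j) \<in> E" for i j
    using chord_triangulation_memD[OF E that] chord_triangulation_noncrossing[OF E that pq]
    by (auto simp: inner_part_def outer_part_def)
  have cases: "e \<in> chords (inner_part V p q) \<or> e \<in> chords (outer_part V p q)" if "e \<in> E" for e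
    using cases[of "fst e" "snd e"] that by simp
  then show "E = (E \<inter> chords (inner_part V p q)) \<union> (E \<inter> chords (outer_part V p q))" by blast
  have cr: "\<not> interleaved e f" if "e \<in> chords (inner_part V p q)" "f \<in> chords (outer_part V p q)" for e f
    using that by (cases e; cases f) (auto simp: inner_part_def outer_part_def)
  have sub: "chords (inner_part V p q) \<subseteq> chords V" "chords (outer_part V p q) \<subseteq> chords V"
    by (auto simp: inner_part_def outer_part_def)
  show "chord_triangulation (inner_part V p q) (E \<inter> chords (inner_part V p q))"
    unfolding chord_triangulation_def
  proof (intro conjI ballI impI)
    fix e assume e: "e \<in> chords (inner_part V p q)" and n: "\<forall>f\<in>E \<inter> chords (inner_part V p q). \<not> interleaved e f"
    have "e \<in> E"
    proof (rule chord_triangulation_maximal[OF E])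
      show "e \<in> chords V" using e sub by auto
      show "\<not> interleaved e f" if "f \<in> E" for f
        using cases[OF that] that n cr[OF e] by blast
    qed
    then show "e \<in> E \<inter> chords (inner_part V p q)" using e by auto
  qed (use chord_triangulation_noncrossing[OF E] in auto)
  show "chord_triangulation (outer_part V p q) (E \<inter> chords (outer_part V p q))"
    unfolding chord_triangulation_def
  proof (intro conjI ballI impI)
    fix e assume e: "e \<in> chords (outer_part V p q)" and n: "\<forall>f\<in>E \<inter> chords (outer_part V p q). \<not> interleaved e f"
    have "e \<in> E"
    proof (rule chord_triangulation_maximal[OF E])
      show "e \<in> chords V" using e sub by auto
      show "\<not> interleaved e f" if "f \<in> E" for f
        using cases[OF that] that n cr[OF _ e, of f] interleaved_sym[of e f] by blast
    qed
    then show "e \<in> E \<inter> chords (outer_part V p q)" using e by auto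
  qed (use chord_triangulation_noncrossing[OF E] in auto)
qed

lemma image_retraction:
  assumes "\<And>x. x \<in> V \<Longrightarrow> f x \<in> W" "W \<subseteq> V" "\<And>x. x \<in> W \<Longrightarrow> f x = x"
  shows "f ` V = W"
  using assms by (metis image_subset_iff subsetD subsetI subset_antisym image_eqI)

text \<open>A retraction fixes every chord on its own side, so the restriction is contained in the
  contraction; both are triangulations of \<open>W\<close> and hence equal. This keeps the ends of a
  modified path unchanged.\<close>

lemma contract_restrict:
  assumes E: "chord_triangulation V E" and fin: "finite V" and f: "mono f" "f ` V = W"
    and fix': "\<And>x. x \<in> W \<Longrightarrow> f x = x" and W: "chord_triangulation W (E \<inter> chords W)"
  shows "contract f E = E \<inter> chords W"
proof -
  have "E \<inter> chords W \<subseteq> contract f E"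
    using fix' contractI[of _ _ E f] by fastforce
  then show ?thesis
    using chord_triangulation_subset_eq[OF W] chord_triangulation_contract[OF E fin f(1)] f(2) by metis
qed

text \<open>Contracted paths may stand still; only their proper steps count towards the
  length.\<close>

lemma relpow_stutter:
  fixes i j :: nat
  assumes "i \<le> j" "\<And>t. i \<le> t \<Longrightarrow> t < j \<Longrightarrow> S t = S (Suc t) \<or> (S t, S (Suc t)) \<in> R"
  shows "(S i, S j) \<in> R ^^ card {t \<in> {i..<j}. S t \<noteq> S (Suc t)}"
  using assms
proof (induction j rule: dec_induct)
  case base then show ?case by simp
next
  case (step m)
  have IH: "(S i, S m) \<in> R ^^ card {t \<in> {i..<m}. S t \<noteq> S (Suc t)}" using step by auto
  show ?case
  proof (cases "S m = S (Suc m)")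
    case True
    then have "{t \<in> {i..<Suc m}. S t \<noteq> S (Suc t)} = {t \<in> {i..<m}. S t \<noteq> S (Suc t)}"
      by (auto simp: less_Suc_eq)
    then show ?thesis using IH True by metis
  next
    case False
    then have "{t \<in> {i..<Suc m}. S t \<noteq> S (Suc t)} = insert m {t \<in> {i..<m}. S t \<noteq> S (Suc t)}"
      using step by (auto simp: less_Suc_eq)
    then have "card {t \<in> {i..<Suc m}. S t \<noteq> S (Suc t)} = Suc (card {t \<in> {i..<m}. S t \<noteq> S (Suc t)})"
      by simp
    moreover have "(S m, S (Suc m)) \<in> R" using step.prems(1)[of m] False step by auto
    ultimately show ?thesis using IH by (metis relpow_Suc_I)
  qed
qed

lemma chord_flipD:
  assumes "(E, F) \<in> chord_flip V"
  shows "chord_triangulation V E" "chord_triangulation V F"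
  using assms by (auto simp: chord_flip_def)

lemma contract_flip_injective:
  assumes EF: "(E, F) \<in> chord_flip V" and fin: "finite V" and f: "mono f"
    and ne: "contract f E \<noteq> contract f F"
    and d: "E - F = {(p, r)} \<and> F - E = {(q, s)} \<or> E - F = {(q, s)} \<and> F - E = {(p, r)}"
    and o: "p < q" "q < r" "r < s"
  shows "f p < f q" "f q < f r" "f r < f s"
proof -
  have "f p \<le> f q" "f q \<le> f r" "f r \<le> f s" using o monoD[OF f] by auto
  moreover have "interleaved (f p, f r) (f q, f s) \<or> interleaved (f q, f s) (f p, f r)"
    using d
  proof
    assume "E - F = {(p, r)} \<and> F - E = {(q, s)}"
    then have "(p, r) \<in> E" "(p, r) \<notin> F" "(q, s) \<in> F" "(q, s) \<notin> E" by blast+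
    from contract_flip_interleaved[OF EF fin f ne this] show ?thesis by simp
  next
    assume "E - F = {(q, s)} \<and> F - E = {(p, r)}"
    then have "(q, s) \<in> E" "(q, s) \<notin> F" "(p, r) \<in> F" "(p, r) \<notin> E" by blast+
    from contract_flip_interleaved[OF EF fin f ne this] show ?thesis by simp
  qed
  ultimately show "f p < f q" "f q < f r" "f r < f s" by auto
qed

lemma chord_flip_quadE:
  assumes "(E, F) \<in> chord_flip V"
  obtains p q r s where "p < q" "q < r" "r < s" "p \<in> V" "q \<in> V" "r \<in> V" "s \<in> V"
    "E - F = {(p, r)} \<and> F - E = {(q, s)} \<or> E - F = {(q, s)} \<and> F - E = {(p, r)}"
    "(p, q) \<in> E \<inter> F" "(q, r) \<in> E \<inter> F" "(r, s) \<in> E \<inter> F" "(p, s) \<in> E \<inter> F"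
  using chord_flip_quad[OF assms] by (elim exE conjE) (simp only: insert_subset)

lemma contract_flip_both:
  assumes EF: "(E, F) \<in> chord_flip V" and fin: "finite V" and f: "mono f" and g: "mono g"
    and nf: "contract f E \<noteq> contract f F" and ng: "contract g E \<noteq> contract g F"
  obtains p q r s where "p < q" "q < r" "r < s"
    "f p < f q" "f q < f r" "f r < f s" "g p < g q" "g q < g r" "g r < g s"
proof -
  obtain p q r s where o: "p < q" "q < r" "r < s"
    and d: "E - F = {(p, r)} \<and> F - E = {(q, s)} \<or> E - F = {(q, s)} \<and> F - E = {(p, r)}"
    by (rule chord_flip_quadE[OF EF])
  show ?thesis
    using that[OF o contract_flip_injective[OF EF fin f nf d o] contract_flip_injective[OF EF fin g ng d o]] .
qed

lemma relpow_shortcut: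
  assumes "i \<le> j" "\<And>t. i \<le> t \<Longrightarrow> t < j \<Longrightarrow> S t = S (Suc t) \<or> (S t, S (Suc t)) \<in> R"
    and m: "i \<le> m" "m < j" "S m = S (Suc m)"
  shows "\<exists>l<j - i. (S i, S j) \<in> R ^^ l"
proof -
  have "m \<in> {i..<j}" using m by simp
  then have "{t \<in> {i..<j}. S t \<noteq> S (Suc t)} \<subset> {i..<j}" using m(3) by blast
  then have "card {t \<in> {i..<j}. S t \<noteq> S (Suc t)} < card {i..<j}"
    by (intro psubset_card_mono) auto
  then show ?thesis using relpow_stutter[of i j S R, OF assms(1,2)] by auto
qed

section \<open>Shortcuts\<close>

text \<open>The path is replaced by the union of its contractions \<open>f\<close> and \<open>g\<close> to the two sides of the chord
  \<open>(0, b)\<close>. No flip survives both, and a flip that inserts \<open>(0, b)\<close> survives neither.\<close>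

lemma flip_shortcut_leaving_chord:
  assumes flips: "\<And>t. i \<le> t \<Longrightarrow> t < j \<Longrightarrow> (T t, T (Suc t)) \<in> chord_flip {..<n}"
    and b: "0 < b" "b < n" and ij: "(0, b) \<in> T i" "(0, b) \<in> T j"
    and m: "i \<le> m" "m \<le> j" "(0, b) \<notin> T m"
  shows "\<exists>l<j - i. (T i, T j) \<in> chord_flip {..<n} ^^ l"
proof -
  \<comment> \<open>The retractions onto the two sides of \<open>(0, b)\<close>: \<open>f\<close>
    merges everything from \<open>b\<close> on, and \<open>g\<close> merges the vertices from 1 to
    \<open>b\<close>.\<close>
  define f where "f = (\<lambda>x::nat. min x b)"
  define g where "g = (\<lambda>x. if x = 0 then 0 else max x b)"
  let ?V = "{..<n}"
  have mono: "mono f" "mono g" by (auto simp: f_def g_def mono_def)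
  have fixf: "f x = x" if "x \<in> inner_part ?V 0 b" for x using that by (simp add: f_def inner_part_def)
  have fixg: "g x = x" if "x \<in> outer_part ?V 0 b" for x using that by (auto simp add: g_def outer_part_def)
  have "f ` ?V = inner_part ?V 0 b" "g ` ?V = outer_part ?V 0 b"
    using fixf fixg b by (intro image_retraction; auto simp: f_def g_def inner_part_def outer_part_def)+
  note img = this
  have tri: "chord_triangulation ?V (T t)" if "i \<le> t" "t \<le> j" for t
  proof (cases "t < j")
    case True
    then show ?thesis using chord_flipD(1)[OF flips[of t]] that by simp
  next
    case False
    have "i < j" using ij m by (cases "i = j") auto
    then show ?thesis using chord_flipD(2)[OF flips[of "j - 1"]] that False by simp
  qed
  define N where "N t = contract f (T t) \<union> contract g (T t)" for t
  have tf: "chord_triangulation (inner_part ?V 0 b) (contract f (T t))" if "i \<le> t" "t \<le> j" for t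
    using chord_triangulation_contract[OF tri[OF that] _ mono(1)] img by simp
  have tg: "chord_triangulation (outer_part ?V 0 b) (contract g (T t))" if "i \<le> t" "t \<le> j" for t
    using chord_triangulation_contract[OF tri[OF that] _ mono(2)] img by simp
  have tN: "chord_triangulation ?V (N t)" if "i \<le> t" "t \<le> j" for t
    unfolding N_def using chord_triangulation_glue[OF _ _ _ _ tf[OF that] tg[OF that]] b by simp
  have keep: "N t = T t" if t: "i \<le> t" "t \<le> j" "(0, b) \<in> T t" for t
  proof -
    note tr = tri[OF t(1,2)]
    note sp = chord_triangulation_split[OF tr t(3)]
    have "contract f (T t) = T t \<inter> chords (inner_part ?V 0 b)"
      using contract_restrict[OF tr finite_lessThan mono(1) img(1) fixf sp(1)] .
    moreover have "contract g (T t) = T t \<inter> chords (outer_part ?V 0 b)"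
      using contract_restrict[OF tr finite_lessThan mono(2) img(2) fixg sp(2)] .
    ultimately show ?thesis unfolding N_def using sp(3) by simp
  qed
  have step: "N t = N (Suc t) \<or> (N t, N (Suc t)) \<in> chord_flip ?V" if t: "i \<le> t" "t < j" for t
  proof -
    note fl = flips[OF t]
    have "contract f (T t) = contract f (T (Suc t)) \<or> contract g (T t) = contract g (T (Suc t))"
    proof (rule ccontr)
      assume c: "\<not> ?thesis"
      then obtain p q r s where q: "p < q" "q < r" "r < s" "f r < f s" "g q < g r"
        using contract_flip_both[OF fl finite_lessThan mono] by metis
      \<comment> \<open>\<open>f r < f s\<close> forces \<open>r < b\<close>, whereas
        \<open>q > 0\<close> and \<open>g q < g r\<close> force \<open>r > b\<close>.\<close>
      then show False by (auto simp: f_def g_def split: if_splits)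
    qed
    then have "near (N t) (N (Suc t))"
      using near_Un[OF near_contract[OF fl, of f], of "contract g (T t)"]
        near_Un'[OF near_contract[OF fl, of g], of "contract f (T t)"]
      unfolding N_def by (elim disjE) simp_all
    then show ?thesis using near_flip[OF tN[of t] tN[of "Suc t"]] t by simp
  qed
  have "\<exists>t. m \<le> t \<and> t < j \<and> (0, b) \<notin> T t \<and> (0, b) \<in> T (Suc t)"
  proof (rule ccontr)
    assume a: "\<not> ?thesis"
    have "(0, b) \<notin> T t" if "m \<le> t" "t \<le> j" for t
      using that
    proof (induction t rule: dec_induct)
      case base show ?case using m by simp
    next
      case (step u) then show ?case using a by (metis Suc_leD Suc_le_lessD)
    qed
    then show False using ij(2) m by blast
  qed
  then obtain t where t: "m \<le> t" "t < j" "(0, b) \<notin> T t" "(0, b) \<in> T (Suc t)" by blast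
  then have ti: "i \<le> t" using m by auto
  note fl = flips[OF ti t(2)]
  obtain d where d: "d \<in> T t" "d \<notin> T (Suc t)" using fl unfolding chord_flip_def by blast
  \<comment> \<open>The inserted chord \<open>(0, b)\<close> is fixed by both maps. It joins the
    extreme vertices of the inner part and consecutive vertices of the outer part, so it crosses
    nothing in either image and the flip is invisible in both.\<close>
  have "contract f (T t) = contract f (T (Suc t))"
  proof (rule ccontr)
    assume "\<not> ?thesis"
    from contract_flip_interleaved[OF fl finite_lessThan mono(1) this d t(4,3)]
    show False by (auto simp: f_def interleaved_def)
  qed
  moreover have "contract g (T t) = contract g (T (Suc t))"
  proof (rule ccontr)
    assume "\<not> ?thesis"
    from contract_flip_interleaved[OF fl finite_lessThan mono(2) this d t(4,3)] b
    show False by (auto simp: g_def interleaved_def split: if_splits)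
  qed
  ultimately have "N t = N (Suc t)" by (simp add: N_def)
  then have "\<exists>l<j - i. (N i, N j) \<in> chord_flip ?V ^^ l"
    using relpow_shortcut[of i j N, OF _ step ti t(2)] m by simp
  then show ?thesis using keep[of i] keep[of j] ij m by simp
qed

text \<open>The triangle on the far side of \<open>(c, a)\<close>. The shortest chord properly
  enclosing \<open>(c, a)\<close> has an apex; it cannot lie strictly between \<open>c\<close> and
  \<open>a\<close> without a crossing, and by minimality it is \<open>c\<close> or \<open>a\<close>.
  The vertex \<open>b\<close> guarantees that a proper enclosing chord exists.\<close>

lemma chord_triangulation_outer_apex:
  assumes E: "chord_triangulation V E" and fin: "finite V" and ca: "(c, a) \<in> E"
    and b: "b \<in> V" "b < c"
  shows "\<exists>v\<in>V. v < c \<and> (v, c) \<in> E \<and> (v, a) \<in> E \<or> a < v \<and> (c, v) \<in> E \<and> (a, v) \<in> E"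
proof -
  have V: "c \<in> V" "a \<in> V" "c < a" using chord_triangulation_memD[OF E ca] by auto
  let ?P = "\<lambda>e. e \<in> E \<and> fst e \<le> c \<and> a \<le> snd e \<and> e \<noteq> (c, a)"
  obtain i' j' where "(i', j') \<in> E" "i' \<le> b" "a \<le> j'"
    using chord_triangulation_cover[OF E fin b(1) V(2)] b V by auto
  then have "?P (i', j')" using b by auto
  from ex_has_least_nat[of ?P, OF this, of "\<lambda>e. snd e - fst e"]
  obtain e0 where e0: "?P e0" and least: "\<And>e'. ?P e' \<Longrightarrow> snd e0 - fst e0 \<le> snd e' - fst e'"
    by blast
  obtain x y where xy: "e0 = (x, y)" by (cases e0)
  have E0: "(x, y) \<in> E" "x \<le> c" "a \<le> y" "x < c \<or> a < y" using e0 xy by auto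
  have "\<exists>v\<in>V. x < v \<and> v < y"
  proof (cases "x < c")
    case True then show ?thesis using V E0 by (intro bexI[of _ c]) auto
  next
    case False then show ?thesis using V E0 by (intro bexI[of _ a]) auto
  qed
  then obtain k where k: "x < k" "k < y" "(x, k) \<in> E" "(k, y) \<in> E"
    using chord_triangulation_apex[OF E fin E0(1)] by blast
  have kV: "x \<in> V" "y \<in> V" using chord_triangulation_memD[OF E E0(1)] by auto
  have nc: "\<not> interleaved (x, k) (c, a)" "\<not> interleaved (k, y) (c, a)"
    using chord_triangulation_noncrossing[OF E _ ca] k by auto
  consider "k \<le> c" | "a \<le> k" | "c < k" "k < a" by linarith
  then show ?thesis
  proof cases
    case 1
    then have "(k, y) = (c, a)" using least[of "(k, y)"] k E0 xy by (cases "(k, y) = (c, a)") auto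
    then show ?thesis using k E0 kV by (intro bexI[of _ x]) auto
  next
    case 2
    then have "(x, k) = (c, a)" using least[of "(x, k)"] k E0 xy by (cases "(x, k) = (c, a)") auto
    then show ?thesis using k E0 kV by (intro bexI[of _ y]) auto
  next
    case 3
    then show ?thesis using nc E0 by auto
  qed
qed

text \<open>A triangle that appears in a flip has the inserted diagonal as a side, and its third
  corner is one of the two remaining corners of the quadrilateral because any other would cross a
  side. The four alternatives record which diagonal was removed and which half appears.\<close>

lemma chord_flip_new_triangle:
  assumes EF: "(E, F) \<in> chord_flip V" and o: "u < v" "v < w"
    and F: "(u, v) \<in> F" "(v, w) \<in> F" "(u, w) \<in> F"
    and E: "\<not> ((u, v) \<in> E \<and> (v, w) \<in> E \<and> (u, w) \<in> E)"
  obtains p q r s where "p < q" "q < r" "r < s" "p \<in> V" "q \<in> V" "r \<in> V" "s \<in> V"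
    "E - F = {(p, r)} \<and> F - E = {(q, s)} \<or> E - F = {(q, s)} \<and> F - E = {(p, r)}"
    "(p, q) \<in> E" "(q, r) \<in> E" "(r, s) \<in> E" "(p, s) \<in> E"
    "(p, r) \<in> E \<and> (u = p \<and> v = q \<and> w = s \<or> u = q \<and> v = r \<and> w = s) \<or>
     (q, s) \<in> E \<and> (u = p \<and> v = q \<and> w = r \<or> u = p \<and> v = r \<and> w = s)"
proof -
  obtain p q r s where Q: "p < q" "q < r" "r < s" "p \<in> V" "q \<in> V" "r \<in> V" "s \<in> V"
    and D: "E - F = {(p, r)} \<and> F - E = {(q, s)} \<or> E - F = {(q, s)} \<and> F - E = {(p, r)}"
    and S: "(p, q) \<in> E \<inter> F" "(q, r) \<in> E \<inter> F" "(r, s) \<in> E \<inter> F" "(p, s) \<in> E \<inter> F"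
    by (rule chord_flip_quadE[OF EF])
  have S': "(p, q) \<in> F" "(q, r) \<in> F" "(r, s) \<in> F" "(p, s) \<in> F"
    "(p, q) \<in> E" "(q, r) \<in> E" "(r, s) \<in> E" "(p, s) \<in> E" using S by blast+
  note nc = chord_triangulation_noncrossing[OF chord_flipD(2)[OF EF]]
  have "(p, r) \<in> E \<and> (u = p \<and> v = q \<and> w = s \<or> u = q \<and> v = r \<and> w = s) \<or>
     (q, s) \<in> E \<and> (u = p \<and> v = q \<and> w = r \<or> u = p \<and> v = r \<and> w = s)"
    using D
  proof
    assume A: "E - F = {(p, r)} \<and> F - E = {(q, s)}"
    then have pr: "(p, r) \<in> E" by blast
    have "(u, v) = (q, s) \<or> (v, w) = (q, s) \<or> (u, w) = (q, s)" using A E F by blast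
    then show ?thesis
    proof (elim disjE)
      assume e: "(u, v) = (q, s)"
      then show ?thesis using nc[OF S'(4) F(3)] Q o by simp
    next
      assume e: "(v, w) = (q, s)"
      then have "u = p" using nc[OF F(1) S'(4)] nc[OF S'(1) F(3)] Q o by simp
      then show ?thesis using e pr by simp
    next
      assume e: "(u, w) = (q, s)"
      then have "v = r" using nc[OF S'(2) F(2)] nc[OF F(1) S'(3)] Q o by simp
      then show ?thesis using e pr by simp
    qed
  next
    assume A: "E - F = {(q, s)} \<and> F - E = {(p, r)}"
    then have qs: "(q, s) \<in> E" by blast
    have "(u, v) = (p, r) \<or> (v, w) = (p, r) \<or> (u, w) = (p, r)" using A E F by blast
    then show ?thesis
    proof (elim disjE)
      assume e: "(u, v) = (p, r)"
      then have "w = s" using nc[OF F(3) S'(3)] nc[OF F(2) S'(4)] Q o by simp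
      then show ?thesis using e qs by simp
    next
      assume e: "(v, w) = (p, r)"
      then show ?thesis using nc[OF F(3) S'(4)] Q o by simp
    next
      assume e: "(u, w) = (p, r)"
      then have "v = q" using nc[OF F(2) S'(1)] nc[OF F(1) S'(2)] Q o by simp
      then show ?thesis using e qs by simp
    qed
  qed
  from that[OF Q D S'(5-8) this] show ?thesis .
qed

text \<open>Here \<open>P\<close> is a path from \<open>T i\<close> to a triangulation that contains the triangle \<open>0, c, a\<close>, and \<open>Q\<close>
  leads from there to \<open>T j\<close>. The part between \<open>c\<close> and \<open>a\<close> follows \<open>T\<close> up to
  time \<open>m\<close> in \<open>P\<close> and from time \<open>m\<close> on in \<open>Q\<close>, and is that of \<open>T m\<close> otherwise. No flip of \<open>T\<close> survives in both paths. If each flip survived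
  in one of them, then the triangle at \<open>(c, a)\<close> facing \<open>0\<close> could not have its apex beyond \<open>a\<close> at a
  time \<open>t \<le> m\<close> (invariant \<open>up\<close>), nor between \<open>0\<close> and \<open>c\<close> at a time \<open>t \<ge> m\<close> (invariant \<open>down\<close>), so
  that at time \<open>m\<close> its apex would be \<open>0\<close>.\<close>

lemma flip_shortcut_triangle:
  assumes flips: "\<And>t. i \<le> t \<Longrightarrow> t < j \<Longrightarrow> (T t, T (Suc t)) \<in> chord_flip {..<n}"
    and o: "0 < c" "c < a" "a < n" and m: "i \<le> m" "m \<le> j"
    and Ti: "(0, a) \<in> T i" and Tm: "(c, a) \<in> T m" and Tj: "(0, c) \<in> T j"
    and none: "\<And>t. i \<le> t \<Longrightarrow> t \<le> j \<Longrightarrow> \<not> ((0, c) \<in> T t \<and> (c, a) \<in> T t \<and> (0, a) \<in> T t)"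
  shows "\<exists>l<j - i. (T i, T j) \<in> chord_flip {..<n} ^^ l"
proof -
  let ?V = "{..<n}"
  \<comment> \<open>The images are the part cut off by \<open>(0, a)\<close>, the same without the
    vertices strictly between \<open>c\<close> and \<open>a\<close>, the far side of
    \<open>(0, c)\<close> without those vertices, and the whole far side of
    \<open>(0, c)\<close>.\<close>
  define f1 where "f1 = (\<lambda>x::nat. min x a)"
  define f2 where "f2 = (\<lambda>x. if x \<le> c then x else a)"
  define g1 where "g1 = (\<lambda>x. if x = 0 then 0 else if x < a then c else x)"
  define g2 where "g2 = (\<lambda>x. if x = 0 then 0 else max x c)"
  note fg = f1_def f2_def g1_def g2_def and parts = inner_part_def outer_part_def
  have mono: "mono f1" "mono f2" "mono g1" "mono g2" using o by (auto simp: fg mono_def)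
  have fixs: "x \<in> inner_part ?V 0 a \<Longrightarrow> f1 x = x"
    "x \<in> outer_part (inner_part ?V 0 a) c a \<Longrightarrow> f2 x = x"
    "x \<in> outer_part (outer_part ?V 0 c) c a \<Longrightarrow> g1 x = x"
    "x \<in> outer_part ?V 0 c \<Longrightarrow> g2 x = x" for x
    using o by (auto simp: fg parts)
  have img: "f1 ` ?V = inner_part ?V 0 a" "f2 ` ?V = outer_part (inner_part ?V 0 a) c a"
     "g1 ` ?V = outer_part (outer_part ?V 0 c) c a" "g2 ` ?V = outer_part ?V 0 c"
    by (intro image_retraction fixs; use o in \<open>auto simp: fg parts\<close>)+
  have "i < j"
  proof (rule ccontr)
    assume "\<not> i < j"
    then have "i = m" "j = m" using m by auto
    then show False using none[of m] Ti Tm Tj m by auto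
  qed
  have tri: "chord_triangulation ?V (T t)" if "i \<le> t" "t \<le> j" for t
  proof (cases "t < j")
    case True
    then show ?thesis using chord_flipD(1)[OF flips[of t]] that by simp
  next
    case False
    then show ?thesis using chord_flipD(2)[OF flips[of "j - 1"]] that \<open>i < j\<close> by simp
  qed
  define RA where "RA = T i \<inter> chords (outer_part ?V 0 a)"
  define RB where "RB = T j \<inter> chords (inner_part ?V 0 c)"
  define RC where "RC = T m \<inter> chords (inner_part ?V c a)"
  have ij: "i \<le> j" "i \<le> i" "j \<le> j" using m by auto
  have tRA: "chord_triangulation (outer_part ?V 0 a) RA"
    unfolding RA_def using chord_triangulation_split(2)[OF tri[OF ij(2,1)] Ti] .
  have tRB: "chord_triangulation (inner_part ?V 0 c) RB"
    unfolding RB_def using chord_triangulation_split(1)[OF tri[OF ij(1,3)] Tj] .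
  have tRC: "chord_triangulation (inner_part ?V c a) RC"
    unfolding RC_def using chord_triangulation_split(1)[OF tri[OF m] Tm] .
  have eqC: "inner_part (inner_part ?V 0 a) c a = inner_part ?V c a"
    "inner_part (outer_part ?V 0 c) c a = inner_part ?V c a"
    using o by (auto simp: parts)
  have tf1: "chord_triangulation (inner_part ?V 0 a) (contract f1 (T t))"
    and tf2: "chord_triangulation (inner_part ?V 0 a) (RC \<union> contract f2 (T t))"
    and tg1: "chord_triangulation (outer_part ?V 0 c) (RC \<union> contract g1 (T t))"
    and tg2: "chord_triangulation (outer_part ?V 0 c) (contract g2 (T t))"
    if t: "i \<le> t" "t \<le> j" for t
  proof -
    note c = chord_triangulation_contract[OF tri[OF t] finite_lessThan]
    show "chord_triangulation (inner_part ?V 0 a) (contract f1 (T t))"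
      using c[OF mono(1)] img by simp
    show "chord_triangulation (outer_part ?V 0 c) (contract g2 (T t))"
      using c[OF mono(4)] img by simp
    show "chord_triangulation (inner_part ?V 0 a) (RC \<union> contract f2 (T t))"
    proof (rule chord_triangulation_glue[of _ c a])
      show "chord_triangulation (outer_part (inner_part ?V 0 a) c a) (contract f2 (T t))"
        using c[OF mono(2)] img by simp
    qed (use o tRC eqC in \<open>auto simp: inner_part_def\<close>)
    show "chord_triangulation (outer_part ?V 0 c) (RC \<union> contract g1 (T t))"
    proof (rule chord_triangulation_glue[of _ c a])
      show "chord_triangulation (outer_part (outer_part ?V 0 c) c a) (contract g1 (T t))"
        using c[OF mono(3)] img by simp
    qed (use o tRC eqC in \<open>auto simp: outer_part_def\<close>)
  qed
  have ncm: "\<not> interleaved (x, y) (c, a)" if "(x, y) \<in> T m" for x y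
    using chord_triangulation_noncrossing[OF tri[OF m] that Tm] .
  have RCI: "(x, y) \<in> RC" if "(x, y) \<in> T m" "c \<le> x" "y \<le> a" for x y
    using that o chord_triangulation_memD[OF tri[OF m] that(1)] by (auto simp: RC_def inner_part_def)
  \<comment> \<open>At time \<open>m\<close> the chord \<open>(c, a)\<close> is present, so freezing
    the part below it changes nothing. This allows both paths to switch contractions at
    \<open>m\<close>.\<close>
  have "contract f1 (T m) \<subseteq> RC \<union> contract f2 (T m)"
  proof
    fix e assume "e \<in> contract f1 (T m)"
    then obtain x y where e: "e = (f1 x, f1 y)" "(x, y) \<in> T m" "f1 x < f1 y" by (rule contractE)
    then have "x < a" "x < y" by (auto simp: f1_def min_def split: if_splits)
    then consider "y \<le> c" | "c \<le> x" "y \<le> a" | "x = c" "a < y" | "x < c" "a \<le> y"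
      using ncm[OF e(2)] by fastforce
    then show "e \<in> RC \<union> contract f2 (T m)"
    proof cases
      case 1
      then have "f1 x = f2 x" "f1 y = f2 y" using o \<open>x < y\<close> by (auto simp: fg)
      then show ?thesis using contractI[OF e(2), of f2] e by simp
    next
      case 2
      then have "f1 x = x" "f1 y = y" using \<open>x < a\<close> by (auto simp: fg)
      then show ?thesis using RCI[OF e(2) 2] e(1) by simp
    next
      case 3
      then have "e = (c, a)" using e(1) o by (auto simp: fg)
      then show ?thesis using RCI[OF Tm] by simp
    next
      case 4
      then have "f1 x = f2 x" "f1 y = f2 y" using o \<open>x < y\<close> by (auto simp: fg)
      then show ?thesis using contractI[OF e(2), of f2] e by simp
    qed
  qed
  then have J1: "contract f1 (T m) = RC \<union> contract f2 (T m)"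
    by (rule chord_triangulation_subset_eq[OF tf1[OF m] tf2[OF m]])
  have "contract g2 (T m) \<subseteq> RC \<union> contract g1 (T m)"
  proof
    fix e assume "e \<in> contract g2 (T m)"
    then obtain x y where e: "e = (g2 x, g2 y)" "(x, y) \<in> T m" "g2 x < g2 y" by (rule contractE)
    then have "x < y" by (auto simp: g2_def split: if_splits)
    then consider "c \<le> x" "y \<le> a" | "y < c" | "a \<le> x" | "x < c" "a \<le> y" | "x = c" "a < y" | "x < c" "y = c"
      using ncm[OF e(2)] by fastforce
    then show "e \<in> RC \<union> contract g1 (T m)"
    proof cases
      case 1
      then have "g2 x = x" "g2 y = y" using o \<open>x < y\<close> by (auto simp: fg)
      then show ?thesis using RCI[OF e(2) 1] e(1) by simp
    qed (use e o \<open>x < y\<close> contractI[OF e(2), of g1] in \<open>auto simp: fg max_def split: if_splits\<close>)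
  qed
  then have J2: "contract g2 (T m) = RC \<union> contract g1 (T m)"
    by (rule chord_triangulation_subset_eq[OF tg2[OF m] tg1[OF m]])
  define P where "P t = (if t < m then contract f1 (T t) else RC \<union> contract f2 (T t)) \<union> RA" for t
  define Q where "Q t = RB \<union> (if t < m then RC \<union> contract g1 (T t) else contract g2 (T t))" for t
  have P1: "P t = contract f1 (T t) \<union> RA" if "t \<le> m" for t
    using that J1 by (cases "t = m") (auto simp: P_def)
  have P2: "P t = (RC \<union> contract f2 (T t)) \<union> RA" if "m \<le> t" for t
    using that by (auto simp: P_def)
  have Q1: "Q t = RB \<union> (RC \<union> contract g1 (T t))" if "t \<le> m" for t
    using that J2 by (cases "t = m") (auto simp: Q_def)
  have Q2: "Q t = RB \<union> contract g2 (T t)" if "m \<le> t" for t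
    using that by (auto simp: Q_def)
  have tP: "chord_triangulation ?V (P t)" and tQ: "chord_triangulation ?V (Q t)"
    if t: "i \<le> t" "t \<le> j" for t
  proof -
    show "chord_triangulation ?V (P t)"
      unfolding P_def by (rule chord_triangulation_glue[of _ 0 a])
        (use o tRA tf1[OF t] tf2[OF t] in auto)
    show "chord_triangulation ?V (Q t)"
      unfolding Q_def by (rule chord_triangulation_glue[of _ 0 c])
        (use o tRB tg1[OF t] tg2[OF t] in auto)
  qed
  define chP where "chP t = (if t < m then contract f1 (T t) \<noteq> contract f1 (T (Suc t))
     else contract f2 (T t) \<noteq> contract f2 (T (Suc t)))" for t
  define chQ where "chQ t = (if t < m then contract g1 (T t) \<noteq> contract g1 (T (Suc t))
     else contract g2 (T t) \<noteq> contract g2 (T (Suc t)))" for t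
  have chP: "chP t" if "P t \<noteq> P (Suc t)" for t
    using that P1[of t] P1[of "Suc t"] P2[of t] P2[of "Suc t"] by (cases "t < m") (auto simp: chP_def)
  have chQ: "chQ t" if "Q t \<noteq> Q (Suc t)" for t
    using that Q1[of t] Q1[of "Suc t"] Q2[of t] Q2[of "Suc t"] by (cases "t < m") (auto simp: chQ_def)
  \<comment> \<open>A flip seen by \<open>f1\<close> has its third corner \<open>r\<close> before
    \<open>a\<close>, one seen by \<open>g1\<close> has \<open>r\<close> at least \<open>a\<close>.
    After time \<open>m\<close> the conditions from \<open>f2\<close> and \<open>g2\<close> are that
    \<open>r\<close> is at most \<open>c\<close> and that it is beyond \<open>c\<close>.\<close>
  have notboth: "\<not> (chP t \<and> chQ t)" if t: "i \<le> t" "t < j" for t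
  proof
    assume c: "chP t \<and> chQ t"
    note both = contract_flip_both[OF flips[OF t] finite_lessThan]
    show False
    proof (cases "t < m")
      case True
      then have "contract f1 (T t) \<noteq> contract f1 (T (Suc t))" "contract g1 (T t) \<noteq> contract g1 (T (Suc t))"
        using c by (auto simp: chP_def chQ_def)
      then obtain p q r s where "p < q" "q < r" "r < s" "f1 r < f1 s" "g1 p < g1 q" "g1 q < g1 r"
        using both[OF mono(1,3)] by metis
      then show False by (auto simp: fg split: if_splits)
    next
      case False
      then have "contract f2 (T t) \<noteq> contract f2 (T (Suc t))" "contract g2 (T t) \<noteq> contract g2 (T (Suc t))"
        using c by (auto simp: chP_def chQ_def)
      then obtain p q r s where "p < q" "q < r" "r < s" "f2 r < f2 s" "g2 p < g2 q" "g2 q < g2 r"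
        using both[OF mono(2,4)] by metis
      then show False by (auto simp: fg split: if_splits)
    qed
  qed
  have stepP: "P t = P (Suc t) \<or> (P t, P (Suc t)) \<in> chord_flip ?V"
    and stepQ: "Q t = Q (Suc t) \<or> (Q t, Q (Suc t)) \<in> chord_flip ?V" if t: "i \<le> t" "t < j" for t
  proof -
    note nr = near_contract[OF flips[OF t]]
    have "near (P t) (P (Suc t)) \<and> near (Q t) (Q (Suc t))"
    proof (cases "t < m")
      case True
      then have "t \<le> m" "Suc t \<le> m" by auto
      then show ?thesis by (simp only: P1 Q1) (intro conjI near_Un near_Un' nr)
    next
      case False
      then have "m \<le> t" "m \<le> Suc t" by auto
      then show ?thesis by (simp only: P2 Q2) (intro conjI near_Un near_Un' nr)
    qed
    then show "P t = P (Suc t) \<or> (P t, P (Suc t)) \<in> chord_flip ?V"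
      "Q t = Q (Suc t) \<or> (Q t, Q (Suc t)) \<in> chord_flip ?V"
      using near_flip tP[of t] tP[of "Suc t"] tQ[of t] tQ[of "Suc t"] t by simp_all
  qed
  have Pi: "P i = T i"
  proof -
    note tr = tri[OF ij(2,1)]
    note sp = chord_triangulation_split[OF tr Ti]
    have "contract f1 (T i) = T i \<inter> chords (inner_part ?V 0 a)"
      using contract_restrict[OF tr finite_lessThan mono(1) img(1) fixs(1) sp(1)] .
    then show ?thesis using P1[OF m(1)] sp(3) by (simp add: RA_def)
  qed
  have Qj: "Q j = T j"
  proof -
    note tr = tri[OF ij(1,3)]
    note sp = chord_triangulation_split[OF tr Tj]
    have "contract g2 (T j) = T j \<inter> chords (outer_part ?V 0 c)"
      using contract_restrict[OF tr finite_lessThan mono(4) img(4) fixs(4) sp(2)] .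
    then show ?thesis using Q2[OF m(2)] sp(3) by (simp add: RB_def)
  qed
  \<comment> \<open>The meeting point of the two paths: \<open>RA\<close>, \<open>RB\<close> and
    \<open>RC\<close> glued around the triangle \<open>0, c, a\<close>. The chord
    \<open>(0, c)\<close> of \<open>T j\<close> reduces \<open>contract f2 (T j)\<close> to
    \<open>RB\<close> and two sides of this triangle.\<close>
  have "P j \<subseteq> Q i"
  proof -
    have 1: "(0, a) \<in> contract g1 (T i)" using contractI[OF Ti, of g1] o by (simp add: g1_def)
    have 2: "(c, a) \<in> RC" using RCI[OF Tm] by simp
    have "contract f2 (T j) \<subseteq> RB \<union> {(0, a), (c, a)}"
    proof
      fix e assume "e \<in> contract f2 (T j)"
      then obtain x y where e: "e = (f2 x, f2 y)" "(x, y) \<in> T j" "f2 x < f2 y" by (rule contractE)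
      have xy: "x < y" "y < n" using chord_triangulation_memD[OF tri[OF ij(1,3)] e(2)] by auto
      have "\<not> interleaved (x, y) (0, c)"
        using chord_triangulation_noncrossing[OF tri[OF ij(1,3)] e(2) Tj] .
      then consider "y \<le> c" | "x = 0" "c < y" | "x = c" "c < y" | "c < x" using xy by fastforce
      then show "e \<in> RB \<union> {(0, a), (c, a)}"
      proof cases
        case 1
        then have "e = (x, y)" using e xy by (auto simp: f2_def)
        then show ?thesis using e(2) 1 xy o by (auto simp: RB_def inner_part_def)
      qed (use e o xy in \<open>auto simp: f2_def\<close>)
    qed
    moreover have "RA \<subseteq> contract g1 (T i)"
    proof
      fix e assume e: "e \<in> RA"
      obtain x y where xy: "e = (x, y)" by (cases e)
      have T: "(x, y) \<in> T i" "x = 0 \<or> a \<le> x" "a \<le> y" "x < y"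
        using e xy o by (auto simp: RA_def outer_part_def)
      then have "g1 x = x" "g1 y = y" by (auto simp: g1_def)
      then show "e \<in> contract g1 (T i)" using contractI[OF T(1), of g1] T xy by simp
    qed
    ultimately show ?thesis
      using 1 2 P2[OF m(2)] Q1[OF m(1)] by blast
  qed
  then have mid: "P j = Q i"
    by (rule chord_triangulation_subset_eq[OF tP[OF ij(1,3)] tQ[OF ij(2,1)]])
  have "\<exists>t. i \<le> t \<and> t < j \<and> \<not> chP t \<and> \<not> chQ t"
  proof (rule ccontr)
    assume "\<not> ?thesis"
    then have ch: "chP t \<or> chQ t" if "i \<le> t" "t < j" for t using that by blast
    have up: "\<not> ((c, a) \<in> T t \<and> (a, x) \<in> T t \<and> (c, x) \<in> T t)" if "i \<le> t" "t \<le> m" "a < x" for t x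
      using that
    proof (induction t arbitrary: x rule: dec_induct)
      case base
      have "interleaved (0, a) (c, x)" using o base by simp
      then show ?case using chord_triangulation_noncrossing[OF tri[OF ij(2,1)] Ti] by blast
    next
      case (step t)
      have t: "i \<le> t" "t < j" "t < m" using step m by auto
      have IH: "\<not> ((c, a) \<in> T t \<and> (a, x) \<in> T t \<and> (c, x) \<in> T t)" if "a < x" for x
        using step.IH[of x] that t by simp
      show ?case
      proof
        assume F: "(c, a) \<in> T (Suc t) \<and> (a, x) \<in> T (Suc t) \<and> (c, x) \<in> T (Suc t)"
        have nE: "\<not> ((c, a) \<in> T t \<and> (a, x) \<in> T t \<and> (c, x) \<in> T t)" using IH step.prems by simp
        obtain p q r s where q: "p < q" "q < r" "r < s" "p \<in> ?V" "q \<in> ?V" "r \<in> ?V" "s \<in> ?V"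
          and D: "T t - T (Suc t) = {(p, r)} \<and> T (Suc t) - T t = {(q, s)} \<or>
            T t - T (Suc t) = {(q, s)} \<and> T (Suc t) - T t = {(p, r)}"
          and S: "(p, q) \<in> T t" "(q, r) \<in> T t" "(r, s) \<in> T t" "(p, s) \<in> T t"
          and C: "(p, r) \<in> T t \<and> (c = p \<and> a = q \<and> x = s \<or> c = q \<and> a = r \<and> x = s) \<or>
            (q, s) \<in> T t \<and> (c = p \<and> a = q \<and> x = r \<or> c = p \<and> a = r \<and> x = s)"
          using F by (elim conjE) (rule chord_flip_new_triangle[OF flips[OF t(1,2)] o(2) step.prems(2) _ _ _ nE])
        \<comment> \<open>The flip producing the forbidden triangle must be seen by
          \<open>f1\<close> or \<open>g1\<close>. In the cases not settled by the induction
          hypothesis or by \<open>none\<close>, both maps merge corners of its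
          quadrilateral.\<close>
        have inj: "f1 r < f1 s \<or> g1 p < g1 q"
          using ch[OF t(1,2)] t(3) contract_flip_injective[OF flips[OF t(1,2)] finite_lessThan _ _ D q(1-3)] mono
          unfolding chP_def chQ_def by auto
        show False using C
        proof (elim disjE conjE)
          assume "(p, r) \<in> T t" "c = p" "a = q" "x = s"
          then show False using IH[of r] S q by auto
        next
          assume h: "(p, r) \<in> T t" "c = q" "a = r" "x = s"
          show False
          proof (cases "p = 0")
            case True
            then show False using none[of t] h S t by auto
          next
            case False
            then show False using inj h q by (auto simp: fg)
          qed
        next
          assume "(q, s) \<in> T t" "c = p" "a = q" "x = r"
          then show False using IH[of s] S q by auto
        next
          assume "(q, s) \<in> T t" "c = p" "a = r" "x = s"
          then show False using inj q o by (auto simp: fg)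
        qed
      qed
    qed
    \<comment> \<open>The same argument read backwards in time from \<open>j\<close>, with
      \<open>f2\<close> and \<open>g2\<close>. It starts because \<open>(0, c)\<close> is present at
      time \<open>j\<close> and would cross \<open>(y, a)\<close>.\<close>
    have down: "\<not> ((y, c) \<in> T t \<and> (c, a) \<in> T t \<and> (y, a) \<in> T t)" if "m \<le> t" "t \<le> j" "0 < y" "y < c" for t y
      using that(2,1,3,4)
    proof (induction t arbitrary: y rule: inc_induct)
      case base
      have "interleaved (0, c) (y, a)" using o base by simp
      then show ?case using chord_triangulation_noncrossing[OF tri[OF ij(1,3)] Tj] by blast
    next
      case (step t)
      have t: "i \<le> t" "t < j" "\<not> t < m" using step m by auto
      have IH: "\<not> ((y, c) \<in> T (Suc t) \<and> (c, a) \<in> T (Suc t) \<and> (y, a) \<in> T (Suc t))" if "0 < y" "y < c" for y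
        using step.IH[of y] that step.prems by simp
      have fl: "(T (Suc t), T t) \<in> chord_flip ?V" using flips[OF t(1,2)] by (simp add: chord_flip_sym)
      show ?case
      proof
        assume F: "(y, c) \<in> T t \<and> (c, a) \<in> T t \<and> (y, a) \<in> T t"
        have nE: "\<not> ((y, c) \<in> T (Suc t) \<and> (c, a) \<in> T (Suc t) \<and> (y, a) \<in> T (Suc t))" using IH step.prems by simp
        obtain p q r s where q: "p < q" "q < r" "r < s" "p \<in> ?V" "q \<in> ?V" "r \<in> ?V" "s \<in> ?V"
          and D: "T (Suc t) - T t = {(p, r)} \<and> T t - T (Suc t) = {(q, s)} \<or>
            T (Suc t) - T t = {(q, s)} \<and> T t - T (Suc t) = {(p, r)}"
          and S: "(p, q) \<in> T (Suc t)" "(q, r) \<in> T (Suc t)" "(r, s) \<in> T (Suc t)" "(p, s) \<in> T (Suc t)"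
          and C: "(p, r) \<in> T (Suc t) \<and> (y = p \<and> c = q \<and> a = s \<or> y = q \<and> c = r \<and> a = s) \<or>
            (q, s) \<in> T (Suc t) \<and> (y = p \<and> c = q \<and> a = r \<or> y = p \<and> c = r \<and> a = s)"
          using F by (elim conjE) (rule chord_flip_new_triangle[OF fl step.prems(3) o(2) _ _ _ nE])
        have inj: "f2 r < f2 s \<or> g2 p < g2 q"
          using ch[OF t(1,2)] t(3) contract_flip_injective[OF fl finite_lessThan _ _ D q(1-3)] mono
          unfolding chP_def chQ_def by fastforce
        show False using C
        proof (elim disjE conjE)
          assume "(p, r) \<in> T (Suc t)" "y = p" "c = q" "a = s"
          then show False using inj step.prems q by (auto simp: fg)
        next
          assume h: "(p, r) \<in> T (Suc t)" "y = q" "c = r" "a = s"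
          show False
          proof (cases "p = 0")
            case True
            then show False using none[of "Suc t"] h S t by auto
          next
            case False
            then show False using IH[of p] h S q by auto
          qed
        next
          assume "(q, s) \<in> T (Suc t)" "y = p" "c = q" "a = r"
          then show False using inj step.prems q by (auto simp: fg)
        next
          assume "(q, s) \<in> T (Suc t)" "y = p" "c = r" "a = s"
          then show False using IH[of q] S q by auto
        qed
      qed
    qed
    have "(0::nat) \<in> ?V" using o by simp
    then obtain v where "v < c \<and> (v, c) \<in> T m \<and> (v, a) \<in> T m \<or> a < v \<and> (c, v) \<in> T m \<and> (a, v) \<in> T m"
      using chord_triangulation_outer_apex[OF tri[OF m] finite_lessThan Tm _ o(1)] by blast
    then show False
      using up[of m v] down[of m v] none[of m] m Tm by (cases "v = 0") auto
  qed
  then obtain t0 where t0: "i \<le> t0" "t0 < j" "\<not> chP t0" "\<not> chQ t0" by blast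
  let ?A = "{t \<in> {i..<j}. P t \<noteq> P (Suc t)}" and ?B = "{t \<in> {i..<j}. Q t \<noteq> Q (Suc t)}"
  have "(T i, T j) \<in> chord_flip ?V ^^ (card ?A + card ?B)"
    using relpow_stutter[of i j P, OF ij(1) stepP] relpow_stutter[of i j Q, OF ij(1) stepQ] mid Pi Qj
    by (auto simp: relpow_add)
  moreover have "card ?A + card ?B < j - i"
  proof -
    \<comment> \<open>The proper steps of the two paths occupy disjoint sets of times, and both sets
      miss \<open>t0\<close>; this makes the concatenation strictly shorter.\<close>
    have "?A \<inter> ?B = {}" using notboth chP chQ by force
    then have "card ?A + card ?B = card (?A \<union> ?B)" by (subst card_Un_disjoint) auto
    also have "\<dots> < card {i..<j}"
    proof (rule psubset_card_mono)
      have "t0 \<in> {i..<j}" using t0 by simp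
      moreover have "t0 \<notin> ?A \<union> ?B" using t0 chP chQ by blast
      ultimately show "?A \<union> ?B \<subset> {i..<j}" by blast
    qed simp
    finally show ?thesis by simp
  qed
  ultimately show ?thesis by blast
qed

section \<open>Points in convex position\<close>

text \<open>Twice the signed area of the triangle, positive for counterclockwise triples.\<close>

definition orient :: "plane \<Rightarrow> plane \<Rightarrow> plane \<Rightarrow> real" where
  "orient a b c = (b $ 1 - a $ 1) * (c $ 2 - a $ 2) - (b $ 2 - a $ 2) * (c $ 1 - a $ 1)"

lemma orient_rotate: "orient b c a = orient a b c"
  by (simp add: orient_def algebra_simps)

lemma orient_swap: "orient b a c = - orient a b c"
  by (simp add: orient_def algebra_simps)

lemma orient_swap': "orient a b c = - orient a c b"
  by (simp add: orient_def algebra_simps)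

lemma orient_same [simp]: "orient a a c = 0" "orient a b a = 0" "orient a b b = 0"
  by (simp_all add: orient_def)

lemma orient_zero_collinear: "orient a b c = 0 \<longleftrightarrow> collinear {a, b, c}"
proof
  show "orient a b c = 0" if "collinear {a, b, c}"
    using that
  proof -
    assume "collinear {a, b, c}"
    then consider "a = c" | u where "b = u *\<^sub>R a + (1 - u) *\<^sub>R c"
      unfolding collinear_3_expand by blast
    then show ?thesis
    proof cases
      case 2
      have "b $ 1 = u * a $ 1 + (1 - u) * c $ 1" "b $ 2 = u * a $ 2 + (1 - u) * c $ 2"
        unfolding 2 by simp_all
      then show ?thesis unfolding orient_def by algebra
    qed simp
  qed
next
  assume z: "orient a b c = 0"
  show "collinear {a, b, c}"
  proof (cases "a = c")
    case False
    then consider "a $ 1 \<noteq> c $ 1" | "a $ 2 \<noteq> c $ 2" by (auto simp: vec_eq_iff forall_2)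
    then show ?thesis
    proof cases
      case 1
      define u where "u = (b $ 1 - c $ 1) / (a $ 1 - c $ 1)"
      have u: "u * (a $ 1 - c $ 1) = b $ 1 - c $ 1" using 1 by (simp add: u_def)
      have "(b $ 2 - c $ 2) * (a $ 1 - c $ 1) = u * (a $ 2 - c $ 2) * (a $ 1 - c $ 1)"
        using z u unfolding orient_def by algebra
      then have "b $ 2 - c $ 2 = u * (a $ 2 - c $ 2)" using 1 by simp
      with u have "b = u *\<^sub>R a + (1 - u) *\<^sub>R c"
        by (simp add: vec_eq_iff forall_2 algebra_simps)
      then show ?thesis unfolding collinear_3_expand by blast
    next
      case 2
      define u where "u = (b $ 2 - c $ 2) / (a $ 2 - c $ 2)"
      have u: "u * (a $ 2 - c $ 2) = b $ 2 - c $ 2" using 2 by (simp add: u_def)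
      have "(b $ 1 - c $ 1) * (a $ 2 - c $ 2) = u * (a $ 1 - c $ 1) * (a $ 2 - c $ 2)"
        using z u unfolding orient_def by algebra
      then have "b $ 1 - c $ 1 = u * (a $ 1 - c $ 1)" using 2 by simp
      with u have "b = u *\<^sub>R a + (1 - u) *\<^sub>R c"
        by (simp add: vec_eq_iff forall_2 algebra_simps)
      then show ?thesis unfolding collinear_3_expand by blast
    qed
  qed (simp add: insert_commute)
qed

text \<open>\<open>orient\<close> is affine in its last argument, hence the condition that the
  weights add up to 1.\<close>

lemma orient_sum:
  assumes "sum u S = 1"
  shows "orient a b (\<Sum>s\<in>S. u s *\<^sub>R g s) = (\<Sum>s\<in>S. u s * orient a b (g s))"
proof -
  have "(\<Sum>s\<in>S. u s * orient a b (g s)) =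
    (b $ 1 - a $ 1) * (\<Sum>s\<in>S. u s * g s $ 2) - (b $ 2 - a $ 2) * (\<Sum>s\<in>S. u s * g s $ 1)
     - ((b $ 1 - a $ 1) * a $ 2 - (b $ 2 - a $ 2) * a $ 1) * sum u S"
    unfolding sum_distrib_left sum_subtractf[symmetric]
    by (rule sum.cong) (simp_all add: orient_def algebra_simps)
  then show ?thesis
    by (simp add: assms orient_def sum_component algebra_simps)
qed

lemma orient_convex_hull_nonneg:
  assumes "finite S" "\<And>s. s \<in> S \<Longrightarrow> 0 \<le> orient a b s" "x \<in> convex hull S"
  shows "0 \<le> orient a b x"
proof -
  obtain u where u: "\<forall>s\<in>S. 0 \<le> u s" "sum u S = 1" "(\<Sum>s\<in>S. u s *\<^sub>R s) = x"
    using assms(3) unfolding convex_hull_finite[OF assms(1)] by blast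
  have "orient a b x = (\<Sum>s\<in>S. u s * orient a b s)" using orient_sum[OF u(2), of a b "\<lambda>s. s"] u(3) by simp
  also have "\<dots> \<ge> 0" using u(1) assms(2) by (intro sum_nonneg) auto
  finally show ?thesis .
qed

lemma convex_hull_orient_zero:
  assumes fin: "finite S" and pos: "\<And>s. s \<in> S \<Longrightarrow> 0 \<le> orient a b s"
    and x: "x \<in> convex hull S" "orient a b x = 0"
  shows "x \<in> convex hull {s \<in> S. orient a b s = 0}"
proof -
  obtain u where u: "\<forall>s\<in>S. 0 \<le> u s" "sum u S = 1" "(\<Sum>s\<in>S. u s *\<^sub>R s) = x"
    using x(1) unfolding convex_hull_finite[OF fin] by blast
  have "(\<Sum>s\<in>S. u s * orient a b s) = 0" using orient_sum[OF u(2), of a b "\<lambda>s. s"] u(3) x(2) by simp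
  then have z: "\<forall>s\<in>S. u s * orient a b s = 0"
    using fin u(1) pos by (subst (asm) sum_nonneg_eq_0_iff) auto
  let ?S = "{s \<in> S. orient a b s = 0}"
  have z': "u s = 0" if "s \<in> S - ?S" for s using z that by auto
  have "sum u ?S = sum u S" "(\<Sum>s\<in>?S. u s *\<^sub>R s) = (\<Sum>s\<in>S. u s *\<^sub>R s)"
    using fin z' by (intro sum.mono_neutral_left; simp)+
  then have "sum u ?S = 1" "(\<Sum>s\<in>?S. u s *\<^sub>R s) = x" using u by simp_all
  then show ?thesis using u(1) fin by (auto simp: convex_hull_finite)
qed

text \<open>The affine dependency of four points of the plane; up to sign, the coefficient of each
  point is the area of the triangle formed by the others.\<close>

lemma quad_dependency:
  "orient q r s *\<^sub>R p + orient p q s *\<^sub>R r = orient p r s *\<^sub>R q + orient p q r *\<^sub>R s"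
  "orient q r s + orient p q s = orient p r s + orient p q r"
  by (simp_all add: vec_eq_iff forall_2 orient_def algebra_simps)

text \<open>Positive orientation of all increasing triples expresses convex position and
  counterclockwise order at once.\<close>

locale convex_numbering =
  fixes X :: "plane set" and p :: "nat \<Rightarrow> plane" and n :: nat
  assumes bij: "bij_betw p {..<n} X"
    and orient_pos: "\<And>i j k. i < j \<Longrightarrow> j < k \<Longrightarrow> k < n \<Longrightarrow> 0 < orient (p i) (p j) (p k)"
begin

lemma p_inj: "i < n \<Longrightarrow> j < n \<Longrightarrow> p i = p j \<longleftrightarrow> i = j"
  using bij by (auto simp: bij_betw_def inj_on_def)

lemma p_mem: "i < n \<Longrightarrow> p i \<in> X"
  using bij by (auto simp: bij_betw_def)

lemma p_surj:
  assumes "x \<in> X" obtains i where "i < n" "x = p i"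
  using bij assms by (auto simp: bij_betw_def)

lemma orient_side:
  assumes "i < j" "j < n" "k < n"
  shows "0 < orient (p i) (p j) (p k) \<longleftrightarrow> k < i \<or> j < k"
    "orient (p i) (p j) (p k) < 0 \<longleftrightarrow> i < k \<and> k < j"
    "orient (p i) (p j) (p k) = 0 \<longleftrightarrow> k = i \<or> k = j"
proof -
  consider "k < i" | "j < k" | "i < k" "k < j" | "k = i" | "k = j" using assms by linarith
  then have "(0 < orient (p i) (p j) (p k) \<longleftrightarrow> k < i \<or> j < k) \<and>
    (orient (p i) (p j) (p k) < 0 \<longleftrightarrow> i < k \<and> k < j) \<and>
    (orient (p i) (p j) (p k) = 0 \<longleftrightarrow> k = i \<or> k = j)"
  proof cases
    case 1
    have "0 < orient (p i) (p j) (p k)"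
      using orient_pos[of k i j] assms 1 orient_rotate[of "p k" "p i" "p j"]
        orient_rotate[of "p j" "p k" "p i"] by simp
    then show ?thesis using 1 assms by auto
  next
    case 2
    have "0 < orient (p i) (p j) (p k)" using orient_pos[of i j k] assms 2 by simp
    then show ?thesis using 2 assms by auto
  next
    case 3
    have "0 < orient (p i) (p k) (p j)" using orient_pos[of i k j] assms 3 by simp
    then have "orient (p i) (p j) (p k) < 0" by (simp add: orient_swap'[of "p i" "p j"])
    then show ?thesis using 3 by auto
  qed (use assms in auto)
  then show "0 < orient (p i) (p j) (p k) \<longleftrightarrow> k < i \<or> j < k"
    "orient (p i) (p j) (p k) < 0 \<longleftrightarrow> i < k \<and> k < j"
    "orient (p i) (p j) (p k) = 0 \<longleftrightarrow> k = i \<or> k = j" by auto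
qed

definition chull :: "nat set \<Rightarrow> plane set" where
  "chull W = convex hull (p ` W)"

lemma chull_mono: "V \<subseteq> W \<Longrightarrow> chull V \<subseteq> chull W"
  unfolding chull_def by (intro Hull.hull_mono image_mono)

lemma chull_empty [simp]: "chull {} = {}"
  by (simp add: chull_def)

lemma chull_single [simp]: "chull {i} = {p i}"
  by (simp add: chull_def)

lemma chull_pair: "chull {i, j} = closed_segment (p i) (p j)"
  by (simp add: chull_def segment_convex_hull)

lemma vertex_in_chull: "i \<in> W \<Longrightarrow> p i \<in> chull W"
  by (simp add: chull_def hull_inc)

text \<open>The line through \<open>p u\<close> and \<open>p v\<close> has \<open>V\<close> on one
  side and \<open>W\<close> on the other, so a common point lies on the line. Only \<open>u\<close>
  and \<open>v\<close> are numbers of vertices on it, and a point of a hull on a supporting line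
  belongs to the hull of the generators on that line.\<close>

lemma chull_Int_line:
  assumes "V \<subseteq> {..<n}" "W \<subseteq> {..<n}" and uv: "u < v" "v < n"
    and V: "\<And>k. k \<in> V \<Longrightarrow> u \<le> k \<and> k \<le> v" and W: "\<And>k. k \<in> W \<Longrightarrow> k \<le> u \<or> v \<le> k"
    and x: "x \<in> chull V" "x \<in> chull W"
  shows "x \<in> chull (V \<inter> {u, v}) \<and> x \<in> chull (W \<inter> {u, v})"
proof -
  have fin: "finite V" "finite W" using finite_subset[OF assms(1)] finite_subset[OF assms(2)] by simp_all
  have oW: "0 \<le> orient (p u) (p v) s" if s: "s \<in> p ` W" for s
  proof -
    obtain k where k: "k \<in> W" "s = p k" using s by blast
    then have "k < n" using assms by auto
    then have "\<not> orient (p u) (p v) (p k) < 0" using orient_side(2)[OF uv, of k] W[OF k(1)] by auto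
    then show ?thesis using k(2) by simp
  qed
  have oV: "0 \<le> orient (p v) (p u) s" if s: "s \<in> p ` V" for s
  proof -
    obtain k where k: "k \<in> V" "s = p k" using s by blast
    then have "k < n" using assms by auto
    then have "\<not> 0 < orient (p u) (p v) (p k)" using orient_side(1)[OF uv, of k] V[OF k(1)] by auto
    then show ?thesis using k(2) orient_swap[of "p v" "p u" s] by simp
  qed
  have x': "x \<in> convex hull p ` V" "x \<in> convex hull p ` W" "finite (p ` V)" "finite (p ` W)"
    using x fin by (auto simp: chull_def)
  have "0 \<le> orient (p u) (p v) x" "0 \<le> orient (p v) (p u) x"
    using orient_convex_hull_nonneg[OF x'(4) oW x'(2)] orient_convex_hull_nonneg[OF x'(3) oV x'(1)] by auto
  then have z: "orient (p u) (p v) x = 0" "orient (p v) (p u) x = 0"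
    using orient_swap[of "p v" "p u" x] by auto
  have sub: "{s \<in> p ` W. orient (p u) (p v) s = 0} \<subseteq> p ` (W \<inter> {u, v})"
    "{s \<in> p ` V. orient (p v) (p u) s = 0} \<subseteq> p ` (V \<inter> {u, v})"
  proof -
    show "{s \<in> p ` W. orient (p u) (p v) s = 0} \<subseteq> p ` (W \<inter> {u, v})"
      using orient_side(3)[OF uv] assms(2) by auto
    have "orient (p v) (p u) (p k) = 0 \<longleftrightarrow> k = u \<or> k = v" if "k \<in> V" for k
      using orient_side(3)[OF uv, of k] orient_swap[of "p v" "p u" "p k"] that assms(1) by auto
    then show "{s \<in> p ` V. orient (p v) (p u) s = 0} \<subseteq> p ` (V \<inter> {u, v})" by auto
  qed
  show ?thesis
    using convex_hull_orient_zero[OF x'(4) oW x'(2) z(1)] convex_hull_orient_zero[OF x'(3) oV x'(1) z(2)]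
      Hull.hull_mono[OF sub(1), of convex] Hull.hull_mono[OF sub(2), of convex]
    unfolding chull_def by blast
qed

text \<open>An element of \<open>V\<close> outside \<open>W\<close> lies in a gap of \<open>W\<close>, whose chord separates the two hulls.\<close>

lemma chull_Int_gap:
  assumes sub: "V \<subseteq> {..<n}" "W \<subseteq> {..<n}"
    and nc: "\<And>i j k l. i \<in> V \<Longrightarrow> j \<in> V \<Longrightarrow> k \<in> W \<Longrightarrow> l \<in> W \<Longrightarrow> \<not> interleaved (i, j) (k, l)"
    and z: "z \<in> V" "z \<notin> W" and W: "a \<in> W" "b \<in> W" "a < b"
  shows "chull V \<inter> chull W \<subseteq> chull (V \<inter> W)"
proof -
  have fW: "finite W" using finite_subset[OF sub(2)] by simp
  have "\<exists>u v. u \<in> W \<and> v \<in> W \<and> u < v \<and>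
    ((\<forall>k\<in>W. k \<le> u \<or> v \<le> k) \<and> u < z \<and> z < v \<or> (\<forall>k\<in>W. u \<le> k \<and> k \<le> v) \<and> (z < u \<or> v < z))"
  \<comment> \<open>Either \<open>z\<close> has elements of \<open>W\<close> on both sides and the
    nearest ones delimit the gap, or the gap is the one that wraps around from \<open>Max W\<close>
    to \<open>Min W\<close>.\<close>
  proof (cases "(\<exists>k\<in>W. k < z) \<and> (\<exists>k\<in>W. z < k)")
    case True
    define u where "u = Max {k \<in> W. k < z}"
    define v where "v = Min {k \<in> W. z < k}"
    have "u \<in> {k \<in> W. k < z}" unfolding u_def using True fW by (intro Max_in) auto
    moreover have "v \<in> {k \<in> W. z < k}" unfolding v_def using True fW by (intro Min_in) auto
    moreover have "k \<le> u \<or> v \<le> k" if "k \<in> W" for k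
    proof (cases "k < z")
      case True
      then show ?thesis unfolding u_def using that fW by (intro disjI1 Max_ge) auto
    next
      case False
      then have "z < k" using that z by (cases "k = z") auto
      then show ?thesis unfolding v_def using that fW by (intro disjI2 Min_le) auto
    qed
    ultimately show ?thesis by (intro exI[of _ u] exI[of _ v]) auto
  next
    case False
    have ne: "W \<noteq> {}" using W by auto
    have m: "Min W \<in> W" "Max W \<in> W" "\<And>k. k \<in> W \<Longrightarrow> Min W \<le> k \<and> k \<le> Max W"
      using fW ne by auto
    have "Min W < Max W" using m(3)[OF W(1)] m(3)[OF W(2)] W(3) by linarith
    moreover have "z < Min W \<or> Max W < z" using False m(1,2) z by (metis linorder_neqE_nat)
    ultimately show ?thesis using m by blast
  qed
  then obtain u v where uv: "u \<in> W" "v \<in> W" "u < v"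
    and d: "(\<forall>k\<in>W. k \<le> u \<or> v \<le> k) \<and> u < z \<and> z < v \<or> (\<forall>k\<in>W. u \<le> k \<and> k \<le> v) \<and> (z < u \<or> v < z)"
    by blast
  have vn: "v < n" using uv sub by auto
  have zk: "\<not> interleaved (z, k) (u, v)" "\<not> interleaved (k, z) (u, v)" if "k \<in> V" for k
    using nc[OF z(1) that uv(1,2)] nc[OF that z(1) uv(1,2)] by auto
  show ?thesis
  proof
    fix x assume x: "x \<in> chull V \<inter> chull W"
    from d have "x \<in> chull (V \<inter> {u, v})"
    proof
      assume a: "(\<forall>k\<in>W. k \<le> u \<or> v \<le> k) \<and> u < z \<and> z < v"
      have "u \<le> k \<and> k \<le> v" if "k \<in> V" for k
        using zk[OF that] a by fastforce
      then show ?thesis using chull_Int_line[OF sub uv(3) vn] a x by blast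
    next
      assume a: "(\<forall>k\<in>W. u \<le> k \<and> k \<le> v) \<and> (z < u \<or> v < z)"
      have "k \<le> u \<or> v \<le> k" if "k \<in> V" for k
        using zk[OF that] a by fastforce
      then show ?thesis using chull_Int_line[OF sub(2,1) uv(3) vn] a x by blast
    qed
    moreover have "V \<inter> {u, v} \<subseteq> V \<inter> W" using uv by auto
    ultimately show "x \<in> chull (V \<inter> W)" using chull_mono by blast
  qed
qed

text \<open>Without crossings, sets that are not nested are separated by a chord of one of them. If
  \<open>W\<close> is a single vertex it has no chord, and the roles are exchanged; two distinct
  single vertices are disjoint.\<close>

lemma chull_Int:
  assumes sub: "V \<subseteq> {..<n}" "W \<subseteq> {..<n}"
    and nc: "\<And>i j k l. i \<in> V \<Longrightarrow> j \<in> V \<Longrightarrow> k \<in> W \<Longrightarrow> l \<in> W \<Longrightarrow> \<not> interleaved (i, j) (k, l)"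
  shows "chull V \<inter> chull W = chull (V \<inter> W)"
proof
  show "chull (V \<inter> W) \<subseteq> chull V \<inter> chull W" using chull_mono[of "V \<inter> W"] by blast
  show "chull V \<inter> chull W \<subseteq> chull (V \<inter> W)"
  proof (cases "V \<subseteq> W \<or> W \<subseteq> V")
    case True
    then show ?thesis by (metis Int_absorb1 Int_absorb2 Int_lower1 Int_lower2)
  next
    case False
    then obtain z z' where z: "z \<in> V" "z \<notin> W" "z' \<in> W" "z' \<notin> V" by blast
    show ?thesis
    proof (cases "W = {z'}")
      case W: True
      show ?thesis
      proof (cases "V = {z}")
        case True
        then show ?thesis using W z sub p_inj[of z z'] by auto
      next
        case False
        then obtain b where "b \<in> V" "b \<noteq> z" using z by blast
        then have "z < b \<or> b < z" by auto
        then obtain a c where ac: "a \<in> V" "c \<in> V" "a < c" using z(1) \<open>b \<in> V\<close> by blast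
        have nc': "\<not> interleaved (i, j) (k, l)" if "i \<in> W" "j \<in> W" "k \<in> V" "l \<in> V" for i j k l
          using nc[OF that(3,4,1,2)] by auto
        have "chull W \<inter> chull V \<subseteq> chull (W \<inter> V)"
          by (rule chull_Int_gap[OF sub(2,1) nc' z(3,4) ac])
        then show ?thesis by (simp add: Int_commute)
      qed
    next
      case False
      then obtain b where "b \<in> W" "b \<noteq> z'" using z by blast
      then have "z' < b \<or> b < z'" by auto
      then obtain a c where ac: "a \<in> W" "c \<in> W" "a < c" using z(3) \<open>b \<in> W\<close> by blast
      show ?thesis by (rule chull_Int_gap[OF sub nc z(1,2) ac])
    qed
  qed
qed

lemma vertex_in_chull_iff:
  assumes "W \<subseteq> {..<n}" "i < n"
  shows "p i \<in> chull W \<longleftrightarrow> i \<in> W"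
proof
  assume "p i \<in> chull W"
  then have "p i \<in> chull ({i} \<inter> W)"
    using chull_Int[of "{i}" W] assms by auto
  then show "i \<in> W" by (cases "i \<in> W") auto
qed (rule vertex_in_chull)

lemma chull_eq_iff:
  assumes "V \<subseteq> {..<n}" "W \<subseteq> {..<n}"
  shows "chull V = chull W \<longleftrightarrow> V = W"
proof
  assume eq: "chull V = chull W"
  have "i \<in> V \<longleftrightarrow> i \<in> W" if "i < n" for i
    using vertex_in_chull_iff[OF assms(1) that] vertex_in_chull_iff[OF assms(2) that] eq by simp
  then show "V = W" using assms by blast
qed simp

lemma chull_subset_iff:
  assumes "V \<subseteq> {..<n}" "W \<subseteq> {..<n}"
  shows "chull V \<subseteq> chull W \<longleftrightarrow> V \<subseteq> W"
proof
  assume le: "chull V \<subseteq> chull W"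
  show "V \<subseteq> W"
  proof
    fix i assume "i \<in> V"
    then show "i \<in> W"
      using vertex_in_chull[of i V] le vertex_in_chull_iff[OF assms(2), of i] assms(1) by blast
  qed
qed (rule chull_mono)

text \<open>The intersection point of the diagonals: \<open>quad_dependency\<close> divided by the
  common sum \<open>N\<close> of its coefficients, all of them positive here.\<close>

lemma quad_center:
  assumes "i < j" "j < k" "k < l" "l < n"
  obtains \<alpha> \<beta> where "0 < \<alpha>" "\<alpha> < 1" "0 < \<beta>" "\<beta> < 1"
    "(1 - \<alpha>) *\<^sub>R p i + \<alpha> *\<^sub>R p k = (1 - \<beta>) *\<^sub>R p j + \<beta> *\<^sub>R p l"
proof -
  define A B C D where "A = orient (p j) (p k) (p l)" and "B = orient (p i) (p j) (p l)"
    and "C = orient (p i) (p k) (p l)" and "D = orient (p i) (p j) (p k)"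
  have pos: "A > 0" "B > 0" "C > 0" "D > 0"
    unfolding A_def B_def C_def D_def using assms by (auto intro!: orient_pos)
  have dep: "A *\<^sub>R p i + B *\<^sub>R p k = C *\<^sub>R p j + D *\<^sub>R p l" "A + B = C + D"
    unfolding A_def B_def C_def D_def by (rule quad_dependency)+
  define N where "N = A + B"
  have N: "N > 0" "N = C + D" using pos dep by (auto simp: N_def)
  have 1: "1 - B / N = A / N" "1 - D / N = C / N" using N by (auto simp: N_def field_simps)
  have "(A / N) *\<^sub>R p i + (B / N) *\<^sub>R p k = (1 / N) *\<^sub>R (A *\<^sub>R p i + B *\<^sub>R p k)"
    by (simp add: scaleR_add_right)
  also have "\<dots> = (C / N) *\<^sub>R p j + (D / N) *\<^sub>R p l"
    unfolding dep by (simp add: scaleR_add_right)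
  finally have "(1 - B / N) *\<^sub>R p i + (B / N) *\<^sub>R p k = (1 - D / N) *\<^sub>R p j + (D / N) *\<^sub>R p l"
    unfolding 1 .
  moreover have "0 < B / N" "B / N < 1" "0 < D / N" "D / N < 1"
    using pos N dep by (auto simp: N_def)
  ultimately show ?thesis using that by blast
qed

text \<open>Interleaved chords share the point from \<open>quad_center\<close>. Otherwise
  \<open>chull_Int\<close> confines the common points of two distinct chords to a common end, which
  is not in the relative interior.\<close>

lemma crossing_iff:
  assumes "i < j" "j < n" "k < l" "l < n"
  shows "crossing (chull {i, j}) (chull {k, l}) \<longleftrightarrow> interleaved (i, j) (k, l)"
proof
  have ne: "p i \<noteq> p j" "p k \<noteq> p l" using p_inj assms by auto
  have ri: "rel_interior (chull {i, j}) = open_segment (p i) (p j)"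
    "rel_interior (chull {k, l}) = open_segment (p k) (p l)"
    unfolding chull_pair rel_interior_closed_segment using ne by auto
  show "interleaved (i, j) (k, l)" if c: "crossing (chull {i, j}) (chull {k, l})"
  proof (rule ccontr)
    assume n: "\<not> interleaved (i, j) (k, l)"
    obtain x where x: "x \<in> open_segment (p i) (p j)" "x \<in> open_segment (p k) (p l)"
      using c unfolding crossing_def ri by blast
    have ne': "{i, j} \<noteq> {k, l}" using c unfolding crossing_def by auto
    have "chull {i, j} \<inter> chull {k, l} = chull ({i, j} \<inter> {k, l})"
      using n assms by (intro chull_Int) auto
    then have "x \<in> chull ({i, j} \<inter> {k, l})"
      using x unfolding chull_pair by (auto simp: open_segment_def)
    moreover have "{i, j} \<inter> {k, l} \<in> {{}, {i}, {j}}" using ne' assms by auto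
    ultimately show False using x by (auto simp: open_segment_def)
  qed
  have cross: "crossing (chull {a, c}) (chull {b, d})" if o: "a < b" "b < c" "c < d" "d < n" for a b c d
  proof -
    obtain \<alpha> \<beta> where ab: "0 < \<alpha>" "\<alpha> < 1" "0 < \<beta>" "\<beta> < 1"
      "(1 - \<alpha>) *\<^sub>R p a + \<alpha> *\<^sub>R p c = (1 - \<beta>) *\<^sub>R p b + \<beta> *\<^sub>R p d"
      using quad_center[OF o] by metis
    have ne: "p a \<noteq> p c" "p b \<noteq> p d" using p_inj o by auto
    have "(1 - \<alpha>) *\<^sub>R p a + \<alpha> *\<^sub>R p c \<in> open_segment (p a) (p c)"
      "(1 - \<alpha>) *\<^sub>R p a + \<alpha> *\<^sub>R p c \<in> open_segment (p b) (p d)"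
      using ab ne by (auto simp: in_segment)
    moreover have "chull {a, c} \<noteq> chull {b, d}"
    proof
      assume "chull {a, c} = chull {b, d}"
      then have "{a, c} = {b, d}" using chull_eq_iff[of "{a, c}" "{b, d}"] o by auto
      then show False using o by (auto simp: doubleton_eq_iff)
    qed
    ultimately show ?thesis
      using ne unfolding crossing_def chull_pair rel_interior_closed_segment by auto
  qed
  show "crossing (chull {i, j}) (chull {k, l})" if "interleaved (i, j) (k, l)"
    using that cross[of i k j l] cross[of k i l j] assms by (auto simp: crossing_def)
qed

end

section \<open>Triangulations as sets of chords\<close>

context convex_numbering
begin

definition code :: "plane set set \<Rightarrow> (nat \<times> nat) set" where
  "code T = {(i, j). i < j \<and> j < n \<and> chull {i, j} \<in> T}"

definition decode :: "(nat \<times> nat) set \<Rightarrow> plane set set" where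
  "decode E = (\<lambda>(i, j). chull {i, j}) ` E"

lemma mem_code [simp]: "(i, j) \<in> code T \<longleftrightarrow> i < j \<and> j < n \<and> chull {i, j} \<in> T"
  by (simp add: code_def)

lemma code_chords: "code T \<subseteq> chords {..<n}"
  by (auto simp: code_def)

lemma chull_pair_eq:
  assumes "i < j" "j < n" "k < l" "l < n"
  shows "chull {i, j} = chull {k, l} \<longleftrightarrow> i = k \<and> j = l"
  using chull_eq_iff[of "{i, j}" "{k, l}"] assms by (auto simp: doubleton_eq_iff)

lemma arcsE:
  assumes "e \<in> arcs X"
  obtains i j where "i < j" "j < n" "e = chull {i, j}"
proof -
  obtain a b where ab: "e = closed_segment a b" "a \<in> X" "b \<in> X" "a \<noteq> b"
    using assms unfolding arcs_def by blast
  obtain i where i: "i < n" "a = p i" using ab(2) by (rule p_surj)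
  obtain j where j: "j < n" "b = p j" using ab(3) by (rule p_surj)
  consider "i < j" | "j < i" using ab i j by force
  then show ?thesis
  proof cases
    case 1
    then show ?thesis using that[of i j] i j ab by (simp add: chull_pair)
  next
    case 2
    then show ?thesis using that[of j i] i j ab by (simp add: chull_pair closed_segment_commute)
  qed
qed

lemma chull_arc: "i < j \<Longrightarrow> j < n \<Longrightarrow> chull {i, j} \<in> arcs X"
  unfolding arcs_def chull_pair using p_mem[of i] p_mem[of j] p_inj[of i j] by fastforce

lemma decode_code:
  assumes "T \<subseteq> arcs X" shows "decode (code T) = T"
proof
  show "decode (code T) \<subseteq> T" by (auto simp: decode_def)
  show "T \<subseteq> decode (code T)"
  proof
    fix e assume e: "e \<in> T"
    then obtain i j where "i < j" "j < n" "e = chull {i, j}" using assms arcsE by blast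
    then show "e \<in> decode (code T)" using e unfolding decode_def by (intro image_eqI[of _ _ "(i, j)"]) auto
  qed
qed

lemma decodeI: "(i, j) \<in> E \<Longrightarrow> chull {i, j} \<in> decode E"
  unfolding decode_def by (intro image_eqI[of _ _ "(i, j)"]) auto

lemma decodeE:
  assumes "e \<in> decode E" obtains i j where "(i, j) \<in> E" "e = chull {i, j}"
  using assms unfolding decode_def by auto

lemma decode_iff:
  assumes "E \<subseteq> chords {..<n}" "i < j" "j < n"
  shows "chull {i, j} \<in> decode E \<longleftrightarrow> (i, j) \<in> E"
proof
  assume "chull {i, j} \<in> decode E"
  then obtain k l where kl: "(k, l) \<in> E" "chull {i, j} = chull {k, l}" by (rule decodeE)
  then have "k < l" "l < n" using assms(1) by auto
  then show "(i, j) \<in> E" using chull_pair_eq[OF assms(2,3)] kl by auto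
qed (rule decodeI)

lemma noncrossing_arcs_iff:
  "noncrossing_arcs X T \<longleftrightarrow> T \<subseteq> arcs X \<and> (\<forall>e\<in>code T. \<forall>f\<in>code T. \<not> interleaved e f)"
proof
  assume T: "noncrossing_arcs X T"
  have "\<not> interleaved e f" if "e \<in> code T" "f \<in> code T" for e f
    using that crossing_iff[of "fst e" "snd e" "fst f" "snd f"] T
    unfolding noncrossing_arcs_def by (cases e; cases f) auto
  then show "T \<subseteq> arcs X \<and> (\<forall>e\<in>code T. \<forall>f\<in>code T. \<not> interleaved e f)"
    using T unfolding noncrossing_arcs_def by blast
next
  assume T: "T \<subseteq> arcs X \<and> (\<forall>e\<in>code T. \<forall>f\<in>code T. \<not> interleaved e f)"
  have "\<not> crossing e f" if ef: "e \<in> T" "f \<in> T" for e f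
  proof -
    obtain i j where ij: "i < j" "j < n" "e = chull {i, j}" using T ef arcsE[of e] by blast
    obtain k l where kl: "k < l" "l < n" "f = chull {k, l}" using T ef arcsE[of f] by blast
    have "(i, j) \<in> code T" "(k, l) \<in> code T" using ij kl ef by auto
    then show ?thesis using crossing_iff ij kl T by metis
  qed
  then show "noncrossing_arcs X T" using T unfolding noncrossing_arcs_def by blast
qed

lemma triangulation_arcs: "triangulation X T \<Longrightarrow> T \<subseteq> arcs X"
  by (simp add: triangulation_def noncrossing_arcs_def)

text \<open>Maximality under inclusion is applied to the triangulation enlarged by a single
  uncrossed chord, which is still noncrossing.\<close>

lemma triangulation_code:
  assumes "triangulation X T" shows "chord_triangulation {..<n} (code T)"
  unfolding chord_triangulation_def
proof (intro conjI)
  have nc: "T \<subseteq> arcs X" "\<forall>e\<in>code T. \<forall>f\<in>code T. \<not> interleaved e f"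
    and mx: "\<And>T'. noncrossing_arcs X T' \<Longrightarrow> T \<subseteq> T' \<Longrightarrow> T' = T"
    using assms unfolding triangulation_def noncrossing_arcs_iff by auto
  show "code T \<subseteq> chords {..<n}" by (rule code_chords)
  show "\<forall>e\<in>code T. \<forall>f\<in>code T. \<not> interleaved e f" by (rule nc)
  show "\<forall>e\<in>chords {..<n}. (\<forall>f\<in>code T. \<not> interleaved e f) \<longrightarrow> e \<in> code T"
  proof (intro ballI impI)
    fix e assume e: "e \<in> chords {..<n}" and free: "\<forall>f\<in>code T. \<not> interleaved e f"
    obtain i j where ij: "e = (i, j)" "i < j" "j < n" using e by (cases e) auto
    let ?T = "insert (chull {i, j}) T"
    have c: "code ?T \<subseteq> insert e (code T)"
      using ij chull_pair_eq by (auto simp: code_def)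
    have "noncrossing_arcs X ?T"
      unfolding noncrossing_arcs_iff
    proof (intro conjI ballI)
      show "?T \<subseteq> arcs X" using nc chull_arc ij by simp
      fix f g assume "f \<in> code ?T" "g \<in> code ?T"
      then have "f = e \<or> f \<in> code T" "g = e \<or> g \<in> code T" using c by auto
      then show "\<not> interleaved f g"
        using free nc(2) interleaved_sym[of f g] by (metis interleaved_Pair ij(1) less_irrefl)
    qed
    then have "?T = T" using mx[of ?T] by blast
    then show "e \<in> code T" using ij by auto
  qed
qed

lemma triangulation_decode:
  assumes E: "chord_triangulation {..<n} E" shows "triangulation X (decode E)"
proof -
  note ch = chord_triangulation_chords[OF E]
  have ar: "decode E \<subseteq> arcs X"
  proof
    fix e assume "e \<in> decode E"
    then obtain i j where "(i, j) \<in> E" "e = chull {i, j}" by (rule decodeE)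
    then show "e \<in> arcs X" using chull_arc ch by auto
  qed
  have cd: "code (decode E) = E"
    using decode_iff[OF ch] ch by (auto simp: code_def)
  show ?thesis
    unfolding triangulation_def
  proof (intro conjI allI impI)
    show "noncrossing_arcs X (decode E)"
      unfolding noncrossing_arcs_iff cd using ar chord_triangulation_noncrossing[OF E] by blast
    fix T' assume T': "noncrossing_arcs X T' \<and> decode E \<subseteq> T'"
    then have nc: "T' \<subseteq> arcs X" "\<forall>e\<in>code T'. \<forall>f\<in>code T'. \<not> interleaved e f"
      unfolding noncrossing_arcs_iff by auto
    have "code (decode E) \<subseteq> code T'" using T' by (auto simp: code_def)
    then have EE: "E \<subseteq> code T'" by (simp add: cd)
    have "code T' \<subseteq> E"
    proof
      fix e assume e: "e \<in> code T'"
      show "e \<in> E"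
        using e code_chords nc(2) EE by (intro chord_triangulation_maximal[OF E]) blast+
    qed
    then have "code T' = E" using EE by blast
    then show "T' = decode E" using decode_code[OF nc(1)] by simp
  qed
qed

lemma flip_code:
  assumes "flip_adjacent X T T'" shows "(code T, code T') \<in> chord_flip {..<n}"
proof -
  obtain d d' where d: "T - T' = {d}" "T' - T = {d'}"
    and tri: "triangulation X T" "triangulation X T'"
    using assms unfolding flip_adjacent_def by blast
  have single: "\<exists>e. code A - code B = {e}" if AB: "A - B = {c}" "A \<subseteq> arcs X" for A B c
  proof -
    have "c \<in> arcs X" using AB by blast
    then obtain i j where ij: "i < j" "j < n" "c = chull {i, j}" by (rule arcsE)
    have "code A - code B = code (A - B)" by (auto simp: code_def)
    also have "\<dots> = {(i, j)}" unfolding AB(1) using ij chull_pair_eq by (auto simp: code_def)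
    finally show ?thesis by blast
  qed
  show ?thesis
    unfolding chord_flip_def
    using triangulation_code tri single[OF d(1) triangulation_arcs] single[OF d(2) triangulation_arcs] by simp
qed

lemma flip_decode:
  assumes "(E, F) \<in> chord_flip {..<n}" shows "flip_adjacent X (decode E) (decode F)"
proof -
  note tri = chord_flipD[OF assms]
  have inj: "inj_on (\<lambda>(i, j). chull {i, j}) (chords {..<n})"
  proof (rule inj_onI, clarify)
    fix i j k l assume "(i, j) \<in> chords {..<n}" "(k, l) \<in> chords {..<n}" "chull {i, j} = chull {k, l}"
    then show "i = k \<and> j = l" using chull_pair_eq[of i j k l] by simp
  qed
  have diff: "decode A - decode B = decode (A - B)" if "A \<subseteq> chords {..<n}" "B \<subseteq> chords {..<n}" for A B
  proof -
    have "A - B \<subseteq> chords {..<n}" using that(1) by blast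
    then show ?thesis unfolding decode_def using inj_on_image_set_diff[OF inj _ that(2)] by metis
  qed
  have ch: "E \<subseteq> chords {..<n}" "F \<subseteq> chords {..<n}"
    by (rule tri[THEN chord_triangulation_chords])+
  obtain d d' where d: "E - F = {d}" "F - E = {d'}" using assms unfolding chord_flip_def by auto
  have "decode E - decode F = decode {d}" "decode F - decode E = decode {d'}"
    using diff[OF ch] diff[OF ch(2,1)] by (simp_all only: d)
  then show ?thesis
    unfolding flip_adjacent_def
    using triangulation_decode[OF tri(1)] triangulation_decode[OF tri(2)]
    by (simp add: decode_def del: Diff_eq_empty_iff)
qed

text \<open>A shortcut between times \<open>i\<close> and \<open>j\<close> could be spliced into the
  path, and decoding would give a path between the same ends that is shorter than the flip
  distance.\<close>

lemma geodesic_no_shortcut: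
  assumes geo: "geodesic_flip_path X k T" and ij: "i \<le> j" "j \<le> k" and l: "l < j - i"
  shows "(code (T i), code (T j)) \<notin> chord_flip {..<n} ^^ l"
proof
  let ?R = "chord_flip {..<n}"
  assume a: "(code (T i), code (T j)) \<in> ?R ^^ l"
  have tri: "\<And>t. t \<le> k \<Longrightarrow> triangulation X (T t)"
    and fl: "\<And>t. t < k \<Longrightarrow> (code (T t), code (T (Suc t))) \<in> ?R"
    using geo flip_code unfolding geodesic_flip_path_def flip_path_def by auto
  have "(code (T 0), code (T i)) \<in> ?R ^^ i"
    unfolding relpow_fun_conv using fl ij by (intro exI[of _ "\<lambda>t. code (T t)"]) simp
  moreover have "(code (T j), code (T k)) \<in> ?R ^^ (k - j)"
    unfolding relpow_fun_conv using fl ij by (intro exI[of _ "\<lambda>t. code (T (j + t))"]) simp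
  ultimately have "(code (T 0), code (T k)) \<in> ?R ^^ (i + l + (k - j))"
    using a unfolding relpow_add by blast
  then obtain f where f: "f 0 = code (T 0)" "f (i + l + (k - j)) = code (T k)"
    and step: "\<forall>t<i + l + (k - j). (f t, f (Suc t)) \<in> ?R"
    unfolding relpow_fun_conv by blast
  have ft: "chord_triangulation {..<n} (f t)" if "t \<le> i + l + (k - j)" for t
  proof (cases t)
    case 0 then show ?thesis using f triangulation_code tri by simp
  next
    case (Suc u)
    then have "u < i + l + (k - j)" using that by simp
    then show ?thesis using step chord_flipD(2) Suc by blast
  qed
  have "flip_path X (i + l + (k - j)) (\<lambda>t. decode (f t))"
    unfolding flip_path_def using ft triangulation_decode flip_decode step by simp
  moreover have "decode (f 0) = T 0" "decode (f (i + l + (k - j))) = T k"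
    using f decode_code triangulation_arcs tri by simp_all
  ultimately have "flip_distance X (T 0) (T k) \<le> i + l + (k - j)"
    unfolding flip_distance_def by (intro Least_le exI[of _ "\<lambda>t. decode (f t)"]) simp
  then show False using geo l ij unfolding geodesic_flip_path_def by linarith
qed

end

lemma relpow_sym:
  assumes "\<And>x y. (x, y) \<in> R \<Longrightarrow> (y, x) \<in> R" "(a, b) \<in> R ^^ l"
  shows "(b, a) \<in> R ^^ l"
  using assms(2)
proof (induction l arbitrary: b)
  case (Suc l)
  then obtain c where "(a, c) \<in> R ^^ l" "(c, b) \<in> R" by auto
  then show ?case using Suc.IH assms(1) by (meson relpow_Suc_I2)
qed simp

text \<open>Since \<open>v\<close> is separated from the other points by a line, they are seen from
  \<open>v\<close> within a half-plane and can be sorted by angle. The free choice of the start is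
  what moves a given vertex to number 0.\<close>

lemma exists_convex_numbering:
  fixes X :: "plane set"
  assumes fin: "finite X" and ext: "\<And>x. x \<in> X \<Longrightarrow> x \<notin> convex hull (X - {x})" and v: "v \<in> X"
  obtains p where "convex_numbering X p (card X)" "p 0 = v"
proof -
  let ?Y = "X - {v}"
  have notcol: "orient a b c \<noteq> 0" if X: "a \<in> X" "b \<in> X" "c \<in> X" and ne: "a \<noteq> b" "b \<noteq> c" "a \<noteq> c" for a b c
  proof
    assume "orient a b c = 0"
    then have "between (b, c) a \<or> between (c, a) b \<or> between (a, b) c"
      unfolding orient_zero_collinear collinear_between_cases .
    then have "a \<in> convex hull {b, c} \<or> b \<in> convex hull {c, a} \<or> c \<in> convex hull {a, b}"
      by (simp add: between_mem_segment segment_convex_hull)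
    moreover have "{b, c} \<subseteq> X - {a}" "{c, a} \<subseteq> X - {b}" "{a, b} \<subseteq> X - {c}" using X ne by auto
    ultimately show False using ext X hull_mono[of _ _ convex] by (meson subsetD)
  qed
  obtain u \<beta> where ub: "inner u v < \<beta>" "\<forall>x\<in>convex hull ?Y. \<beta> < inner u x"
    using separating_hyperplane_closed_point[of "convex hull ?Y" v] ext[OF v] fin
    by (metis convex_convex_hull compact_imp_closed finite_Diff finite_imp_compact_convex_hull)
  have up: "0 < inner u (x - v)" if "x \<in> ?Y" for x
    using ub hull_inc[OF that, of convex] by (fastforce simp: inner_diff_right)
  \<comment> \<open>The tangent of the angle from the normal \<open>u\<close> to
    \<open>x - v\<close>; it is increasing in the angle because all these vectors have positive
    inner product with \<open>u\<close>.\<close>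
  define key where "key x = (u $ 1 * (x $ 2 - v $ 2) - u $ 2 * (x $ 1 - v $ 1)) / inner u (x - v)" for x
  have inn: "inner u (x - v) = u $ 1 * (x $ 1 - v $ 1) + u $ 2 * (x $ 2 - v $ 2)" for x
    by (simp add: inner_vec_def sum_2)
  have key: "0 < orient v x y \<longleftrightarrow> key x < key y" if xy: "x \<in> ?Y" "y \<in> ?Y" for x y
  proof -
    have u0: "0 < (u $ 1)\<^sup>2 + (u $ 2)\<^sup>2"
    proof (rule ccontr)
      assume "\<not> ?thesis"
      then have "u $ 1 = 0 \<and> u $ 2 = 0"
        by (meson not_sum_power2_lt_zero sum_power2_gt_zero_iff)
      then show False using up[OF xy(1)] by (simp add: inn)
    qed
    have "key x < key y \<longleftrightarrow>
      (u $ 1 * (x $ 2 - v $ 2) - u $ 2 * (x $ 1 - v $ 1)) * inner u (y - v)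
      < (u $ 1 * (y $ 2 - v $ 2) - u $ 2 * (y $ 1 - v $ 1)) * inner u (x - v)"
      unfolding key_def using up[OF xy(1)] up[OF xy(2)] by (simp add: field_simps)
    \<comment> \<open>The difference of the two products is the squared length of \<open>u\<close>
      times \<open>orient v x y\<close>.\<close>
    also have "\<dots> \<longleftrightarrow> 0 < ((u $ 1)\<^sup>2 + (u $ 2)\<^sup>2) * orient v x y"
      unfolding inn orient_def by (simp add: algebra_simps power2_eq_square)
    also have "\<dots> \<longleftrightarrow> 0 < orient v x y" using u0 by (simp add: zero_less_mult_iff)
    finally show ?thesis by simp
  qed
  have kinj: "inj_on key ?Y"
  proof (rule inj_onI)
    fix x y assume xy: "x \<in> ?Y" "y \<in> ?Y" "key x = key y"
    show "x = y"
    proof (rule ccontr)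
      assume "x \<noteq> y"
      then have "orient v x y \<noteq> 0" using notcol[of v x y] xy v by auto
      moreover have "\<not> 0 < orient v x y" using key[OF xy(1,2)] xy(3) by simp
      moreover have "\<not> 0 < orient v y x" using key[OF xy(2,1)] xy(3) by simp
      ultimately show False using orient_swap'[of v x y] by simp
    qed
  qed
  define ks where "ks = sorted_list_of_set (key ` ?Y)"
  define N where "N = card X - 1"
  have card: "card ?Y = N" "card X = Suc N"
    using v fin card_gt_0_iff[of X] by (auto simp: N_def)
  have ks: "set ks = key ` ?Y" "sorted_wrt (<) ks" "length ks = N"
    using fin card kinj by (auto simp: ks_def card_image)
  define p where "p i = (if i = 0 then v else the_inv_into ?Y key (ks ! (i - 1)))" for i
  have mem: "ks ! i \<in> key ` ?Y" if "i < N" for i using nth_mem[of i ks] ks that by auto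
  have pS: "p (Suc i) \<in> ?Y" "key (p (Suc i)) = ks ! i" if "i < N" for i
    using the_inv_into_into[OF kinj mem[OF that] subset_refl] f_the_inv_into_f[OF kinj mem[OF that]]
    by (simp_all add: p_def)
  have mono: "key (p i) < key (p j)" if "0 < i" "i < j" "j < Suc N" for i j
  proof -
    obtain i' where i': "i = Suc i'" using \<open>0 < i\<close> by (cases i) auto
    obtain j' where j': "j = Suc j'" using \<open>i < j\<close> by (cases j) auto
    show ?thesis
      using pS[of i'] pS[of j'] that sorted_wrt_nth_less[OF ks(2), of i' j'] ks(3) i' j' by simp
  qed
  have pY: "p i \<in> ?Y" if "0 < i" "i < Suc N" for i
    using pS[of "i - 1"] that by (cases i) auto
  have p0: "p 0 = v" by (simp add: p_def)
  have pos0: "0 < orient v (p i) (p j)" if "0 < i" "i < j" "j < Suc N" for i j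
    using key[OF pY pY, of i j] mono[OF that] that by simp
  have "convex_numbering X p (Suc N)"
  proof
    have inj: "inj_on p {..<Suc N}"
    proof (rule linorder_inj_onI)
      fix i j assume "i < j" and "i \<in> {..<Suc N}" and "j \<in> {..<Suc N}"
      then show "p i \<noteq> p j"
        using mono[of i j] pY[of j] p0 by (cases "i = 0") auto
    qed auto
    have "p ` {..<Suc N} \<subseteq> X"
    proof
      fix x assume "x \<in> p ` {..<Suc N}"
      then obtain i where "i < Suc N" "x = p i" by blast
      then show "x \<in> X" using pY[of i] p0 v by (cases "i = 0") auto
    qed
    moreover have "card (p ` {..<Suc N}) = card X" using card_image[OF inj] card by simp
    ultimately have "p ` {..<Suc N} = X" using card_subset_eq[OF fin] by blast
    then show "bij_betw p {..<Suc N} X" using inj by (simp add: bij_betw_def)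
    fix i j k assume ijk: "i < j" "j < k" "k < Suc N"
    show "0 < orient (p i) (p j) (p k)"
    proof (cases "i = 0")
      case True
      then show ?thesis using pos0[of j k] p0 ijk by simp
    next
      case False
      have p: "p i \<in> ?Y" "p j \<in> ?Y" "p k \<in> ?Y" using pY[of i] pY[of j] pY[of k] ijk False by simp_all
      have ne: "p i \<noteq> p j" "p j \<noteq> p k" "p i \<noteq> p k"
        using mono[of i j] mono[of j k] mono[of i k] ijk False by auto
      show ?thesis
      proof (rule ccontr)
        assume "\<not> 0 < orient (p i) (p j) (p k)"
        moreover have "orient (p i) (p j) (p k) \<noteq> 0" using notcol[of "p i" "p j" "p k"] p ne by auto
        ultimately have neg: "orient (p i) (p j) (p k) < 0" by simp
        \<comment> \<open>With \<open>A\<close> negative and the other three areas positive, the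
          affine dependency of the four points writes \<open>p j\<close> as a convex combination of
          \<open>v\<close>, \<open>p i\<close> and \<open>p k\<close>, which is impossible for an
          extreme point.\<close>
        define A B C D where "A = orient (p i) (p j) (p k)" and "B = orient v (p i) (p k)"
          and "C = orient v (p j) (p k)" and "D = orient v (p i) (p j)"
        have dep: "A *\<^sub>R v + B *\<^sub>R p j = C *\<^sub>R p i + D *\<^sub>R p k" "A + B = C + D"
        proof -
          show "A *\<^sub>R v + B *\<^sub>R p j = C *\<^sub>R p i + D *\<^sub>R p k"
            unfolding A_def B_def C_def D_def
            by (simp add: vec_eq_iff forall_2 orient_def algebra_simps)
          show "A + B = C + D"
            unfolding A_def B_def C_def D_def by (simp add: orient_def algebra_simps)
        qed
        have pos: "A < 0" "B > 0" "C > 0" "D > 0"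
          using neg pos0 ijk False by (auto simp: A_def B_def C_def D_def)
        have "p j = (1 / B) *\<^sub>R (B *\<^sub>R p j)" using pos by simp
        also have "B *\<^sub>R p j = (- A) *\<^sub>R v + C *\<^sub>R p i + D *\<^sub>R p k"
          using dep(1) by (simp add: algebra_simps)
        finally have "p j = (- A / B) *\<^sub>R v + (C / B) *\<^sub>R p i + (D / B) *\<^sub>R p k"
          by (simp add: scaleR_add_right scaleR_diff_right)
        moreover have "- A / B + C / B + D / B = 1" using pos dep(2) by (simp add: field_simps)
        moreover have "0 \<le> - A / B" "0 \<le> C / B" "0 \<le> D / B" using pos by (auto simp: divide_nonpos_pos)
        ultimately have "p j \<in> convex hull {v, p i, p k}" unfolding convex_hull_3 by blast
        moreover have "{v, p i, p k} \<subseteq> X - {p j}" using p ne v by auto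
        ultimately have "p j \<in> convex hull (X - {p j})" using hull_mono[of _ _ convex] by blast
        then show False using ext[of "p j"] p by blast
      qed
    qed
  qed
  then show ?thesis using that p0 card by metis
qed

section \<open>Geodesics\<close>

lemma geodesic_code_flip:
  assumes "convex_numbering X p n" "geodesic_flip_path X k T" "t < k"
  shows "(convex_numbering.code p n (T t), convex_numbering.code p n (T (Suc t))) \<in> chord_flip {..<n}"
  using convex_numbering.flip_code[OF assms(1)] assms(2,3)
  unfolding geodesic_flip_path_def flip_path_def by simp

lemma convex_numbering_nonzero:
  assumes "convex_numbering X p n" "x \<in> X" "x \<noteq> p 0"
  obtains i where "0 < i" "i < n" "x = p i"
proof -
  obtain i where i: "i < n" "x = p i" using convex_numbering.p_surj[OF assms(1,2)] by blast
  then have "i \<noteq> 0" using assms(3) by metis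
  then show ?thesis using that[of i] i by simp
qed

text \<open>Numbering from \<open>a\<close> turns the arc into a chord \<open>(0, b')\<close>, to
  which the shortcut around an absent chord applies.\<close>

lemma geodesic_keeps_arc:
  assumes fin: "finite X" and ext: "\<And>x. x \<in> X \<Longrightarrow> x \<notin> convex hull (X - {x})"
    and geo: "geodesic_flip_path X k T" and ab: "a \<in> X" "b \<in> X" "a \<noteq> b"
    and t: "i \<le> m" "m \<le> j" "j \<le> k"
    and e: "closed_segment a b \<in> T i" "closed_segment a b \<in> T j"
  shows "closed_segment a b \<in> T m"
proof (rule ccontr)
  assume nm: "closed_segment a b \<notin> T m"
  obtain p where p: "convex_numbering X p (card X)" "p 0 = a"
    using exists_convex_numbering[OF fin ext ab(1)] by blast
  interpret convex_numbering X p "card X" by (rule p(1))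
  obtain b' where b': "0 < b'" "b' < card X" "b = p b'"
    using convex_numbering_nonzero[OF p(1) ab(2)] ab(3) p(2) by metis
  have mem: "(0, b') \<in> code (T t) \<longleftrightarrow> closed_segment a b \<in> T t" for t
    using b' p(2) by (simp add: chull_pair)
  have "\<exists>l<j - i. (code (T i), code (T j)) \<in> chord_flip {..<card X} ^^ l"
  proof (rule flip_shortcut_leaving_chord)
    show "(code (T t), code (T (Suc t))) \<in> chord_flip {..<card X}" if "i \<le> t" "t < j" for t
      using geodesic_code_flip[OF p(1) geo, of t] that t by simp
  qed (use mem e nm b' t in auto)
  then show False using geodesic_no_shortcut[OF geo] t by (meson order_trans)
qed

text \<open>The numbering starts at \<open>b\<close>, the common end of the earliest and the latest
  arc, as the shortcut for triangles requires.\<close>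

lemma geodesic_triangle:
  assumes fin: "finite X" and ext: "\<And>x. x \<in> X \<Longrightarrow> x \<notin> convex hull (X - {x})"
    and geo: "geodesic_flip_path X k T" and abc: "a \<in> X" "b \<in> X" "c \<in> X" "a \<noteq> b" "b \<noteq> c" "a \<noteq> c"
    and t: "i \<le> m" "m \<le> j" "j \<le> k"
    and e: "closed_segment a b \<in> T i" "closed_segment a c \<in> T m" "closed_segment b c \<in> T j"
  shows "\<exists>t\<le>k. closed_segment a b \<in> T t \<and> closed_segment a c \<in> T t \<and> closed_segment b c \<in> T t"
proof (rule ccontr)
  assume no: "\<not> ?thesis"
  obtain p where p: "convex_numbering X p (card X)" "p 0 = b"
    using exists_convex_numbering[OF fin ext abc(2)] by blast
  interpret convex_numbering X p "card X" by (rule p(1))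
  obtain a' where a': "0 < a'" "a' < card X" "a = p a'"
    using convex_numbering_nonzero[OF p(1) abc(1)] abc p(2) by metis
  obtain c' where c': "0 < c'" "c' < card X" "c = p c'"
    using convex_numbering_nonzero[OF p(1) abc(3)] abc p(2) by metis
  have mem: "(0, a') \<in> code (T t) \<longleftrightarrow> closed_segment a b \<in> T t"
    "(0, c') \<in> code (T t) \<longleftrightarrow> closed_segment b c \<in> T t"
    "c' < a' \<Longrightarrow> (c', a') \<in> code (T t) \<longleftrightarrow> closed_segment a c \<in> T t"
    "a' < c' \<Longrightarrow> (a', c') \<in> code (T t) \<longleftrightarrow> closed_segment a c \<in> T t" for t
    using a' c' p(2) by (simp_all add: chull_pair closed_segment_commute)
  have flip: "(code (T t), code (T (Suc t))) \<in> chord_flip {..<card X}" if "t < j" for t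
    using geodesic_code_flip[OF p(1) geo, of t] that t by simp
  have "a' \<noteq> c'" using abc a' c' by auto
  then consider "c' < a'" | "a' < c'" by linarith
  then have "\<exists>l<j - i. (code (T i), code (T j)) \<in> chord_flip {..<card X} ^^ l"
  proof cases
    case 1
    show ?thesis
    proof (rule flip_shortcut_triangle[of i j _ _ c' a' m])
      show "\<not> ((0, c') \<in> code (T t) \<and> (c', a') \<in> code (T t) \<and> (0, a') \<in> code (T t))"
        if "i \<le> t" "t \<le> j" for t
        using no mem 1 that t by (meson order_trans)
    qed (use flip mem e a' c' 1 t in auto)
  next
    case 2
    \<comment> \<open>In the other cyclic order the path is run backwards: reversing time exchanges
      the earliest and the latest arc, and with them the roles of \<open>a'\<close> and
      \<open>c'\<close>.\<close>
    have "\<exists>l<(j - i) - 0. (code (T (j - 0)), code (T (j - (j - i)))) \<in> chord_flip {..<card X} ^^ l"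
    proof (rule flip_shortcut_triangle[of 0 "j - i" "\<lambda>t. code (T (j - t))" _ a' c' "j - m"])
      show "(code (T (j - t)), code (T (j - Suc t))) \<in> chord_flip {..<card X}" if "0 \<le> t" "t < j - i" for t
      proof -
        have "j - t = Suc (j - Suc t)" using that by simp
        then show ?thesis using flip[of "j - Suc t"] that by (simp add: chord_flip_sym)
      qed
      show "\<not> ((0, a') \<in> code (T (j - t)) \<and> (a', c') \<in> code (T (j - t)) \<and> (0, c') \<in> code (T (j - t)))"
        if "0 \<le> t" "t \<le> j - i" for t
      proof -
        have "j - t \<le> k" using t by simp
        then show ?thesis using no mem(1,2,4) 2 by metis
      qed
      show "(a', c') \<in> code (T (j - (j - m)))" using mem(4)[OF 2] e t by simp
      show "(0, a') \<in> code (T (j - (j - i)))" using mem(1) e t by simp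
      show "(0, c') \<in> code (T (j - 0))" using mem(2) e by simp
    qed (use a' c' 2 t in auto)
    then have "\<exists>l<j - i. (code (T j), code (T i)) \<in> chord_flip {..<card X} ^^ l"
      using t by simp
    then show ?thesis using relpow_sym[of "chord_flip {..<card X}"] chord_flip_sym by metis
  qed
  then show False using geodesic_no_shortcut[OF geo] t by (meson order_trans)
qed

section \<open>Surfaces that are graphs\<close>

definition graph_over :: "(plane \<Rightarrow> real) \<Rightarrow> plane set \<Rightarrow> space set" where
  "graph_over h R = (\<lambda>x. (x, h x)) ` R"

definition region_between :: "(plane \<Rightarrow> real) \<Rightarrow> (plane \<Rightarrow> real) \<Rightarrow> plane set \<Rightarrow> space set" where
  "region_between h u Q = {(x, z). x \<in> Q \<and> h x \<le> z \<and> z \<le> u x}"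

lemma mem_graph_over [simp]: "(x, z) \<in> graph_over h R \<longleftrightarrow> x \<in> R \<and> z = h x"
  by (auto simp: graph_over_def)

lemma mem_region_between [simp]: "(x, z) \<in> region_between h u Q \<longleftrightarrow> x \<in> Q \<and> h x \<le> z \<and> z \<le> u x"
  by (simp add: region_between_def)

lemma projects_homeomorphically_graph:
  assumes "projects_homeomorphically S R"
  obtains h where "continuous_on R h" "S = graph_over h R"
proof -
  obtain g where g: "homeomorphism S R fst g"
    using assms unfolding projects_homeomorphically_def by blast
  have "continuous_on R (\<lambda>x. snd (g x))"
    using homeomorphism_cont2[OF g] by (rule continuous_on_snd)
  moreover have "S = graph_over (\<lambda>x. snd (g x)) R"
  proof -
    have "g x = (x, snd (g x))" if "x \<in> R" for x
      using homeomorphism_apply2[OF g that] by (metis prod.collapse)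
    then have "graph_over (\<lambda>x. snd (g x)) R = g ` R"
      unfolding graph_over_def by (metis (mono_tags, lifting) image_cong)
    then show ?thesis using homeomorphism_image2[OF g] by simp
  qed
  ultimately show ?thesis by (rule that)
qed

lemma homeomorphism_graph:
  assumes "continuous_on R h"
  shows "homeomorphism R (graph_over h R) (\<lambda>x. (x, h x)) fst"
  unfolding homeomorphism_def graph_over_def
  using assms by (auto intro!: continuous_intros simp: image_image)

text \<open>Invariance of domain makes the image of the interior open.\<close>

lemma homeomorphism_interior:
  fixes f g :: "'a::euclidean_space \<Rightarrow> 'a"
  assumes "homeomorphism S R f g" "x \<in> interior S"
  shows "f x \<in> interior R"
proof (rule interiorI)
  have sub: "interior S \<subseteq> S" by (rule interior_subset)
  show "open (f ` interior S)"
  proof (rule invariance_of_domain)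
    show "continuous_on (interior S) f"
      using homeomorphism_cont1[OF assms(1)] sub by (rule continuous_on_subset)
    show "inj_on f (interior S)"
      using homeomorphism_apply1[OF assms(1)] sub by (metis inj_on_inverseI subsetD)
  qed simp
  show "f x \<in> f ` interior S" using assms(2) by simp
  show "f ` interior S \<subseteq> R" using homeomorphism_image1[OF assms(1)] sub by blast
qed

text \<open>Any parametrization of the graph by the unit disk, composed with the projection, is a
  homeomorphism between two planar sets. In both directions it maps interior points to interior
  points, so the unit circle corresponds to the frontier of \<open>R\<close>.\<close>

lemma disk_boundary_graph:
  assumes R: "convex R" "compact R" "interior R \<noteq> {}" and h: "continuous_on R h"
  shows "disk_boundary (graph_over h R) = graph_over h (frontier R)"
proof -
  note hg = homeomorphism_graph[OF h]
  have front: "frontier R = R - interior R"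
    using R(2) by (simp add: frontier_def compact_imp_closed closure_closed)
  have sphere: "sphere (0::plane) 1 = cball 0 1 - interior (cball 0 1)"
    by (auto simp: interior_cball)
  show ?thesis
  proof
    show "disk_boundary (graph_over h R) \<subseteq> graph_over h (frontier R)"
    proof
      fix z assume "z \<in> disk_boundary (graph_over h R)"
      then obtain f g y where fg: "homeomorphism (cball (0::plane) 1) (graph_over h R) f g"
        and y: "y \<in> sphere 0 1" "z = f y"
        unfolding disk_boundary_def by blast
      have yc: "y \<in> cball 0 1" "y \<notin> interior (cball 0 1)" using y sphere by auto
      have hom: "homeomorphism R (cball 0 1) (g \<circ> (\<lambda>x. (x, h x))) (fst \<circ> f)"
        by (rule homeomorphism_compose[OF hg homeomorphism_symD[OF fg]])
      have zg: "z \<in> graph_over h R" using homeomorphism_image1[OF fg] yc y by blast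
      then obtain x where x: "x \<in> R" "z = (x, h x)" by (auto simp: graph_over_def)
      have "g z = y" using homeomorphism_apply1[OF fg yc(1)] y by simp
      then have "x \<notin> interior R"
        using homeomorphism_interior[OF hom, of x] yc(2) x by auto
      then show "z \<in> graph_over h (frontier R)" using x front by auto
    qed
    show "graph_over h (frontier R) \<subseteq> disk_boundary (graph_over h R)"
    proof
      fix z assume "z \<in> graph_over h (frontier R)"
      then obtain x where x: "x \<in> R" "x \<notin> interior R" "z = (x, h x)"
        using front by (auto simp: graph_over_def)
      have "R homeomorphic cball (0::plane) 1"
        by (rule homeomorphic_convex_compact_cball[OF R]) simp
      then obtain f g where fg: "homeomorphism R (cball (0::plane) 1) f g"
        unfolding homeomorphic_def by blast
      have hom: "homeomorphism (cball 0 1) (graph_over h R) ((\<lambda>x. (x, h x)) \<circ> g) (f \<circ> fst)"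
        by (rule homeomorphism_compose[OF homeomorphism_symD[OF fg] hg])
      have fx: "f x \<in> cball 0 1" "g (f x) = x"
        using homeomorphism_image1[OF fg] homeomorphism_apply1[OF fg] x by blast+
      have "f x \<notin> interior (cball 0 1)"
        using homeomorphism_interior[OF homeomorphism_symD[OF fg], of "f x"] fx(2) x(2) by metis
      then have "f x \<in> sphere 0 1" unfolding sphere using fx(1) by blast
      moreover have "z = ((\<lambda>x. (x, h x)) \<circ> g) (f x)" using fx x by simp
      ultimately show "z \<in> disk_boundary (graph_over h R)"
        unfolding disk_boundary_def using hom by blast
    qed
  qed
qed

lemma portion_graph:
  assumes "Q \<subseteq> P" shows "portion (graph_over h P) Q = graph_over h Q"
  using assms by (auto simp: portion_def graph_over_def)

lemma graph_over_eqD: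
  assumes "graph_over h R = graph_over u R'"
  shows "R = R' \<and> (\<forall>x\<in>R. h x = u x)"
proof -
  have 1: "x \<in> R' \<and> h x = u x" if "x \<in> R" for x
  proof -
    have "(x, h x) \<in> graph_over h R" using that by simp
    then show ?thesis unfolding assms by simp
  qed
  have 2: "x \<in> R" if "x \<in> R'" for x
  proof -
    have "(x, u x) \<in> graph_over u R'" using that by simp
    then show ?thesis unfolding assms[symmetric] by simp
  qed
  show ?thesis using 1 2 by blast
qed

lemma cap_above_graph:
  assumes P: "Q \<subseteq> P" "continuous_on P h"
    and Q: "convex Q" "compact Q" "interior Q \<noteq> {}"
    and cap: "cap_above (graph_over h P) Q D"
  obtains u where "continuous_on Q u" "D = graph_over u Q"
    "\<And>x. x \<in> Q - interior Q \<Longrightarrow> u x = h x" "\<And>x. x \<in> interior Q \<Longrightarrow> h x < u x"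
proof -
  have c: "disk_boundary D = disk_boundary (portion (graph_over h P) Q)" "projects_homeomorphically D Q"
    and above: "\<And>z w. z \<in> D - disk_boundary D \<Longrightarrow> w \<in> graph_over h P \<Longrightarrow> fst w = fst z \<Longrightarrow> snd w < snd z"
    using cap unfolding cap_above_def by auto
  obtain u where u: "continuous_on Q u" "D = graph_over u Q"
    using projects_homeomorphically_graph[OF c(2)] .
  have hQ: "continuous_on Q h" using P continuous_on_subset by blast
  have front: "frontier Q = Q - interior Q"
    using Q(2) by (simp add: frontier_def compact_imp_closed closure_closed)
  have bd: "disk_boundary D = graph_over u (frontier Q)"
    unfolding u(2) by (rule disk_boundary_graph[OF Q u(1)])
  moreover have "disk_boundary D = graph_over h (frontier Q)"
    unfolding c(1) portion_graph[OF P(1)] by (rule disk_boundary_graph[OF Q hQ])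
  ultimately have eq: "\<forall>x\<in>frontier Q. u x = h x" using graph_over_eqD by metis
  have "h x < u x" if "x \<in> interior Q" for x
  proof -
    have x: "x \<in> Q" "x \<notin> frontier Q" using that interior_subset front by blast+
    have "(x, u x) \<in> D - disk_boundary D" using x bd u(2) by simp
    moreover have "(x, h x) \<in> graph_over h P" using x P by auto
    ultimately show ?thesis using above[of "(x, u x)" "(x, h x)"] by simp
  qed
  then show ?thesis using that[OF u] eq front by simp
qed

text \<open>\<open>Q\<close> and \<open>P - interior Q\<close> are closed and cover
  \<open>P\<close>, and the two functions agree on their overlap.\<close>

lemma continuous_on_paste:
  fixes u h :: "plane \<Rightarrow> real"
  assumes "Q \<subseteq> P" "closed P" "closed Q" "continuous_on Q u" "continuous_on P h"
    "\<And>x. x \<in> Q - interior Q \<Longrightarrow> u x = h x"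
  shows "continuous_on P (\<lambda>x. if x \<in> Q then u x else h x)"
proof -
  have "continuous_on (Q \<union> (P - interior Q)) (\<lambda>x. if x \<in> Q then u x else h x)"
  proof (rule continuous_on_cases)
    show "closed (P - interior Q)" using assms by (intro closed_Diff) auto
    show "continuous_on (P - interior Q) h" using assms(5) by (rule continuous_on_subset) auto
  qed (use assms in auto)
  moreover have "Q \<union> (P - interior Q) = P" using assms(1) interior_subset[of Q] by blast
  ultimately show ?thesis by simp
qed

text \<open>By induction along the path: over a surface that is a graph, the next cap is the graph
  of a function agreeing with it on the boundary of the quadrilateral, and pasting gives the next
  height function.\<close>

lemma blow_up_surfaces_graphs:
  assumes P: "convex P" "compact P" "interior P \<noteq> {}"
    and surf: "blow_up_surfaces P k T S D"
    and Q: "\<And>i. 1 \<le> i \<Longrightarrow> i \<le> k \<Longrightarrow> Q i = flip_quad (T (i - 1)) (T i)"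
    and Qc: "\<And>i. 1 \<le> i \<Longrightarrow> i \<le> k \<Longrightarrow> Q i \<subseteq> P \<and> convex (Q i) \<and> compact (Q i) \<and> interior (Q i) \<noteq> {}"
  obtains h where
    "\<And>i. i \<le> k \<Longrightarrow> continuous_on P (h i) \<and> S i = graph_over (h i) P"
    "\<And>i. 1 \<le> i \<Longrightarrow> i \<le> k \<Longrightarrow> D i = graph_over (h i) (Q i)"
    "\<And>i x. 1 \<le> i \<Longrightarrow> i \<le> k \<Longrightarrow> x \<in> interior (Q i) \<Longrightarrow> h (i - 1) x < h i x"
    "\<And>i x. 1 \<le> i \<Longrightarrow> i \<le> k \<Longrightarrow> x \<in> P - interior (Q i) \<Longrightarrow> h i x = h (i - 1) x"
    "\<And>x. x \<in> frontier P \<Longrightarrow> h 0 x = 0"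
proof -
  have init: "projects_homeomorphically (S 0) P" "disk_boundary (S 0) = embed ` frontier P"
    using surf unfolding blow_up_surfaces_def initial_disk_def by auto
  have step: "cap_above (S (i - 1)) (Q i) (D i)"
     "S i = (S (i - 1) - portion (S (i - 1)) (Q i)) \<union> D i" if "1 \<le> i" "i \<le> k" for i
    using surf that Q[OF that] unfolding blow_up_surfaces_def Let_def by auto
  have nxt: "\<exists>u. continuous_on (Q i) u \<and> D i = graph_over u (Q i) \<and>
       (\<forall>x\<in>Q i - interior (Q i). u x = h x) \<and> (\<forall>x\<in>interior (Q i). h x < u x) \<and>
       continuous_on P (\<lambda>x. if x \<in> Q i then u x else h x) \<and>
       S i = graph_over (\<lambda>x. if x \<in> Q i then u x else h x) P"
    if i: "1 \<le> i" "i \<le> k" and h: "continuous_on P h" "S (i - 1) = graph_over h P" for i h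
  proof -
    note q = Qc[OF i]
    obtain u where u: "continuous_on (Q i) u" "D i = graph_over u (Q i)"
      "\<And>x. x \<in> Q i - interior (Q i) \<Longrightarrow> u x = h x" "\<And>x. x \<in> interior (Q i) \<Longrightarrow> h x < u x"
      using cap_above_graph[of "Q i" P h "D i"] q h step(1)[OF i] by auto
    have "continuous_on P (\<lambda>x. if x \<in> Q i then u x else h x)"
      using q P(2) u h(1) by (intro continuous_on_paste) (auto simp: compact_imp_closed)
    moreover have "S i = graph_over (\<lambda>x. if x \<in> Q i then u x else h x) P"
      unfolding step(2)[OF i] h(2) u(2) using q by (auto simp: portion_def graph_over_def)
    ultimately show ?thesis using u by blast
  qed
  have ex: "\<exists>h. continuous_on P h \<and> S i = graph_over h P" if "i \<le> k" for i
    using that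
  proof (induction i)
    case 0
    then show ?case using projects_homeomorphically_graph[OF init(1)] by metis
  next
    case (Suc i)
    then obtain h where "continuous_on P h" "S (Suc i - 1) = graph_over h P" by auto
    then show ?case using nxt[of "Suc i" h] Suc by auto
  qed
  then obtain h where h: "\<And>i. i \<le> k \<Longrightarrow> continuous_on P (h i) \<and> S i = graph_over (h i) P"
    by metis
  show ?thesis
  proof
    show "continuous_on P (h i) \<and> S i = graph_over (h i) P" if "i \<le> k" for i by (rule h[OF that])
    have "graph_over (h 0) (frontier P) = embed ` frontier P"
      using disk_boundary_graph[OF P, of "h 0"] h[of 0] init(2) by simp
    then have "graph_over (h 0) (frontier P) = graph_over (\<lambda>x. 0) (frontier P)"
      by (simp add: graph_over_def)
    then show "h 0 x = 0" if "x \<in> frontier P" for x using graph_over_eqD that by blast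
    fix i assume i: "1 \<le> i" "i \<le> k"
    have i1: "i - 1 \<le> k" using i by simp
    obtain u where u: "D i = graph_over u (Q i)"
       "\<forall>x\<in>Q i - interior (Q i). u x = h (i - 1) x" "\<forall>x\<in>interior (Q i). h (i - 1) x < u x"
       "S i = graph_over (\<lambda>x. if x \<in> Q i then u x else h (i - 1) x) P"
      using nxt[OF i conjunct1[OF h[OF i1]] conjunct2[OF h[OF i1]]] by (elim exE conjE) (rule that)
    have eq: "h i x = (if x \<in> Q i then u x else h (i - 1) x)" if "x \<in> P" for x
      using graph_over_eqD[OF trans[OF sym[OF conjunct2[OF h[OF i(2)]]] u(4)]] that by simp
    have QP: "Q i \<subseteq> P" "interior (Q i) \<subseteq> Q i" using Qc[OF i] interior_subset by auto
    show "D i = graph_over (h i) (Q i)"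
      unfolding u(1) graph_over_def
    proof (rule image_cong)
      show "(x, u x) = (x, h i x)" if "x \<in> Q i" for x using eq[of x] QP that by auto
    qed simp
    show "h (i - 1) x < h i x" if "x \<in> interior (Q i)" for x
    proof -
      have "x \<in> Q i" "x \<in> P" using that QP by auto
      then show ?thesis using eq[of x] u(3) that by simp
    qed
    show "h i x = h (i - 1) x" if "x \<in> P - interior (Q i)" for x
      using eq[of x] u(2) that by auto
  qed
qed

lemma compact_region_between:
  assumes Q: "compact Q" and c: "continuous_on Q h" "continuous_on Q u"
  shows "compact (region_between h u Q)"
proof -
  have cl: "closed (Q \<times> (UNIV::real set))"
    using Q by (intro closed_Times) (auto simp: compact_imp_closed)
  have f: "continuous_on (Q \<times> UNIV) (\<lambda>y. f (fst y))" if "continuous_on Q f" for f :: "plane \<Rightarrow> real"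
    by (rule continuous_on_compose2[OF that continuous_on_fst]) auto
  have "closed (Q \<times> UNIV \<inter> (\<lambda>y. snd y - h (fst y)) -` {0..} \<inter> (Q \<times> UNIV \<inter> (\<lambda>y. u (fst y) - snd y) -` {0..}))"
    using f[OF c(1)] f[OF c(2)] cl
    by (intro closed_Int continuous_closed_preimage continuous_intros) auto
  also have "Q \<times> UNIV \<inter> (\<lambda>y. snd y - h (fst y)) -` {0..} \<inter> (Q \<times> UNIV \<inter> (\<lambda>y. u (fst y) - snd y) -` {0..})
     = region_between h u Q" by (auto simp: region_between_def)
  finally have "closed (region_between h u Q)" .
  moreover have "bounded (region_between h u Q)"
  proof -
    have "bounded (h ` Q)" "bounded (u ` Q)"
      using c Q by (auto intro!: compact_imp_bounded compact_continuous_image)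
    then obtain M N where M: "\<And>x. x \<in> Q \<Longrightarrow> \<bar>h x\<bar> \<le> M" and N: "\<And>x. x \<in> Q \<Longrightarrow> \<bar>u x\<bar> \<le> N"
      unfolding bounded_real by blast
    have "region_between h u Q \<subseteq> Q \<times> {- M..N}"
    proof
      fix y assume "y \<in> region_between h u Q"
      then obtain x z where y: "y = (x, z)" "x \<in> Q" "h x \<le> z" "z \<le> u x" by (cases y) auto
      then show "y \<in> Q \<times> {- M..N}" using M[of x] N[of x] by auto
    qed
    moreover have "bounded (Q \<times> {- M..N})"
      using Q by (intro bounded_Times compact_imp_bounded) auto
    ultimately show ?thesis using bounded_subset by blast
  qed
  ultimately show ?thesis by (simp add: compact_eq_bounded_closed)
qed

text \<open>From a point outside the region a vertical ray escapes to infinity without meeting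
  either graph. A component of the complement starting inside cannot leave the compact region, whose
  frontier lies on the two graphs.\<close>

lemma ball_bounded_by_graphs:
  assumes Q: "compact Q" and c: "continuous_on Q h" "continuous_on Q u"
    and eq: "\<And>x. x \<in> Q - interior Q \<Longrightarrow> h x = u x" and lt: "\<And>x. x \<in> interior Q \<Longrightarrow> h x < u x"
  shows "ball_bounded_by (graph_over h Q \<union> graph_over u Q) = region_between h u Q"
proof -
  let ?B = "graph_over h Q \<union> graph_over u Q" and ?R = "region_between h u Q"
  have le: "h x \<le> u x" if "x \<in> Q" for x
    using eq[of x] lt[of x] that by (cases "x \<in> interior Q") auto
  have BR: "?B \<subseteq> ?R" using le by (auto simp: graph_over_def)
  have comp: "compact ?R" by (rule compact_region_between[OF Q c])
  have notin: "y \<notin> inside ?B" if A: "connected A" "\<not> bounded A" "y \<in> A" "A \<inter> ?B = {}" for y A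
  proof
    assume "y \<in> inside ?B"
    then have "bounded (connected_component_set (- ?B) y)" by (simp add: inside_def)
    moreover have "A \<subseteq> connected_component_set (- ?B) y"
      using A by (intro connected_component_maximal) auto
    ultimately show False using A(2) bounded_subset by blast
  qed
  have unb: "\<not> bounded ({x} \<times> Z)" if "\<not> bounded Z" for x :: plane and Z :: "real set"
  proof
    assume "bounded ({x} \<times> Z)"
    then have "bounded (snd ` ({x} \<times> Z))" by (rule bounded_snd)
    then show False using that by simp
  qed
  have rays: "\<not> bounded {z::real..}" "\<not> bounded {..z::real}" for z
  proof -
    show "\<not> bounded {z..}"
    proof
      assume "bounded {z..}"
      then obtain a where a: "\<forall>x\<in>{z..}. \<bar>x\<bar> \<le> a" unfolding bounded_real by blast
      have "max z (a + 1) \<in> {z..}" by simp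
      then have "\<bar>max z (a + 1)\<bar> \<le> a" using a by blast
      then show False by linarith
    qed
    show "\<not> bounded {..z}"
    proof
      assume "bounded {..z}"
      then obtain a where a: "\<forall>x\<in>{..z}. \<bar>x\<bar> \<le> a" unfolding bounded_real by blast
      have "min z (- a - 1) \<in> {..z}" by simp
      then have "\<bar>min z (- a - 1)\<bar> \<le> a" using a by blast
      then show False by linarith
    qed
  qed
  have "inside ?B \<subseteq> ?R"
  proof
    fix y assume y: "y \<in> inside ?B"
    obtain x z where xz: "y = (x, z)" by (cases y)
    have conn: "connected ({x} \<times> Z)" if "connected Z" for Z :: "real set"
      using that by (intro connected_Times) auto
    show "y \<in> ?R"
    proof (rule ccontr)
      assume "y \<notin> ?R"
      then consider "x \<notin> Q" | "x \<in> Q" "z < h x" | "x \<in> Q" "u x < z" using xz by force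
      then show False
      proof cases
        case 1
        then have "({x} \<times> {z..}) \<inter> ?B = {}" by auto
        then show ?thesis using notin[OF conn unb, of "{z..}" y] y xz rays by auto
      next
        case 2
        then have "({x} \<times> {..z}) \<inter> ?B = {}" using le[of x] by auto
        then show ?thesis using notin[OF conn unb, of "{..z}" y] y xz rays by auto
      next
        case 3
        then have "({x} \<times> {z..}) \<inter> ?B = {}" using le[of x] by auto
        then show ?thesis using notin[OF conn unb, of "{z..}" y] y xz rays by auto
      qed
    qed
  qed
  moreover have "?R - ?B \<subseteq> inside ?B"
  proof
    fix y assume y: "y \<in> ?R - ?B"
    let ?C = "connected_component_set (- ?B) y"
    let ?O = "interior Q \<times> UNIV \<inter> (\<lambda>y. snd y - h (fst y)) -` {0<..} \<inter>
        (interior Q \<times> UNIV \<inter> (\<lambda>y. u (fst y) - snd y) -` {0<..})"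
    have f: "continuous_on (interior Q \<times> UNIV) (\<lambda>y::space. f (fst y))" if "continuous_on Q f" for f :: "plane \<Rightarrow> real"
      using interior_subset[of Q] by (intro continuous_on_compose2[OF that continuous_on_fst]) auto
    have "open ?O"
      using f[OF c(1)] f[OF c(2)]
      by (intro open_Int continuous_open_preimage continuous_intros open_Times) auto
    moreover have "?O \<subseteq> ?R" using interior_subset[of Q] by (auto simp: region_between_def)
    moreover have "?R - ?B \<subseteq> ?O"
    proof
      fix w assume w: "w \<in> ?R - ?B"
      obtain x z where xz: "w = (x, z)" by (cases w)
      then have x: "x \<in> Q" "h x < z" "z < u x" using w by (auto simp: order_less_le)
      then have "x \<in> interior Q" using eq[of x] by (cases "x \<in> interior Q") auto
      then show "w \<in> ?O" using x xz by simp
    qed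
    ultimately have int: "?R - ?B \<subseteq> interior ?R" using interior_maximal by blast
    have fr: "frontier ?R \<subseteq> ?B"
      using int comp by (auto simp: frontier_def compact_imp_closed closure_closed)
    have "?C \<subseteq> ?R"
    proof (rule ccontr)
      assume "\<not> ?C \<subseteq> ?R"
      then have "?C - ?R \<noteq> {}" by blast
      moreover have "y \<in> ?C" using y by (simp add: connected_component_refl)
      then have "?C \<inter> ?R \<noteq> {}" using y by blast
      ultimately have "?C \<inter> frontier ?R \<noteq> {}"
        using connected_Int_frontier[OF connected_connected_component] by blast
      then show False using fr connected_component_subset[of "- ?B" y] by blast
    qed
    then have "bounded ?C" using comp compact_imp_bounded bounded_subset by blast
    then show "y \<in> inside ?B" using y by (simp add: inside_def)
  qed
  ultimately show ?thesis unfolding ball_bounded_by_def using BR by blast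
qed

section \<open>The tetrahedron over a quadrilateral\<close>

text \<open>Where \<open>w\<close> vanishes the factor \<open>\<theta>\<close> may jump, but it is
  bounded and the product is squeezed to 0; elsewhere \<open>w\<close> is nonzero nearby and
  \<open>\<theta>\<close> is continuous.\<close>

lemma continuous_on_bounded_mult:
  fixes w \<theta> :: "'a::topological_space \<Rightarrow> real"
  assumes w: "continuous_on S w" and b: "\<And>y. y \<in> S \<Longrightarrow> \<bar>\<theta> y\<bar> \<le> 1"
    and c: "continuous_on {y \<in> S. w y \<noteq> 0} \<theta>"
  shows "continuous_on S (\<lambda>y. \<theta> y * w y)"
  unfolding continuous_on_def
proof
  fix y assume y: "y \<in> S"
  have wy: "(w \<longlongrightarrow> w y) (at y within S)" using w y by (simp add: continuous_on_def)
  show "((\<lambda>y. \<theta> y * w y) \<longlongrightarrow> \<theta> y * w y) (at y within S)"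
  proof (cases "w y = 0")
    case True
    have "((\<lambda>y. \<theta> y * w y) \<longlongrightarrow> 0) (at y within S)"
    proof (rule Lim_null_comparison)
      show "\<forall>\<^sub>F y in at y within S. norm (\<theta> y * w y) \<le> \<bar>w y\<bar>"
        unfolding eventually_at_filter
      proof (rule eventuallyI, intro impI)
        fix z assume "z \<noteq> y" "z \<in> S"
        then have "\<bar>\<theta> z\<bar> * \<bar>w z\<bar> \<le> 1 * \<bar>w z\<bar>" using b by (intro mult_right_mono) auto
        then show "norm (\<theta> z * w z) \<le> \<bar>w z\<bar>" by (simp add: abs_mult)
      qed
      show "((\<lambda>y. \<bar>w y\<bar>) \<longlongrightarrow> 0) (at y within S)"
        using tendsto_rabs[OF wy] True by simp
    qed
    then show ?thesis using True by simp
  next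
    case False
    have ev: "\<forall>\<^sub>F z in at y within S. w z \<noteq> 0"
      using tendsto_imp_eventually_ne[OF wy False] .
    have "(\<theta> \<longlongrightarrow> \<theta> y) (at y within {y \<in> S. w y \<noteq> 0})"
      using c y False by (simp add: continuous_on_def)
    then have "(\<theta> \<longlongrightarrow> \<theta> y) (at y within S)"
    proof (rule filterlim_mono_eventually[OF _ order_refl])
      show "at y within S \<le> at y within {y \<in> S. w y \<noteq> 0}"
        using ev unfolding at_within_def le_inf_iff
        by (auto simp: le_principal eventually_inf_principal eventually_at_filter elim!: eventually_mono)
    qed auto
    then show ?thesis using wy by (rule tendsto_mult)
  qed
qed

lemma orient_inner:
  obtains g k where "\<And>x. orient a b x = inner g x + k"
proof
  show "orient a b x = inner (vector [- (b $ 2 - a $ 2), b $ 1 - a $ 1]) x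
     + ((b $ 2 - a $ 2) * a $ 1 - (b $ 1 - a $ 1) * a $ 2)" for x
    by (simp add: orient_def inner_vec_def sum_2 algebra_simps)
qed

lemma convex_hull_affine_graph:
  assumes "\<And>x. \<phi> x = inner g x + k"
  shows "convex hull ((\<lambda>x. (x, \<phi> x)) ` V) = (\<lambda>x::plane. (x, \<phi> x :: real)) ` (convex hull V)"
proof -
  have lin: "linear (\<lambda>x. (x, inner g x))"
    by (rule linearI) (simp_all add: inner_add_right)
  have eq: "(\<lambda>x. (x, \<phi> x)) ` W = (+) (0, k) ` (\<lambda>x. (x, inner g x)) ` W" for W
    unfolding image_image using assms by (simp add: add.commute)
  show ?thesis
    unfolding eq convex_hull_translation convex_hull_linear_image[OF lin] by simp
qed

lemma convex_affine_le:
  assumes "\<And>x. \<phi> x = inner g x + k"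
  shows "convex {(x::plane, z::real). \<phi> x \<le> s * z + t}"
proof -
  have "{(x::plane, z::real). \<phi> x \<le> s * z + t} = {y. inner (g, - s) y \<le> t - k}"
    using assms by (auto simp: inner_prod_def algebra_simps)
  then show ?thesis by (simp add: convex_halfspace_le)
qed

lemma convex_hull_4I:
  assumes "0 \<le> s" "0 \<le> t" "0 \<le> u" "0 \<le> v" "s + t + u + v = 1"
  shows "s *\<^sub>R a + t *\<^sub>R b + u *\<^sub>R c + v *\<^sub>R d \<in> convex hull {a, b, c, d}"
proof (cases "v = 1")
  case True
  then have "s = 0" "t = 0" "u = 0" using assms by auto
  then show ?thesis using True by (simp add: hull_inc)
next
  case False
  have v: "1 - v > 0" using assms False by auto
  have abc: "(s / (1 - v)) *\<^sub>R a + (t / (1 - v)) *\<^sub>R b + (u / (1 - v)) *\<^sub>R c \<in> convex hull {a, b, c}"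
    unfolding convex_hull_3
    using assms v by (intro CollectI exI[of _ "s / (1 - v)"] exI[of _ "t / (1 - v)"] exI[of _ "u / (1 - v)"])
      (auto simp: add_divide_distrib[symmetric])
  then have "(s / (1 - v)) *\<^sub>R a + (t / (1 - v)) *\<^sub>R b + (u / (1 - v)) *\<^sub>R c \<in> convex hull {a, b, c, d}"
    using hull_mono[of "{a, b, c}" "{a, b, c, d}" convex] by blast
  moreover have "d \<in> convex hull {a, b, c, d}" by (simp add: hull_inc)
  ultimately have "(1 - v) *\<^sub>R ((s / (1 - v)) *\<^sub>R a + (t / (1 - v)) *\<^sub>R b + (u / (1 - v)) *\<^sub>R c) + v *\<^sub>R d
     \<in> convex hull {a, b, c, d}"
    using assms v by (intro convexD[OF convex_convex_hull]) auto
  then show ?thesis using v by (simp add: scaleR_add_right)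
qed

text \<open>\<open>o'\<close> is the crossing point of the diagonals. The vertices \<open>c\<close>
  and \<open>d\<close> lie on the rays opposite to \<open>a\<close> and \<open>b\<close>, at
  distances scaled by \<open>\<kappa>\<close> and \<open>\<mu>\<close>; this makes
  \<open>a - o'\<close>, \<open>b - o'\<close> a convenient basis.\<close>

locale quadrilateral =
  fixes a b c d o' :: plane and \<kappa> \<mu> :: real
  assumes \<kappa>: "0 < \<kappa>" and \<mu>: "0 < \<mu>"
    and c: "c = o' - \<kappa> *\<^sub>R (a - o')" and d: "d = o' - \<mu> *\<^sub>R (b - o')"
    and D: "orient o' a b \<noteq> 0"
begin

text \<open>The coordinates of \<open>x\<close> in the basis \<open>a - o'\<close>,
  \<open>b - o'\<close> with origin \<open>o'\<close>, by Cramer's rule.\<close>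

definition \<xi> :: "plane \<Rightarrow> real" where "\<xi> x = orient b o' x / orient o' a b"
definition \<eta> :: "plane \<Rightarrow> real" where "\<eta> x = orient o' a x / orient o' a b"

text \<open>\<open>A\<close> is the norm-like function with value 1 at \<open>a\<close> and \<open>c\<close> that vanishes on the line \<open>bd\<close>;
  \<open>B\<close> exchanges the two diagonals. The graphs of \<open>B\<close> and \<open>1 - A\<close> bound the tetrahedron.\<close>

definition A :: "plane \<Rightarrow> real" where "A x = max (\<xi> x) (- \<xi> x / \<kappa>)"
definition B :: "plane \<Rightarrow> real" where "B x = max (\<eta> x) (- \<eta> x / \<mu>)"

definition Q :: "plane set" where "Q = convex hull {a, b, c, d}"
text \<open>The removed diagonal \<open>ac\<close> lies at height 0 and the inserted one
  \<open>bd\<close> at height 1, so the lower faces lie over the old triangles and the upper faces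
  over the new ones.\<close>

definition \<Delta> :: "space set" where "\<Delta> = convex hull {(a, 0), (b, 1), (c, 0), (d, 1)}"

lemma \<xi>_inner: obtains g k where "\<And>x. \<xi> x = inner g x + k"
proof -
  obtain g k where "\<And>x. orient b o' x = inner g x + k" by (rule orient_inner[of b o']) blast
  then have "\<xi> x = inner (g /\<^sub>R orient o' a b) x + k / orient o' a b" for x
    using D by (simp add: \<xi>_def field_simps)
  then show ?thesis using that by blast
qed

lemma \<eta>_inner: obtains g k where "\<And>x. \<eta> x = inner g x + k"
proof -
  obtain g k where "\<And>x. orient o' a x = inner g x + k" by (rule orient_inner[of o' a]) blast
  note g = this
  have "\<eta> x = inner (g /\<^sub>R orient o' a b) x + k / orient o' a b" for x
    unfolding \<eta>_def g[of x] by (simp add: divide_inverse algebra_simps)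
  then show ?thesis using that by blast
qed

lemma coordinates: "x = o' + \<xi> x *\<^sub>R (a - o') + \<eta> x *\<^sub>R (b - o')"
proof -
  have "orient o' a b *\<^sub>R (x - o') = orient b o' x *\<^sub>R (a - o') + orient o' a x *\<^sub>R (b - o')"
    by (simp add: vec_eq_iff forall_2 orient_def algebra_simps)
  then have "(1 / orient o' a b) *\<^sub>R (orient o' a b *\<^sub>R (x - o')) =
     (1 / orient o' a b) *\<^sub>R (orient b o' x *\<^sub>R (a - o') + orient o' a x *\<^sub>R (b - o'))" by simp
  then have "x - o' = \<xi> x *\<^sub>R (a - o') + \<eta> x *\<^sub>R (b - o')"
    using D by (simp add: \<xi>_def \<eta>_def scaleR_add_right)
  then show ?thesis by (simp add: algebra_simps)
qed

lemma coordinates_combine: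
  "\<xi> (o' + s *\<^sub>R (a - o') + t *\<^sub>R (b - o')) = s" "\<eta> (o' + s *\<^sub>R (a - o') + t *\<^sub>R (b - o')) = t"
proof -
  have "orient b o' (o' + s *\<^sub>R (a - o') + t *\<^sub>R (b - o')) = s * orient o' a b"
    "orient o' a (o' + s *\<^sub>R (a - o') + t *\<^sub>R (b - o')) = t * orient o' a b"
    by (simp_all add: orient_def algebra_simps)
  then show "\<xi> (o' + s *\<^sub>R (a - o') + t *\<^sub>R (b - o')) = s" "\<eta> (o' + s *\<^sub>R (a - o') + t *\<^sub>R (b - o')) = t"
    using D by (simp_all add: \<xi>_def \<eta>_def)
qed

lemma coordinates_vertices [simp]:
  "\<xi> a = 1" "\<eta> a = 0" "\<xi> b = 0" "\<eta> b = 1" "\<xi> c = - \<kappa>" "\<eta> c = 0" "\<xi> d = 0" "\<eta> d = - \<mu>"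
proof -
  have "a = o' + 1 *\<^sub>R (a - o') + 0 *\<^sub>R (b - o')" "b = o' + 0 *\<^sub>R (a - o') + 1 *\<^sub>R (b - o')"
    "c = o' + (- \<kappa>) *\<^sub>R (a - o') + 0 *\<^sub>R (b - o')" "d = o' + 0 *\<^sub>R (a - o') + (- \<mu>) *\<^sub>R (b - o')"
    by (simp_all add: c d)
  then show "\<xi> a = 1" "\<eta> a = 0" "\<xi> b = 0" "\<eta> b = 1" "\<xi> c = - \<kappa>" "\<eta> c = 0" "\<xi> d = 0" "\<eta> d = - \<mu>"
    using coordinates_combine by metis+
qed

lemma A_cases: "0 \<le> \<xi> x \<Longrightarrow> A x = \<xi> x" "\<xi> x \<le> 0 \<Longrightarrow> A x = - \<xi> x / \<kappa>"
  unfolding A_def using max_absorb1[of "- \<xi> x / \<kappa>" "\<xi> x"] max_absorb2[of "\<xi> x" "- \<xi> x / \<kappa>"]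
    divide_nonpos_pos[of "- \<xi> x" \<kappa>] divide_nonneg_pos[of "- \<xi> x" \<kappa>] \<kappa> by linarith+

lemma B_cases: "0 \<le> \<eta> x \<Longrightarrow> B x = \<eta> x" "\<eta> x \<le> 0 \<Longrightarrow> B x = - \<eta> x / \<mu>"
  unfolding B_def using max_absorb1[of "- \<eta> x / \<mu>" "\<eta> x"] max_absorb2[of "\<eta> x" "- \<eta> x / \<mu>"]
    divide_nonpos_pos[of "- \<eta> x" \<mu>] divide_nonneg_pos[of "- \<eta> x" \<mu>] \<mu> by linarith+

lemma AB_nonneg: "0 \<le> A x" "0 \<le> B x"
  using A_cases[of x] B_cases[of x] divide_nonneg_pos[of "- \<xi> x" \<kappa>] divide_nonneg_pos[of "- \<eta> x" \<mu>] \<kappa> \<mu>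
  by linarith+

lemma mem_\<Delta>: "(x, z) \<in> \<Delta> \<longleftrightarrow> B x \<le> z \<and> z \<le> 1 - A x"
proof
  obtain g k where g: "\<And>x. \<xi> x = inner g x + k" by (rule \<xi>_inner) blast
  obtain g' k' where g': "\<And>x. \<eta> x = inner g' x + k'" by (rule \<eta>_inner) blast
  have n1: "- \<xi> x / \<kappa> = inner (- g /\<^sub>R \<kappa>) x + (- k / \<kappa>)" for x using g \<kappa> by (simp add: field_simps)
  have n2: "- \<eta> x / \<mu> = inner (- g' /\<^sub>R \<mu>) x + (- k' / \<mu>)" for x using g' \<mu> by (simp add: field_simps)
  let ?H = "{(x::plane, z::real). \<xi> x \<le> (-1) * z + 1} \<inter> {(x, z). - \<xi> x / \<kappa> \<le> (-1) * z + 1} \<inter>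
    {(x, z). \<eta> x \<le> 1 * z + 0} \<inter> {(x, z). - \<eta> x / \<mu> \<le> 1 * z + 0}"
  have H: "(x, z) \<in> ?H \<longleftrightarrow> B x \<le> z \<and> z \<le> 1 - A x" for x z by (auto simp: A_def B_def)
  have "convex ?H"
    by (intro convex_Int convex_affine_le[OF g] convex_affine_le[OF g'] convex_affine_le[OF n1] convex_affine_le[OF n2])
  moreover have "{(a, 0), (b, 1), (c, 0), (d, 1)} \<subseteq> ?H"
    using \<kappa> \<mu> by (auto intro: order_trans[of "-1" 0])
  ultimately have "\<Delta> \<subseteq> ?H" unfolding \<Delta>_def by (rule hull_minimal[rotated])
  then show "B x \<le> z \<and> z \<le> 1 - A x" if "(x, z) \<in> \<Delta>" using H that by blast
next
  assume as: "B x \<le> z \<and> z \<le> 1 - A x"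
  have "\<xi> x \<le> A x" "- \<xi> x / \<kappa> \<le> A x" "\<eta> x \<le> B x" "- \<eta> x / \<mu> \<le> B x"
    unfolding A_def B_def by (rule max.cobounded1 max.cobounded2)+
  then have "\<xi> x \<le> 1 - z" "- \<xi> x / \<kappa> \<le> 1 - z" "\<eta> x \<le> z" "- \<eta> x / \<mu> \<le> z"
    using as by linarith+
  then have i: "\<xi> x \<le> 1 - z" "- \<xi> x \<le> (1 - z) * \<kappa>" "\<eta> x \<le> z" "- \<eta> x \<le> z * \<mu>"
    using \<kappa> \<mu> by (simp_all only: pos_divide_le_eq)
  \<comment> \<open>Barycentric coordinates: \<open>sa\<close> and \<open>sc\<close> must add up to
    \<open>1 - z\<close> and produce \<open>\<xi> x\<close>, while \<open>sb\<close> and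
    \<open>sd\<close> must add up to \<open>z\<close> and produce \<open>\<eta> x\<close>.\<close>
  define sa sb sc sd where "sa = ((1 - z) * \<kappa> + \<xi> x) / (1 + \<kappa>)" and "sb = (z * \<mu> + \<eta> x) / (1 + \<mu>)"
    and "sc = ((1 - z) - \<xi> x) / (1 + \<kappa>)" and "sd = (z - \<eta> x) / (1 + \<mu>)"
  have nn: "0 \<le> sa" "0 \<le> sb" "0 \<le> sc" "0 \<le> sd"
    unfolding sa_def sb_def sc_def sd_def using i \<kappa> \<mu> by (intro divide_nonneg_pos; linarith)+
  have s1: "sa + sc = 1 - z" "sb + sd = z" "sa - \<kappa> * sc = \<xi> x" "sb - \<mu> * sd = \<eta> x"
    using \<kappa> \<mu> unfolding sa_def sb_def sc_def sd_def by (simp_all add: divide_simps) (simp_all add: algebra_simps)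
  have "sa *\<^sub>R a + sb *\<^sub>R b + sc *\<^sub>R c + sd *\<^sub>R d =
     (sa + sc + (sb + sd)) *\<^sub>R o' + (sa - \<kappa> * sc) *\<^sub>R (a - o') + (sb - \<mu> * sd) *\<^sub>R (b - o')"
    unfolding c d by (simp add: algebra_simps)
  also have "\<dots> = x" unfolding s1 using coordinates[of x] by simp
  finally have "sa *\<^sub>R (a, 0) + sb *\<^sub>R (b, 1) + sc *\<^sub>R (c, 0) + sd *\<^sub>R (d, 1) = (x, z)"
    using s1 by simp
  moreover have "sa *\<^sub>R (a, 0) + sb *\<^sub>R (b, 1) + sc *\<^sub>R (c, 0) + sd *\<^sub>R (d, 1) \<in> \<Delta>"
    unfolding \<Delta>_def by (rule convex_hull_4I[OF nn]) (use s1 in linarith)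
  ultimately show "(x, z) \<in> \<Delta>" by metis
qed

lemma mem_Q: "x \<in> Q \<longleftrightarrow> A x + B x \<le> 1"
proof -
  have "Q = fst ` \<Delta>"
    unfolding Q_def \<Delta>_def convex_hull_linear_image[OF linear_fst] by simp
  then have "x \<in> Q \<longleftrightarrow> (\<exists>z. (x, z) \<in> \<Delta>)" by force
  also have "\<dots> \<longleftrightarrow> A x + B x \<le> 1" unfolding mem_\<Delta> by (auto intro: exI[of _ "B x"])
  finally show ?thesis .
qed

lemma continuous_AB: "continuous_on S A" "continuous_on S B"
proof -
  obtain g k where g: "\<And>x. \<xi> x = inner g x + k" by (rule \<xi>_inner) blast
  obtain g' k' where g': "\<And>x. \<eta> x = inner g' x + k'" by (rule \<eta>_inner) blast
  show "continuous_on S A" unfolding A_def g using \<kappa> by (intro continuous_intros) auto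
  show "continuous_on S B" unfolding B_def g' using \<mu> by (intro continuous_intros) auto
qed

lemma AB_scale:
  assumes "0 \<le> s"
  shows "A (o' + s *\<^sub>R (x - o')) = s * A x" "B (o' + s *\<^sub>R (x - o')) = s * B x"
proof -
  have "x - o' = \<xi> x *\<^sub>R (a - o') + \<eta> x *\<^sub>R (b - o')"
    using coordinates[of x] by (simp add: algebra_simps)
  then have "o' + s *\<^sub>R (x - o') = o' + (s * \<xi> x) *\<^sub>R (a - o') + (s * \<eta> x) *\<^sub>R (b - o')"
    by (simp add: scaleR_add_right add.assoc)
  then have "\<xi> (o' + s *\<^sub>R (x - o')) = s * \<xi> x" "\<eta> (o' + s *\<^sub>R (x - o')) = s * \<eta> x"
    using coordinates_combine[of "s * \<xi> x" "s * \<eta> x"] by (simp_all add: add.assoc)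
  then show "A (o' + s *\<^sub>R (x - o')) = s * A x" "B (o' + s *\<^sub>R (x - o')) = s * B x"
    using assms by (simp_all add: A_def B_def max_mult_distrib_left)
qed

lemma interior_Q: "interior Q = {x. A x + B x < 1}"
proof
  have "open {x. A x + B x < 1}"
    using continuous_AB by (intro open_Collect_less continuous_intros) auto
  then show "{x. A x + B x < 1} \<subseteq> interior Q"
    by (intro interior_maximal) (auto simp: mem_Q)
  show "interior Q \<subseteq> {x. A x + B x < 1}"
  proof
    fix x assume x: "x \<in> interior Q"
    then have le: "A x + B x \<le> 1" using interior_subset mem_Q by blast
    obtain e where e: "0 < e" "ball x e \<subseteq> Q" using x mem_interior by blast
    \<comment> \<open>Small enough that stretching \<open>x\<close> away from \<open>o'\<close> by
      the factor \<open>1 + \<epsilon>\<close> stays in the ball around \<open>x\<close>. On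
      \<open>A x + B x = 1\<close> such a stretch would leave \<open>Q\<close>, since
      \<open>A\<close> and \<open>B\<close> scale with it.\<close>
    define \<epsilon> where "\<epsilon> = e / (2 * (norm (x - o') + 1))"
    have pos: "0 < norm (x - o') + 1" by (smt (verit) norm_ge_zero)
    have \<epsilon>: "0 < \<epsilon>" using e pos by (simp add: \<epsilon>_def)
    have "\<epsilon> * norm (x - o') < \<epsilon> * (2 * (norm (x - o') + 1))"
      using \<epsilon> by (intro mult_strict_left_mono) (smt (verit) norm_ge_zero)+
    also have "\<dots> = e" using pos by (simp add: \<epsilon>_def)
    finally have lt: "\<epsilon> * norm (x - o') < e" .
    let ?y = "o' + (1 + \<epsilon>) *\<^sub>R (x - o')"
    have "?y - x = \<epsilon> *\<^sub>R (x - o')" by (simp add: algebra_simps)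
    moreover have "dist x ?y = norm (?y - x)" by (metis dist_norm dist_commute)
    ultimately have "dist x ?y < e" using lt \<epsilon> by simp
    then have "?y \<in> Q" using e by auto
    then have "(1 + \<epsilon>) * (A x + B x) \<le> 1"
      using AB_scale[of "1 + \<epsilon>" x] \<epsilon> by (simp add: mem_Q distrib_left)
    then have "A x + B x \<noteq> 1" using \<epsilon> by auto
    then show "x \<in> {x. A x + B x < 1}" using le by simp
  qed
qed

text \<open>On \<open>A x + B x = 1\<close> the values \<open>A x\<close> and \<open>B x\<close> are
  the weights of the two ends of the side; the signs of \<open>\<xi> x\<close> and
  \<open>\<eta> x\<close> select the ends.\<close>

lemma frontier_in_side:
  assumes "x \<in> Q - interior Q"
  shows "\<exists>v\<in>{a, c}. \<exists>w\<in>{b, d}. x \<in> closed_segment v w"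
proof -
  have one: "A x + B x = 1" using assms by (auto simp: mem_Q interior_Q)
  have "\<exists>v\<in>{a, c}. \<xi> x *\<^sub>R (a - o') = A x *\<^sub>R (v - o')"
  proof (cases "0 \<le> \<xi> x")
    case True
    then have "A x = \<xi> x" by (rule A_cases)
    then show ?thesis by auto
  next
    case False
    then have "A x = - \<xi> x / \<kappa>" by (intro A_cases) simp
    then show ?thesis using \<kappa> by (intro bexI[of _ c]) (auto simp: c)
  qed
  then obtain v where v: "v \<in> {a, c}" "\<xi> x *\<^sub>R (a - o') = A x *\<^sub>R (v - o')" by blast
  have "\<exists>w\<in>{b, d}. \<eta> x *\<^sub>R (b - o') = B x *\<^sub>R (w - o')"
  proof (cases "0 \<le> \<eta> x")
    case True
    then have "B x = \<eta> x" by (rule B_cases)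
    then show ?thesis by auto
  next
    case False
    then have "B x = - \<eta> x / \<mu>" by (intro B_cases) simp
    then show ?thesis using \<mu> by (intro bexI[of _ d]) (auto simp: d)
  qed
  then obtain w where w: "w \<in> {b, d}" "\<eta> x *\<^sub>R (b - o') = B x *\<^sub>R (w - o')" by blast
  have A: "A x = 1 - B x" using one by simp
  have "x = o' + A x *\<^sub>R (v - o') + B x *\<^sub>R (w - o')" using coordinates[of x] v w by simp
  also have "\<dots> = (1 - B x) *\<^sub>R v + B x *\<^sub>R w" unfolding A by (simp add: algebra_simps)
  finally have "x \<in> closed_segment v w"
    unfolding in_segment using AB_nonneg[of x] one by (intro exI[of _ "B x"]) auto
  then show ?thesis using v(1) w(1) by blast
qed

lemma side_not_interior:
  assumes v: "v \<in> {a, c}" and w: "w \<in> {b, d}" and x: "x \<in> closed_segment v w"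
  shows "x \<in> Q - interior Q"
proof -
  obtain t where t: "0 \<le> t" "t \<le> 1" "x = (1 - t) *\<^sub>R v + t *\<^sub>R w" using x unfolding in_segment by blast
  define r where "r = (if v = a then 1 else - \<kappa>)"
  define s where "s = (if w = b then 1 else - \<mu>)"
  have v': "v = o' + r *\<^sub>R (a - o')" and w': "w = o' + s *\<^sub>R (b - o')"
    using v w by (auto simp: r_def s_def c d)
  have "x = o' + ((1 - t) * r) *\<^sub>R (a - o') + (t * s) *\<^sub>R (b - o')"
    unfolding t(3) v' w' by (simp add: algebra_simps)
  then have xe: "\<xi> x = (1 - t) * r" "\<eta> x = t * s"
    using coordinates_combine by simp_all
  have "A x = 1 - t"
  proof (cases "r = 1")
    case True
    then show ?thesis using A_cases(1)[of x] xe t by simp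
  next
    case False
    then have "r = - \<kappa>" by (simp add: r_def split: if_splits)
    then show ?thesis using A_cases(2)[of x] xe t \<kappa> by (simp add: mult_nonneg_nonneg)
  qed
  moreover have "B x = t"
  proof (cases "s = 1")
    case True
    then show ?thesis using B_cases(1)[of x] xe t by simp
  next
    case False
    then have "s = - \<mu>" by (simp add: s_def split: if_splits)
    then show ?thesis using B_cases(2)[of x] xe t \<mu> by (simp add: mult_nonneg_nonneg)
  qed
  ultimately show ?thesis by (simp add: mem_Q interior_Q)
qed

lemma vertices_distinct: "a \<noteq> b" "a \<noteq> c" "a \<noteq> d" "b \<noteq> c" "b \<noteq> d" "c \<noteq> d"
proof -
  have "\<xi> a \<noteq> \<xi> b" "\<xi> a \<noteq> \<xi> c" "\<xi> a \<noteq> \<xi> d" "\<xi> b \<noteq> \<xi> c" "\<eta> b \<noteq> \<eta> d" "\<xi> c \<noteq> \<xi> d"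
    using \<kappa> \<mu> by simp_all
  then show "a \<noteq> b" "a \<noteq> c" "a \<noteq> d" "b \<noteq> c" "b \<noteq> d" "c \<noteq> d" by metis+
qed

lemma affine_independent_\<Delta>: "\<not> affine_dependent {(a, 0), (b, 1), (c, 0), (d, 1::real)}"
proof
  let ?S = "{(a, 0), (b, 1), (c, 0), (d, 1::real)}"
  assume "affine_dependent ?S"
  then obtain U where U: "sum U ?S = 0" "\<exists>v\<in>?S. U v \<noteq> 0" "(\<Sum>v\<in>?S. U v *\<^sub>R v) = 0"
    unfolding affine_dependent_explicit_finite[OF finite.insertI[OF finite.insertI[OF finite.insertI[OF finite.insertI[OF finite.emptyI]]]]]
    by blast
  define ua ub uc ud where "ua = U (a, 0)" and "ub = U (b, 1)" and "uc = U (c, 0)" and "ud = U (d, 1)"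
  note u = ua_def[symmetric] ub_def[symmetric] uc_def[symmetric] ud_def[symmetric]
  have s: "ua + ub + uc + ud = 0" and v: "ua *\<^sub>R (a, 0) + ub *\<^sub>R (b, 1) + uc *\<^sub>R (c, 0) + ud *\<^sub>R (d, 1::real) = 0"
    using U(1,3) vertices_distinct by (simp_all add: u add.assoc)
  have z: "ub + ud = 0" and p: "ua *\<^sub>R a + ub *\<^sub>R b + uc *\<^sub>R c + ud *\<^sub>R d = 0"
    using v by (simp_all add: zero_prod_def)
  have e: "uc = - ua" "ud = - ub" using s z by linarith+
  have "(ua * (1 + \<kappa>)) *\<^sub>R (a - o') + (ub * (1 + \<mu>)) *\<^sub>R (b - o') = 0"
    using p unfolding e c d by (simp add: algebra_simps)
  then have "o' + (ua * (1 + \<kappa>)) *\<^sub>R (a - o') + (ub * (1 + \<mu>)) *\<^sub>R (b - o') = o'"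
    by (simp add: add.assoc)
  then have "ua * (1 + \<kappa>) = \<xi> o'" "ub * (1 + \<mu>) = \<eta> o'"
    using coordinates_combine by metis+
  moreover have "\<xi> o' = 0" "\<eta> o' = 0" by (simp_all add: \<xi>_def \<eta>_def)
  ultimately have "ua = 0" "ub = 0" using \<kappa> \<mu> by auto
  then show False using U(2) e by (auto simp: u)
qed

lemma simplex_\<Delta>: "3 simplex \<Delta>"
  unfolding simplex_def \<Delta>_def
  using affine_independent_\<Delta> vertices_distinct
  by (intro exI[of _ "{(a, 0), (b, 1), (c, 0), (d, 1)}"]) auto

definition lift :: "plane \<Rightarrow> space" where "lift v = (v, if v \<in> {b, d} then 1 else 0)"

lemma lift_vertices: "lift a = (a, 0)" "lift b = (b, 1)" "lift c = (c, 0)" "lift d = (d, 1)"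
  using vertices_distinct by (auto simp: lift_def)

lemma hull_lift_affine:
  assumes "\<And>x. \<phi> x = inner g x + k" "\<And>v. v \<in> V \<Longrightarrow> lift v = (v, \<phi> v)"
  shows "convex hull (lift ` V) = (\<lambda>x. (x, \<phi> x)) ` (convex hull V)"
proof -
  have "lift ` V = (\<lambda>x. (x, \<phi> x)) ` V" using assms(2) by (rule image_cong[OF refl])
  then show ?thesis using convex_hull_affine_graph[OF assms(1)] by simp
qed

lemma hull_affine_le:
  assumes "\<And>x. \<phi> x = inner g x + k" "\<And>v. v \<in> V \<Longrightarrow> \<phi> v \<le> 0" "x \<in> convex hull V"
  shows "\<phi> x \<le> (0::real)"
proof -
  have "V \<subseteq> {x. inner g x \<le> - k}" using assms(1,2) by force
  then have "convex hull V \<subseteq> {x. inner g x \<le> - k}" by (rule hull_minimal) (rule convex_halfspace_le)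
  then show ?thesis using assms(1,3) by force
qed

text \<open>A set of corners without both \<open>b\<close> and \<open>d\<close> lies on one side of
  the line \<open>ac\<close>. There \<open>\<eta>\<close> has constant sign and \<open>B\<close> is
  affine, so the hull of the lifted corners is a piece of its graph.\<close>

lemma hull_lift_lower:
  assumes "V \<subseteq> {a, b, c, d}" "\<not> {b, d} \<subseteq> V"
  shows "convex hull (lift ` V) = (\<lambda>x. (x, B x)) ` (convex hull V)"
proof -
  obtain g k where g: "\<And>x. \<eta> x = inner g x + k" by (rule \<eta>_inner) blast
  consider "V \<subseteq> {a, b, c}" | "V \<subseteq> {a, c, d}" using assms by blast
  then show ?thesis
  proof cases
    case 1
    have m: "- \<eta> x = inner (- g) x + - k" for x by (simp add: g)
    have "B x = \<eta> x" if "x \<in> convex hull V" for x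
      using hull_affine_le[OF m _ that] 1 by (intro B_cases) force
    then have "(\<lambda>x. (x, B x)) ` (convex hull V) = (\<lambda>x. (x, \<eta> x)) ` (convex hull V)"
      by (intro image_cong) auto
    moreover have "convex hull (lift ` V) = (\<lambda>x. (x, \<eta> x)) ` (convex hull V)"
      using 1 lift_vertices by (intro hull_lift_affine[OF g]) auto
    ultimately show ?thesis by simp
  next
    case 2
    have m: "- \<eta> x / \<mu> = inner (- g /\<^sub>R \<mu>) x + (- k / \<mu>)" for x using \<mu> by (simp add: g field_simps)
    have "B x = - \<eta> x / \<mu>" if "x \<in> convex hull V" for x
      using hull_affine_le[OF g _ that] 2 \<mu> by (intro B_cases) force
    then have "(\<lambda>x. (x, B x)) ` (convex hull V) = (\<lambda>x. (x, - \<eta> x / \<mu>)) ` (convex hull V)"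
      by (intro image_cong) auto
    moreover have "convex hull (lift ` V) = (\<lambda>x. (x, - \<eta> x / \<mu>)) ` (convex hull V)"
      using 2 lift_vertices \<mu> by (intro hull_lift_affine[OF m]) auto
    ultimately show ?thesis by simp
  qed
qed

text \<open>Same reason with the diagonals exchanged: on one side of the line \<open>bd\<close> the
  function \<open>1 - A\<close> is affine.\<close>

lemma hull_lift_upper:
  assumes "V \<subseteq> {a, b, c, d}" "\<not> {a, c} \<subseteq> V"
  shows "convex hull (lift ` V) = (\<lambda>x. (x, 1 - A x)) ` (convex hull V)"
proof -
  obtain g k where g: "\<And>x. \<xi> x = inner g x + k" by (rule \<xi>_inner) blast
  consider "V \<subseteq> {a, b, d}" | "V \<subseteq> {b, c, d}" using assms by blast
  then show ?thesis
  proof cases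
    case 1
    have m: "- \<xi> x = inner (- g) x + - k" "1 - \<xi> x = inner (- g) x + (1 - k)" for x by (simp_all add: g)
    have "A x = \<xi> x" if "x \<in> convex hull V" for x
      using hull_affine_le[OF m(1) _ that] 1 by (intro A_cases) force
    then have "(\<lambda>x. (x, 1 - A x)) ` (convex hull V) = (\<lambda>x. (x, 1 - \<xi> x)) ` (convex hull V)"
      by (intro image_cong) auto
    moreover have "convex hull (lift ` V) = (\<lambda>x. (x, 1 - \<xi> x)) ` (convex hull V)"
      using 1 lift_vertices by (intro hull_lift_affine[OF m(2)]) auto
    ultimately show ?thesis by simp
  next
    case 2
    have m: "1 - - \<xi> x / \<kappa> = inner (g /\<^sub>R \<kappa>) x + (1 + k / \<kappa>)" for x using \<kappa> by (simp add: g field_simps)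
    have "A x = - \<xi> x / \<kappa>" if "x \<in> convex hull V" for x
      using hull_affine_le[OF g _ that] 2 \<kappa> by (intro A_cases) force
    then have "(\<lambda>x. (x, 1 - A x)) ` (convex hull V) = (\<lambda>x. (x, 1 - - \<xi> x / \<kappa>)) ` (convex hull V)"
      by (intro image_cong) auto
    moreover have "convex hull (lift ` V) = (\<lambda>x. (x, 1 - - \<xi> x / \<kappa>)) ` (convex hull V)"
      using 2 lift_vertices \<kappa> by (intro hull_lift_affine[OF m]) auto
    ultimately show ?thesis by simp
  qed
qed

lemma lift_hull_all: "convex hull (lift ` {a, b, c, d}) = \<Delta>"
  by (simp add: lift_vertices \<Delta>_def)

lemma faces_\<Delta>: "{F. F face_of \<Delta> \<and> F \<noteq> {}} = {convex hull (lift ` V) | V. V \<subseteq> {a, b, c, d} \<and> V \<noteq> {}}"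
proof -
  have S: "{(a, 0), (b, 1), (c, 0), (d, 1)} = lift ` {a, b, c, d}" by (simp add: lift_vertices)
  have "F face_of \<Delta> \<longleftrightarrow> (\<exists>C \<subseteq> lift ` {a, b, c, d}. F = convex hull C)" for F
    unfolding \<Delta>_def S[symmetric] by (rule face_of_convex_hull_affine_independent[OF affine_independent_\<Delta>])
  then have "F face_of \<Delta> \<and> F \<noteq> {} \<longleftrightarrow> (\<exists>V. F = convex hull (lift ` V) \<and> V \<subseteq> {a, b, c, d} \<and> V \<noteq> {})" for F
    unfolding subset_image_iff by auto
  then show ?thesis by auto
qed

text \<open>Fibrewise affine, hence discontinuous only where a fibre degenerates to a point; there
  the factor \<open>u - h\<close> vanishes (and the quotient is \<open>0 / 0 = 0\<close>).\<close>

definition stretch :: "(plane \<Rightarrow> real) \<Rightarrow> (plane \<Rightarrow> real) \<Rightarrow> space \<Rightarrow> space" where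
  "stretch h u y = (fst y, h (fst y) + (snd y - B (fst y)) / (1 - A (fst y) - B (fst y)) * (u (fst y) - h (fst y)))"

lemma stretch_faces:
  assumes "x \<in> Q" "\<And>x. x \<in> Q - interior Q \<Longrightarrow> h x = u x"
  shows "stretch h u (x, B x) = (x, h x)" "stretch h u (x, 1 - A x) = (x, u x)"
proof -
  show "stretch h u (x, B x) = (x, h x)" by (simp add: stretch_def)
  show "stretch h u (x, 1 - A x) = (x, u x)"
  proof (cases "x \<in> interior Q")
    case True
    then have "1 - A x - B x \<noteq> 0" by (simp add: interior_Q)
    then show ?thesis by (simp add: stretch_def)
  next
    case False
    then show ?thesis using assms by (simp add: stretch_def)
  qed
qed

text \<open>The map is continuous on a compact set, so bijectivity suffices. Over the interior it is
  an affine bijection of vertical segments; over the boundary both segments are points.\<close>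

lemma homeomorphism_stretch:
  assumes c: "continuous_on Q h" "continuous_on Q u"
    and eq: "\<And>x. x \<in> Q - interior Q \<Longrightarrow> h x = u x" and lt: "\<And>x. x \<in> interior Q \<Longrightarrow> h x < u x"
  obtains f where "homeomorphism \<Delta> (region_between h u Q) (stretch h u) f"
proof -
  have fst\<Delta>: "fst y \<in> Q" if "y \<in> \<Delta>" for y
    using that mem_\<Delta>[of "fst y" "snd y"] by (simp add: mem_Q)
  have bnd: "B (fst y) \<le> snd y \<and> snd y \<le> 1 - A (fst y)" if "y \<in> \<Delta>" for y
    using that mem_\<Delta>[of "fst y" "snd y"] by simp
  have comp: "compact \<Delta>" unfolding \<Delta>_def by (intro finite_imp_compact_convex_hull) simp
  have f: "continuous_on \<Delta> (\<lambda>y. \<phi> (fst y))" if "continuous_on Q \<phi>" for \<phi> :: "plane \<Rightarrow> real"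
    by (rule continuous_on_compose2[OF that continuous_on_fst]) (use fst\<Delta> in auto)
  let ?\<theta> = "\<lambda>y. (snd y - B (fst y)) / (1 - A (fst y) - B (fst y))"
  let ?w = "\<lambda>y. u (fst y) - h (fst y)"
  have wz: "A (fst y) + B (fst y) < 1" if "y \<in> \<Delta>" "?w y \<noteq> 0" for y
    using eq[of "fst y"] fst\<Delta>[OF that(1)] that(2) unfolding interior_Q by auto
  have cont: "continuous_on \<Delta> (\<lambda>y. ?\<theta> y * ?w y)"
  proof (rule continuous_on_bounded_mult)
    show "continuous_on \<Delta> ?w" by (intro continuous_intros f c)
    show "\<bar>?\<theta> y\<bar> \<le> 1" if "y \<in> \<Delta>" for y
    proof (cases "1 - A (fst y) - B (fst y) = 0")
      case False
      have "B (fst y) \<le> snd y" "snd y \<le> 1 - A (fst y)"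
        using bnd[OF that] by auto
      then show ?thesis using False by (simp add: abs_le_iff divide_le_eq le_divide_eq)
    qed simp
    show "continuous_on {y \<in> \<Delta>. ?w y \<noteq> 0} ?\<theta>"
    proof (intro continuous_intros)
      have sub: "{y \<in> \<Delta>. ?w y \<noteq> 0} \<subseteq> \<Delta>" by auto
      show "continuous_on {y \<in> \<Delta>. ?w y \<noteq> 0} (\<lambda>y. A (fst y))"
        "continuous_on {y \<in> \<Delta>. ?w y \<noteq> 0} (\<lambda>y. B (fst y))"
        "continuous_on {y \<in> \<Delta>. ?w y \<noteq> 0} (\<lambda>y. B (fst y))"
        using f[OF continuous_AB(1)] f[OF continuous_AB(2)] continuous_on_subset[OF _ sub] by blast+
      show "\<forall>y\<in>{y \<in> \<Delta>. ?w y \<noteq> 0}. 1 - A (fst y) - B (fst y) \<noteq> 0"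
        using wz by fastforce
    qed
  qed
  have sc: "continuous_on \<Delta> (stretch h u)"
    unfolding stretch_def by (intro continuous_intros f c cont)
  have inj: "inj_on (stretch h u) \<Delta>"
  proof (rule inj_onI)
    fix y y' assume y: "y \<in> \<Delta>" "y' \<in> \<Delta>" "stretch h u y = stretch h u y'"
    have fs: "fst y = fst y'" using y(3) by (simp add: stretch_def)
    have b: "B (fst y) \<le> snd y" "snd y \<le> 1 - A (fst y)" "B (fst y) \<le> snd y'" "snd y' \<le> 1 - A (fst y)"
      using bnd[OF y(1)] bnd[OF y(2)] fs by simp_all
    have "snd y = snd y'"
    proof (cases "fst y \<in> interior Q")
      case True
      then have "u (fst y) - h (fst y) \<noteq> 0" "1 - A (fst y) - B (fst y) \<noteq> 0"
        using lt[OF True] by (auto simp: interior_Q)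
      then show ?thesis using y(3) fs by (simp add: stretch_def)
    next
      case False
      then have "\<not> A (fst y) + B (fst y) < 1" by (simp add: interior_Q)
      then show ?thesis using b by linarith
    qed
    then show "y = y'" using fs by (simp add: prod_eq_iff)
  qed
  have img: "stretch h u ` \<Delta> = region_between h u Q"
  proof
    show "stretch h u ` \<Delta> \<subseteq> region_between h u Q"
    proof
      fix w assume "w \<in> stretch h u ` \<Delta>"
      then obtain x z where y: "(x, z) \<in> \<Delta>" "w = stretch h u (x, z)" by force
      have b: "B x \<le> z" "z \<le> 1 - A x" and x: "x \<in> Q" using y(1) fst\<Delta>[OF y(1)] by (auto simp: mem_\<Delta>)
      show "w \<in> region_between h u Q"
      proof (cases "x \<in> interior Q")
        case True
        define \<theta> where "\<theta> = (z - B x) / (1 - A x - B x)"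
        have pos: "0 < 1 - A x - B x" using True by (simp add: interior_Q)
        have "0 \<le> \<theta>" "\<theta> \<le> 1" using pos b by (auto simp: \<theta>_def)
        moreover have "0 < u x - h x" using lt[OF True] by simp
        ultimately have "0 \<le> \<theta> * (u x - h x)" "\<theta> * (u x - h x) \<le> 1 * (u x - h x)"
          by (auto intro: mult_right_mono)
        then show ?thesis using y(2) x by (simp add: stretch_def \<theta>_def)
      next
        case False
        then have "h x = u x" using eq x by simp
        then show ?thesis using y(2) x by (simp add: stretch_def)
      qed
    qed
    show "region_between h u Q \<subseteq> stretch h u ` \<Delta>"
    proof
      fix w assume w: "w \<in> region_between h u Q"
      obtain x t where xt: "w = (x, t)" "x \<in> Q" "h x \<le> t" "t \<le> u x" using w by (cases w) auto
      show "w \<in> stretch h u ` \<Delta>"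
      proof (cases "x \<in> interior Q")
        case True
        define r where "r = (t - h x) / (u x - h x)"
        have wpos: "0 < u x - h x" using lt[OF True] by simp
        have pos: "0 < 1 - A x - B x" using True by (simp add: interior_Q)
        have r: "0 \<le> r" "r \<le> 1" "r * (u x - h x) = t - h x" using wpos xt by (auto simp: r_def)
        define z where "z = B x + r * (1 - A x - B x)"
        have "0 \<le> r * (1 - A x - B x)" "r * (1 - A x - B x) \<le> 1 * (1 - A x - B x)"
          using r pos by (auto intro: mult_right_mono)
        then have "(x, z) \<in> \<Delta>" by (simp add: mem_\<Delta> z_def)
        moreover have "stretch h u (x, z) = w"
          using pos r xt by (simp add: stretch_def z_def)
        ultimately show ?thesis by (metis image_eqI)
      next
        case False
        then have "h x = u x" using eq xt by simp
        then have "w = stretch h u (x, B x)" using xt by (simp add: stretch_def)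
        moreover have "(x, B x) \<in> \<Delta>" using xt by (simp add: mem_\<Delta> mem_Q)
        ultimately show ?thesis by blast
      qed
    qed
  qed
  show ?thesis using homeomorphism_compact[OF comp sc img inj] that by blast
qed

lemma half_quadrilateral:
  assumes "x \<in> Q" "0 \<le> \<eta> x"
  shows "x \<in> convex hull {a, b, c}"
proof -
  have B: "B x = \<eta> x" using assms(2) by (rule B_cases)
  have le: "\<xi> x \<le> A x" "- \<xi> x / \<kappa> \<le> A x"
    unfolding A_def by (rule max.cobounded1 max.cobounded2)+
  have "\<xi> x \<le> 1 - \<eta> x" "- \<xi> x / \<kappa> \<le> 1 - \<eta> x"
    using assms(1) le B unfolding mem_Q by linarith+
  then have i: "\<xi> x \<le> 1 - \<eta> x" "- \<xi> x \<le> (1 - \<eta> x) * \<kappa>"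
    using \<kappa> by (simp_all only: pos_divide_le_eq)
  define sa sc where "sa = ((1 - \<eta> x) * \<kappa> + \<xi> x) / (1 + \<kappa>)" and "sc = ((1 - \<eta> x) - \<xi> x) / (1 + \<kappa>)"
  have nn: "0 \<le> sa" "0 \<le> sc"
    unfolding sa_def sc_def using i \<kappa> by (intro divide_nonneg_pos; linarith)+
  have s1: "sa + sc = 1 - \<eta> x" "sa - \<kappa> * sc = \<xi> x"
    using \<kappa> unfolding sa_def sc_def by (simp_all add: divide_simps) (simp_all add: algebra_simps)
  have "sa *\<^sub>R a + \<eta> x *\<^sub>R b + sc *\<^sub>R c =
     (sa + sc + \<eta> x) *\<^sub>R o' + (sa - \<kappa> * sc) *\<^sub>R (a - o') + \<eta> x *\<^sub>R (b - o')"
    unfolding c by (simp add: algebra_simps)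
  also have "\<dots> = x" unfolding s1 using coordinates[of x] by simp
  finally have "x = sa *\<^sub>R a + \<eta> x *\<^sub>R b + sc *\<^sub>R c" by simp
  moreover have "sa + \<eta> x + sc = 1" using s1 by simp
  ultimately show ?thesis unfolding convex_hull_3 using nn assms(2) by blast
qed

lemma center_interior: "o' \<in> interior Q"
  using coordinates_combine[of 0 0] by (simp add: interior_Q A_def B_def)

end

text \<open>Exchanging \<open>b\<close> and \<open>d\<close> inverts the ratio on their diagonal, as
  \<open>d - o'\<close> is \<open>b - o'\<close> scaled by \<open>- \<mu>\<close>.\<close>

lemma quadrilateral_flip:
  assumes "quadrilateral a b c d o' \<kappa> \<mu>" shows "quadrilateral a d c b o' \<kappa> (1 / \<mu>)"
proof -
  interpret quadrilateral a b c d o' \<kappa> \<mu> by (rule assms)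
  have "orient o' a d = - \<mu> * orient o' a b" unfolding d by (simp add: orient_def algebra_simps)
  then show ?thesis using \<kappa> \<mu> c D by unfold_locales (auto simp: d)
qed

lemma quadrilateral_swap:
  assumes "quadrilateral a b c d o' \<kappa> \<mu>" shows "quadrilateral b a d c o' \<mu> \<kappa>"
proof -
  interpret quadrilateral a b c d o' \<kappa> \<mu> by (rule assms)
  show ?thesis using \<kappa> \<mu> c d D orient_swap'[of o' a b] by unfold_locales auto
qed

lemma quadrilateral_split:
  assumes "quadrilateral a b c d o' \<kappa> \<mu>" "x \<in> convex hull {a, b, c, d}"
  shows "x \<in> convex hull {a, b, c} \<or> x \<in> convex hull {a, c, d}"
proof -
  interpret q: quadrilateral a b c d o' \<kappa> \<mu> by (rule assms)
  interpret r: quadrilateral a d c b o' \<kappa> "1 / \<mu>" by (rule quadrilateral_flip[OF assms(1)])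
  have "orient o' a d = - \<mu> * orient o' a b" unfolding q.d by (simp add: orient_def algebra_simps)
  then have e: "r.\<eta> x = - q.\<eta> x / \<mu>" by (simp add: q.\<eta>_def r.\<eta>_def)
  have Q: "x \<in> q.Q" "x \<in> r.Q" using assms(2) unfolding q.Q_def r.Q_def by (simp_all add: insert_commute)
  show ?thesis
  proof (cases "0 \<le> q.\<eta> x")
    case True
    then show ?thesis using q.half_quadrilateral Q by blast
  next
    case False
    then have "0 \<le> r.\<eta> x" using q.\<mu> by (simp add: e divide_nonpos_pos)
    then have "x \<in> convex hull {a, d, c}" using r.half_quadrilateral Q by blast
    then show ?thesis by (simp add: insert_commute)
  qed
qed

text \<open>The ratio arises because \<open>c - o'\<close> scaled by \<open>\<alpha>\<close> and
  \<open>a - o'\<close> scaled by \<open>1 - \<alpha>\<close> cancel.\<close>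

lemma quadrilateralI:
  assumes "0 < \<alpha>" "\<alpha> < 1" "0 < \<beta>" "\<beta> < 1"
    and o1: "o' = (1 - \<alpha>) *\<^sub>R a + \<alpha> *\<^sub>R c" and o2: "o' = (1 - \<beta>) *\<^sub>R b + \<beta> *\<^sub>R d"
    and D: "orient a b c \<noteq> 0"
  shows "quadrilateral a b c d o' ((1 - \<alpha>) / \<alpha>) ((1 - \<beta>) / \<beta>)"
proof -
  have end2: "y = z - ((1 - t) / t) *\<^sub>R (x - z)" if "0 < t" "z = (1 - t) *\<^sub>R x + t *\<^sub>R y"
    for t :: real and x y z :: plane
  proof -
    have "t *\<^sub>R (z - ((1 - t) / t) *\<^sub>R (x - z)) = t *\<^sub>R z - (1 - t) *\<^sub>R (x - z)"
      using that(1) by (simp add: scaleR_diff_right)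
    also have "\<dots> = z - (1 - t) *\<^sub>R x" by (simp add: algebra_simps)
    also have "\<dots> = t *\<^sub>R y" using that(2) by (simp add: algebra_simps)
    finally show ?thesis using that(1) by (simp add: scaleR_cancel_left del: scaleR_diff_right)
  qed
  have c: "c = o' - ((1 - \<alpha>) / \<alpha>) *\<^sub>R (a - o')" by (rule end2[OF assms(1) o1])
  have "orient a b (o' - t *\<^sub>R (a - o')) = (1 + t) * orient o' a b" for t
    by (simp add: orient_def algebra_simps)
  then have "orient a b c = (1 + (1 - \<alpha>) / \<alpha>) * orient o' a b"
    using c by metis
  then have "orient o' a b \<noteq> 0" using D by auto
  then show ?thesis using c end2[OF assms(3) o2] assms(1-4) by unfold_locales auto
qed

section \<open>Cliques and flips of chord triangulations\<close>

text \<open>The last case only extracts five elements: a clique on a pentagon is already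
  contradictory.\<close>

lemma nat_set_cases:
  fixes W :: "nat set"
  assumes fin: "finite W" "W \<noteq> {}"
  obtains (1) i where "W = {i}" | (2) i j where "W = {i, j}" "i < j"
    | (3) i j k where "W = {i, j, k}" "i < j" "j < k"
    | (4) i j k l where "W = {i, j, k, l}" "i < j" "j < k" "k < l"
    | (5) i j k l m where "{i, j, k, l, m} \<subseteq> W" "i < j" "j < k" "k < l" "l < m"
proof -
  have peel: "\<exists>i U. V = insert i U \<and> finite U \<and> (\<forall>x\<in>U. i < x)" if "finite V" "V \<noteq> {}" for V :: "nat set"
  proof (intro exI conjI ballI)
    show "V = insert (Min V) (V - {Min V})" using Min_in[OF that] by blast
    show "finite (V - {Min V})" using that by simp
    show "Min V < x" if "x \<in> V - {Min V}" for x
      using Min_le[OF \<open>finite V\<close>, of x] that by auto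
  qed
  obtain i W1 where 1: "W = insert i W1" "finite W1" "\<forall>x\<in>W1. i < x" using peel[OF fin] by blast
  show ?thesis
  proof (cases "W1 = {}")
    case True then show ?thesis using that(1) 1 by blast
  next
    case False
    obtain j W2 where 2: "W1 = insert j W2" "finite W2" "\<forall>x\<in>W2. j < x" using peel[OF 1(2) False] by blast
    show ?thesis
    proof (cases "W2 = {}")
      case True then show ?thesis using that(2)[of i j] 1 2 by simp
    next
      case False
      obtain k W3 where 3: "W2 = insert k W3" "finite W3" "\<forall>x\<in>W3. k < x" using peel[OF 2(2) False] by blast
      show ?thesis
      proof (cases "W3 = {}")
        case True then show ?thesis using that(3)[of i j k] 1 2 3 by simp
      next
        case False
        obtain l W4 where 4: "W3 = insert l W4" "finite W4" "\<forall>x\<in>W4. l < x" using peel[OF 3(2) False] by blast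
        show ?thesis
        proof (cases "W4 = {}")
          case True then show ?thesis using that(4)[of i j k l] 1 2 3 4 by simp
        next
          case False
          then obtain m where "m \<in> W4" by blast
          then show ?thesis using that(5)[of i j k l m] 1 2 3 4 by simp
        qed
      qed
    qed
  qed
qed

context convex_numbering
begin

text \<open>For a triangulation \<open>F\<close> these are the vertex sets of its cells: vertices,
  arcs and triangles.\<close>

definition clique :: "(nat \<times> nat) set \<Rightarrow> nat set \<Rightarrow> bool" where
  "clique F W \<longleftrightarrow> W \<noteq> {} \<and> W \<subseteq> {..<n} \<and> (\<forall>i\<in>W. \<forall>j\<in>W. i < j \<longrightarrow> (i, j) \<in> F)"

lemma clique_mono: "clique F W \<Longrightarrow> U \<subseteq> W \<Longrightarrow> U \<noteq> {} \<Longrightarrow> clique F U"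
  unfolding clique_def by blast

lemma cliqueD: "clique F W \<Longrightarrow> i \<in> W \<Longrightarrow> j \<in> W \<Longrightarrow> i < j \<Longrightarrow> (i, j) \<in> F"
  unfolding clique_def by blast

lemma clique_sub: "clique F W \<Longrightarrow> W \<subseteq> {..<n}"
  unfolding clique_def by blast

lemma clique_finite: "clique F W \<Longrightarrow> finite W"
  using clique_sub finite_subset by blast

lemma clique_single: "i < n \<Longrightarrow> clique F {i}"
  by (simp add: clique_def)

lemma clique_pair: "i < j \<Longrightarrow> j < n \<Longrightarrow> clique F {i, j} \<longleftrightarrow> (i, j) \<in> F"
  by (auto simp: clique_def)

lemma clique_insert:
  "clique F {x, y} \<Longrightarrow> clique F {y, z} \<Longrightarrow> clique F {x, z} \<Longrightarrow> clique F {x, y, z}"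
  unfolding clique_def by auto

lemma chull_clique_Int:
  assumes F: "chord_triangulation {..<n} F" and V: "clique F V" and W: "clique F W"
  shows "chull V \<inter> chull W = chull (V \<inter> W)"
proof (rule chull_Int[OF clique_sub[OF V] clique_sub[OF W]])
  fix i j k l assume "i \<in> V" "j \<in> V" "k \<in> W" "l \<in> W"
  show "\<not> interleaved (i, j) (k, l)"
  proof
    assume x: "interleaved (i, j) (k, l)"
    then have "i < j" "k < l" by auto
    then have "(i, j) \<in> F" "(k, l) \<in> F"
      using cliqueD[OF V] cliqueD[OF W] \<open>i \<in> V\<close> \<open>j \<in> V\<close> \<open>k \<in> W\<close> \<open>l \<in> W\<close> by auto
    then show False using chord_triangulation_noncrossing[OF F] x by blast
  qed
qed

text \<open>Always \<open>(a, c)\<close> is removed and \<open>(b, d)\<close> inserted. The price of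
  fixing these roles is that the order may be \<open>a < b < c < d\<close> or
  \<open>b < a < d < c\<close>.\<close>

definition flip_corners ::
  "(nat \<times> nat) set \<Rightarrow> (nat \<times> nat) set \<Rightarrow> nat \<Rightarrow> nat \<Rightarrow> nat \<Rightarrow> nat \<Rightarrow> bool" where
  "flip_corners F G a b c d \<longleftrightarrow> a < c \<and> c < n \<and> b < d \<and> d < n \<and> interleaved (a, c) (b, d) \<and>
     F - G = {(a, c)} \<and> G - F = {(b, d)} \<and>
     clique F {a, b} \<and> clique F {b, c} \<and> clique F {c, d} \<and> clique F {a, d} \<and>
     clique G {a, b} \<and> clique G {b, c} \<and> clique G {c, d} \<and> clique G {a, d}"

lemma flip_corners_exist:
  assumes "(F, G) \<in> chord_flip {..<n}"
  shows "\<exists>a b c d. flip_corners F G a b c d"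
proof -
  obtain i j k l where o: "i < j" "j < k" "k < l" "i \<in> {..<n}" "j \<in> {..<n}" "k \<in> {..<n}" "l \<in> {..<n}"
    and D: "F - G = {(i, k)} \<and> G - F = {(j, l)} \<or> F - G = {(j, l)} \<and> G - F = {(i, k)}"
    and S: "(i, j) \<in> F \<inter> G" "(j, k) \<in> F \<inter> G" "(k, l) \<in> F \<inter> G" "(i, l) \<in> F \<inter> G"
    by (rule chord_flip_quadE[OF assms])
  have cl: "clique F {i, j}" "clique G {i, j}" "clique F {j, k}" "clique G {j, k}"
    "clique F {k, l}" "clique G {k, l}" "clique F {i, l}" "clique G {i, l}"
    using S o by (simp_all add: clique_pair)
  from D show ?thesis
  proof
    assume "F - G = {(i, k)} \<and> G - F = {(j, l)}"
    then have "flip_corners F G i j k l"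
      unfolding flip_corners_def using o cl by (simp only: lessThan_iff interleaved_Pair) simp
    then show ?thesis by blast
  next
    assume "F - G = {(j, l)} \<and> G - F = {(i, k)}"
    then have "flip_corners F G j i l k"
      unfolding flip_corners_def using o cl by (simp only: lessThan_iff interleaved_Pair) (simp add: insert_commute)
    then show ?thesis by blast
  qed
qed

lemma flip_corners_distinct:
  assumes "flip_corners F G a b c d"
  shows "a \<noteq> b" "a \<noteq> c" "a \<noteq> d" "b \<noteq> c" "b \<noteq> d" "c \<noteq> d" "{a, b, c, d} \<subseteq> {..<n}"
proof -
  have "a < c" "c < n" "b < d" "d < n" "interleaved (a, c) (b, d)"
    using assms unfolding flip_corners_def by - ((elim conjE, assumption)+)
  then show "a \<noteq> b" "a \<noteq> c" "a \<noteq> d" "b \<noteq> c" "b \<noteq> d" "c \<noteq> d" "{a, b, c, d} \<subseteq> {..<n}" by auto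
qed

lemma flip_corners_sides:
  assumes "flip_corners F G a b c d"
  shows "clique F {a, b}" "clique F {b, c}" "clique F {c, d}" "clique F {a, d}"
    "clique G {a, b}" "clique G {b, c}" "clique G {c, d}" "clique G {a, d}"
  using assms unfolding flip_corners_def by - ((elim conjE, assumption)+)

lemma flip_corners_order:
  assumes "flip_corners F G a b c d"
  shows "a < b \<and> b < c \<and> c < d \<or> b < a \<and> a < d \<and> d < c" "c < n" "d < n"
proof -
  have "c < n" "d < n" "interleaved (a, c) (b, d)"
    using assms unfolding flip_corners_def by - ((elim conjE, assumption)+)
  then show "a < b \<and> b < c \<and> c < d \<or> b < a \<and> a < d \<and> d < c" "c < n" "d < n" by auto
qed

lemma flip_corners_mem:
  assumes "flip_corners F G a b c d"
  shows "(a, c) \<in> F" "(a, c) \<notin> G" "(b, d) \<in> G" "(b, d) \<notin> F"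
proof -
  have d: "F - G = {(a, c)}" "G - F = {(b, d)}"
    using assms unfolding flip_corners_def by - ((elim conjE, assumption)+)
  have "(a, c) \<in> F - G" "(b, d) \<in> G - F" unfolding d by simp_all
  then show "(a, c) \<in> F" "(a, c) \<notin> G" "(b, d) \<in> G" "(b, d) \<notin> F" by simp_all
qed

lemma flip_corners_triangles:
  assumes "flip_corners F G a b c d"
  shows "clique F {a, b, c}" "clique F {a, c, d}" "clique G {a, b, d}" "clique G {b, c, d}"
proof -
  note m = flip_corners_mem[OF assms]
  note o = flip_corners_order[OF assms] and s = flip_corners_sides[OF assms]
  have ac: "clique F {a, c}" and bd: "clique G {b, d}"
    using m o by (auto simp: clique_pair)
  show "clique F {a, b, c}" by (rule clique_insert[OF s(1,2) ac])
  show "clique F {a, c, d}" by (rule clique_insert[OF ac s(3,4)])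
  show "clique G {a, b, d}" by (rule clique_insert[OF s(5) bd s(8)])
  show "clique G {b, c, d}" by (rule clique_insert[OF s(6,7) bd])
qed

text \<open>Only two triangles contain the diagonal \<open>ac\<close>: wherever another common
  neighbour of \<open>a\<close> and \<open>c\<close> lies in the cyclic order, one of its chords to
  them crosses a side of the quadrilateral.\<close>

lemma flip_corners_apex:
  assumes fc: "flip_corners F G a b c d" and F: "chord_triangulation {..<n} F"
    and w: "clique F {a, c, w}"
  shows "w \<in> {a, b, c, d}"
proof (rule ccontr)
  assume nw: "w \<notin> {a, b, c, d}"
  note s = flip_corners_sides[OF fc]
  have nc: "\<not> interleaved e f" if "e \<in> F" "f \<in> F" for e f
    using chord_triangulation_noncrossing[OF F that] .
  have e: "(x, y) \<in> F" if "x < y" "clique F {x, y} \<or> clique F {y, x}" for x y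
    using that unfolding clique_def by auto
  have ws: "clique F {a, w}" "clique F {c, w}" using clique_mono[OF w] by auto
  have aw: "a < w \<Longrightarrow> (a, w) \<in> F" "w < a \<Longrightarrow> (w, a) \<in> F" "c < w \<Longrightarrow> (c, w) \<in> F" "w < c \<Longrightarrow> (w, c) \<in> F"
    using e ws by blast+
  have sd: "a < b \<Longrightarrow> (a, b) \<in> F" "b < a \<Longrightarrow> (b, a) \<in> F" "b < c \<Longrightarrow> (b, c) \<in> F" "c < b \<Longrightarrow> (c, b) \<in> F"
    "c < d \<Longrightarrow> (c, d) \<in> F" "d < c \<Longrightarrow> (d, c) \<in> F" "a < d \<Longrightarrow> (a, d) \<in> F" "d < a \<Longrightarrow> (d, a) \<in> F"
    using e s by blast+
  from flip_corners_order(1)[OF fc] show False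
  proof
    assume o: "a < b \<and> b < c \<and> c < d"
    consider "w < a" | "a < w" "w < b" | "b < w" "w < c" | "c < w" "w < d" | "d < w" using nw by force
    then show False
    proof cases
      case 1 then show False using nc[OF aw(4) sd(7)] o by simp
    next
      case 2 then show False using nc[OF aw(4) sd(1)] o by simp
    next
      case 3 then show False using nc[OF aw(1) sd(3)] o by simp
    next
      case 4 then show False using nc[OF aw(1) sd(5)] o by simp
    next
      case 5 then show False using nc[OF aw(3) sd(7)] o by simp
    qed
  next
    assume o: "b < a \<and> a < d \<and> d < c"
    consider "w < b" | "b < w" "w < a" | "a < w" "w < d" | "d < w" "w < c" | "c < w" using nw by force
    then show False
    proof cases
      case 1 then show False using nc[OF aw(2) sd(3)] o by simp
    next
      case 2 then show False using nc[OF aw(4) sd(2)] o by simp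
    next
      case 3 then show False using nc[OF aw(4) sd(7)] o by simp
    next
      case 4 then show False using nc[OF aw(1) sd(6)] o by simp
    next
      case 5 then show False using nc[OF aw(1) sd(3)] o by simp
    qed
  qed
qed

lemma orient_nonzero:
  assumes "i < n" "j < n" "k < n" "i \<noteq> j" "j \<noteq> k" "i \<noteq> k"
  shows "orient (p i) (p j) (p k) \<noteq> 0"
proof (cases "i < j")
  case True
  then show ?thesis using orient_side(3)[OF True assms(2,3)] assms by auto
next
  case False
  then have "j < i" using assms by auto
  then show ?thesis using orient_side(3)[OF _ assms(1,3), of j] assms orient_swap[of "p i" "p j" "p k"] by auto
qed

lemma flip_corners_quadrilateral:
  assumes fc: "flip_corners F G a b c d"
  obtains o' \<kappa> \<mu> where "quadrilateral (p a) (p b) (p c) (p d) o' \<kappa> \<mu>"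
proof -
  note s = flip_corners_order[OF fc] and di = flip_corners_distinct[OF fc]
  have D: "orient (p a) (p b) (p c) \<noteq> 0" using di by (intro orient_nonzero) auto
  from flip_corners_order(1)[OF fc] show ?thesis
  proof
    assume o: "a < b \<and> b < c \<and> c < d"
    obtain \<alpha> \<beta> where ab: "0 < \<alpha>" "\<alpha> < 1" "0 < \<beta>" "\<beta> < 1"
      "(1 - \<alpha>) *\<^sub>R p a + \<alpha> *\<^sub>R p c = (1 - \<beta>) *\<^sub>R p b + \<beta> *\<^sub>R p d"
      using quad_center[of a b c d] o s by metis
    show ?thesis by (rule that[OF quadrilateralI[OF ab(1-4) refl ab(5) D]])
  next
    assume o: "b < a \<and> a < d \<and> d < c"
    obtain \<beta> \<alpha> where ab: "0 < \<beta>" "\<beta> < 1" "0 < \<alpha>" "\<alpha> < 1"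
      "(1 - \<beta>) *\<^sub>R p b + \<beta> *\<^sub>R p d = (1 - \<alpha>) *\<^sub>R p a + \<alpha> *\<^sub>R p c"
      using quad_center[of b a d c] o s by metis
    show ?thesis by (rule that[OF quadrilateralI[OF ab(3,4,1,2) refl ab(5)[symmetric] D]])
  qed
qed

lemma chull_quad: "chull {a, b, c, d} = convex hull {p a, p b, p c, p d}"
  by (simp add: chull_def)

lemma chull_triple: "chull {a, b, c} = convex hull {p a, p b, p c}"
  by (simp add: chull_def)

lemma flip_corners_split:
  assumes fc: "flip_corners F G a b c d" and x: "x \<in> chull {a, b, c, d}"
  shows "x \<in> chull {a, b, c} \<or> x \<in> chull {a, c, d}" "x \<in> chull {a, b, d} \<or> x \<in> chull {b, c, d}"
proof -
  obtain o' \<kappa> \<mu> where q: "quadrilateral (p a) (p b) (p c) (p d) o' \<kappa> \<mu>"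
    by (rule flip_corners_quadrilateral[OF fc])
  show "x \<in> chull {a, b, c} \<or> x \<in> chull {a, c, d}"
    using quadrilateral_split[OF q] x by (simp add: chull_quad chull_triple)
  have "x \<in> convex hull {p b, p a, p d, p c}" using x by (simp add: chull_quad insert_commute)
  from quadrilateral_split[OF quadrilateral_swap[OF q] this]
  show "x \<in> chull {a, b, d} \<or> x \<in> chull {b, c, d}" by (simp add: chull_triple insert_commute)
qed

lemma flip_corners_frontier:
  assumes fc: "flip_corners F G a b c d" and x: "x \<in> chull {a, b, c, d}" "x \<notin> interior (chull {a, b, c, d})"
  obtains s where "s \<in> {{a, b}, {b, c}, {c, d}, {a, d}}" "x \<in> chull s"
proof -
  obtain o' \<kappa> \<mu> where q: "quadrilateral (p a) (p b) (p c) (p d) o' \<kappa> \<mu>"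
    by (rule flip_corners_quadrilateral[OF fc])
  interpret q: quadrilateral "p a" "p b" "p c" "p d" o' \<kappa> \<mu> by (rule q)
  have "x \<in> q.Q - interior q.Q" using x by (simp add: q.Q_def chull_quad)
  then obtain v w where "v \<in> {p a, p c}" "w \<in> {p b, p d}" "x \<in> closed_segment v w"
    using q.frontier_in_side by blast
  then have "x \<in> chull {a, b} \<or> x \<in> chull {b, c} \<or> x \<in> chull {c, d} \<or> x \<in> chull {a, d}"
    unfolding chull_pair by (auto simp: closed_segment_commute)
  then show ?thesis using that by blast
qed

lemma flip_corners_side:
  assumes fc: "flip_corners F G a b c d" and s: "s \<in> {{a, b}, {b, c}, {c, d}, {a, d}}" "x \<in> chull s"
  shows "x \<notin> interior (chull {a, b, c, d})"
proof -
  obtain o' \<kappa> \<mu> where q: "quadrilateral (p a) (p b) (p c) (p d) o' \<kappa> \<mu>"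
    by (rule flip_corners_quadrilateral[OF fc])
  interpret q: quadrilateral "p a" "p b" "p c" "p d" o' \<kappa> \<mu> by (rule q)
  have "\<exists>v\<in>{p a, p c}. \<exists>w\<in>{p b, p d}. x \<in> closed_segment v w"
    using s unfolding insert_iff
    by (elim disjE) (auto simp: chull_pair closed_segment_commute)
  then show ?thesis using q.side_not_interior by (auto simp: q.Q_def chull_quad)
qed

text \<open>Four vertices of a clique would contain two interleaved chords.\<close>

lemma clique_cases:
  assumes F: "chord_triangulation {..<n} F" and W: "clique F W"
  obtains (1) i where "W = {i}" "i < n" | (2) i j where "W = {i, j}" "i < j" "j < n"
    | (3) i j k where "W = {i, j, k}" "i < j" "j < k" "k < n"
proof -
  have no4: False if "{i, j, k, l} \<subseteq> W" "i < j" "j < k" "k < l" for i j k l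
  proof -
    have "(i, k) \<in> F" "(j, l) \<in> F" using that cliqueD[OF W] by auto
    then show False using chord_triangulation_noncrossing[OF F] that by fastforce
  qed
  have ne: "W \<noteq> {}" and sub: "W \<subseteq> {..<n}" using W unfolding clique_def by auto
  from clique_finite[OF W] ne show ?thesis
  proof (cases rule: nat_set_cases)
    case (1 i) then show ?thesis using that(1) sub by blast
  next
    case (2 i j) then show ?thesis using that(2) sub by blast
  next
    case (3 i j k) then show ?thesis using that(3) sub by blast
  next
    case (4 i j k l) then show ?thesis using no4 by blast
  next
    case (5 i j k l m) then show ?thesis using no4[of i j k l] by blast
  qed
qed


text \<open>A clique has at most three vertices, and three vertices in convex position are never
  collinear, so a clique of size three is a genuine triangle.\<close>

lemma cells_cliques:
  assumes T: "triangulation X T"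
  shows "cells X T = {chull W | W. clique (code T) W}"
proof
  note tri = triangulation_code[OF T] and ar = triangulation_arcs[OF T]
  have end': "\<exists>i<n. u = p i" if h: "closed_segment u v \<in> T" for u v
  proof -
    have "closed_segment u v \<in> arcs X" using h ar by blast
    then obtain i j where ij: "i < j" "j < n" "closed_segment u v = chull {i, j}" by (rule arcsE)
    then have "{u, v} = {p i, p j}" by (simp add: chull_pair)
    then have "u = p i \<or> u = p j" by (auto simp: doubleton_eq_iff)
    moreover have "i < n" using ij by simp
    ultimately show ?thesis using ij(2) by blast
  qed
  have seg: "(i, j) \<in> code T" if "closed_segment (p i) (p j) \<in> T \<or> closed_segment (p j) (p i) \<in> T" "i < j" "j < n" for i j
    using that by (auto simp: chull_pair closed_segment_commute)
  show "cells X T \<subseteq> {chull W | W. clique (code T) W}"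
  proof
    fix \<sigma> assume "\<sigma> \<in> cells X T"
    then consider x where "x \<in> X" "\<sigma> = {x}" | "\<sigma> \<in> T" | "\<sigma> \<in> triangles T" unfolding cells_def by blast
    then show "\<sigma> \<in> {chull W | W. clique (code T) W}"
    proof cases
      case 1
      obtain i where i: "i < n" "x = p i" using 1(1) by (rule p_surj)
      then have "\<sigma> = chull {i}" using 1 by simp
      then show ?thesis using clique_single[OF i(1)] by blast
    next
      case 2
      then have "\<sigma> \<in> arcs X" using ar by blast
      then obtain i j where ij: "i < j" "j < n" "\<sigma> = chull {i, j}" by (rule arcsE)
      then have "clique (code T) {i, j}" using 2 by (simp add: clique_pair)
      then show ?thesis using ij by blast
    next
      case 3
      then obtain u v w where u: "\<sigma> = convex hull {u, v, w}" "\<not> collinear {u, v, w}"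
        "closed_segment u v \<in> T" "closed_segment v w \<in> T" "closed_segment u w \<in> T"
        unfolding triangles_def by blast
      obtain i where i: "i < n" "u = p i" using end'[OF u(3)] by blast
      obtain j where j: "j < n" "v = p j" using end'[OF u(4)] by blast
      have "closed_segment w u \<in> T" using u(5) by (simp add: closed_segment_commute)
      then obtain l where l: "l < n" "w = p l" using end' by blast
      have "clique (code T) {i, j, l}"
        using seg u(3-5) i j l unfolding clique_def by auto
      moreover have "\<sigma> = chull {i, j, l}" using u(1) i j l by (simp add: chull_def)
      ultimately show ?thesis by blast
    qed
  qed
  show "{chull W | W. clique (code T) W} \<subseteq> cells X T"
  proof clarify
    fix W assume W: "clique (code T) W"
    from tri W show "chull W \<in> cells X T"
    proof (cases rule: clique_cases)
      case (1 i)
      then show ?thesis using p_mem by (simp add: cells_def)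
    next
      case (2 i j)
      then have "chull W \<in> T" using W clique_pair by simp
      then show ?thesis by (simp add: cells_def)
    next
      case (3 i j l)
      have "(i, j) \<in> code T" "(j, l) \<in> code T" "(i, l) \<in> code T" 
        using cliqueD[OF W, of i j] cliqueD[OF W, of j l] cliqueD[OF W, of i l] 3 by simp_all
      then have "closed_segment (p i) (p j) \<in> T" "closed_segment (p j) (p l) \<in> T" "closed_segment (p i) (p l) \<in> T"
        by (simp_all add: chull_pair)
      moreover have "\<not> collinear {p i, p j, p l}"
        using orient_nonzero[of i j l] 3 by (simp add: orient_zero_collinear)
      moreover have "chull W = convex hull {p i, p j, p l}" using 3 by (simp add: chull_def)
      ultimately have "chull W \<in> triangles T" unfolding triangles_def by blast
      then show ?thesis by (simp add: cells_def)
    qed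
  qed
qed

lemma simplex_clique:
  assumes F: "chord_triangulation {..<n} F" and W: "clique F W"
  shows "\<not> affine_dependent (embed ` p ` W)" "card (embed ` p ` W) = card W"
proof -
  have inj: "inj_on (embed \<circ> p) W"
    using clique_sub[OF W] p_inj by (auto simp: inj_on_def)
  then show "card (embed ` p ` W) = card W"
    using card_image[OF inj] by (simp add: image_comp)
  from F W show "\<not> affine_dependent (embed ` p ` W)"
  proof (cases rule: clique_cases)
    case (3 i j k)
    have "\<not> collinear {(p i, 0::real), (p j, 0), (p k, 0)}"
    proof
      assume "collinear {(p i, 0::real), (p j, 0), (p k, 0)}"
      then have "p i = p k \<or> (\<exists>u. p j = u *\<^sub>R p i + (1 - u) *\<^sub>R p k)"
        unfolding collinear_3_expand by auto
      then have "collinear {p i, p j, p k}" unfolding collinear_3_expand .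
      then show False using orient_nonzero[of i j k] 3 by (simp add: orient_zero_collinear)
    qed
    then show ?thesis using 3 by (simp add: collinear_3_eq_affine_dependent)
  qed auto
qed

end

section \<open>The faces of a blow-up triangulation\<close>

text \<open>The interface between geodesics and complexes. \<open>keep\<close> and
  \<open>triangle\<close> are all that remains of shortness, and \<open>up\<close> and
  \<open>same\<close> all that remains of the caps; \<open>base\<close> and \<open>extreme\<close>
  pin the polygon vertices to height 0 at all times.\<close>

locale blow_up_path = convex_numbering X p n
  for X :: "plane set" and p :: "nat \<Rightarrow> plane" and n :: nat +
  fixes k :: nat and E :: "nat \<Rightarrow> (nat \<times> nat) set" and h :: "nat \<Rightarrow> plane \<Rightarrow> real"
    and a b c d :: "nat \<Rightarrow> nat" and K :: "space set set"
  assumes tri: "t \<le> k \<Longrightarrow> chord_triangulation {..<n} (E t)"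
    and keep: "i \<le> m \<Longrightarrow> m \<le> j \<Longrightarrow> j \<le> k \<Longrightarrow> e \<in> E i \<Longrightarrow> e \<in> E j \<Longrightarrow> e \<in> E m"
    and triangle: "u < v \<Longrightarrow> v < w \<Longrightarrow> w < n \<Longrightarrow> s1 \<le> k \<Longrightarrow> s2 \<le> k \<Longrightarrow> s3 \<le> k \<Longrightarrow>
      (u, v) \<in> E s1 \<Longrightarrow> (v, w) \<in> E s2 \<Longrightarrow> (u, w) \<in> E s3 \<Longrightarrow>
      \<exists>t\<le>k. (u, v) \<in> E t \<and> (v, w) \<in> E t \<and> (u, w) \<in> E t"
    and corners: "t < k \<Longrightarrow> flip_corners (E t) (E (Suc t)) (a t) (b t) (c t) (d t)"
    and cont: "t \<le> k \<Longrightarrow> continuous_on (chull {..<n}) (h t)"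
    and up: "t < k \<Longrightarrow> x \<in> interior (chull {a t, b t, c t, d t}) \<Longrightarrow> h t x < h (Suc t) x"
    and same: "t < k \<Longrightarrow> x \<in> chull {..<n} \<Longrightarrow> x \<notin> interior (chull {a t, b t, c t, d t}) \<Longrightarrow> h (Suc t) x = h t x"
    and base: "v < n \<Longrightarrow> h 0 (p v) = 0"
    and extreme: "v < n \<Longrightarrow> p v \<notin> interior (chull {..<n})"
    and n: "0 < n"
    and K: "K = {graph_over (h t) (chull W) | t W. t \<le> k \<and> clique (E t) W} \<union>
      {region_between (h t) (h (Suc t)) (chull {a t, b t, c t, d t}) | t. t < k}"
begin

text \<open>The \<open>t\<close>-th flip, from \<open>E t\<close> to \<open>E (t + 1)\<close>, removes \<open>(a t, c t)\<close> and inserts \<open>(b t, d t)\<close>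
  in the quadrilateral with corner set \<open>V t\<close>; \<open>tet t\<close> is the ball of this flip.\<close>

definition V :: "nat \<Rightarrow> nat set" where "V t = {a t, b t, c t, d t}"
definition Face :: "nat \<Rightarrow> nat set \<Rightarrow> space set" where "Face t W = graph_over (h t) (chull W)"
definition tet :: "nat \<Rightarrow> space set" where "tet t = region_between (h t) (h (Suc t)) (chull (V t))"

lemma K_eq: "K = {Face t W | t W. t \<le> k \<and> clique (E t) W} \<union> {tet t | t. t < k}"
  unfolding K Face_def tet_def V_def ..

lemma mem_Face: "(x, z) \<in> Face t W \<longleftrightarrow> x \<in> chull W \<and> z = h t x"
  by (simp add: Face_def)

lemma mem_tet: "(x, z) \<in> tet t \<longleftrightarrow> x \<in> chull (V t) \<and> h t x \<le> z \<and> z \<le> h (Suc t) x"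
  by (simp add: tet_def)

lemma Face_empty [simp]: "Face t {} = {}"
  by (simp add: Face_def graph_over_def)

lemma Face_nonempty: "W \<noteq> {} \<Longrightarrow> Face t W \<noteq> {}"
  using vertex_in_chull mem_Face by blast

lemma V_sub: "t < k \<Longrightarrow> V t \<subseteq> {..<n}"
  using flip_corners_distinct(7)[OF corners] by (simp add: V_def)

lemma chull_P: "W \<subseteq> {..<n} \<Longrightarrow> x \<in> chull W \<Longrightarrow> x \<in> chull {..<n}"
  using chull_mono by blast

lemma h_step: "t < k \<Longrightarrow> x \<in> chull {..<n} \<Longrightarrow> h t x \<le> h (Suc t) x"
  using up[of t x] same[of t x] by (cases "x \<in> interior (chull {a t, b t, c t, d t})") auto

lemma h_mono:
  assumes "i \<le> j" "j \<le> k" "x \<in> chull {..<n}"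
  shows "h i x \<le> h j x"
  using assms(1,2)
proof (induction j rule: dec_induct)
  case (step m)
  then show ?case using h_step[of m x] assms(3) by force
qed simp

text \<open>A vertex is never interior to the polygon, hence never interior to a quadrilateral, and
  no flip moves it.\<close>

lemma h_vertex: "t \<le> k \<Longrightarrow> v < n \<Longrightarrow> h t (p v) = 0"
proof (induction t)
  case 0 then show ?case using base by simp
next
  case (Suc t)
  have v: "p v \<in> chull {..<n}" using Suc vertex_in_chull by simp
  have "chull {a t, b t, c t, d t} \<subseteq> chull {..<n}"
    using chull_mono[OF V_sub[of t]] Suc by (simp add: V_def)
  then have "p v \<notin> interior (chull {a t, b t, c t, d t})"
    using extreme[OF Suc.prems(2)] interior_mono by blast
  then show ?case using same[OF _ v] Suc by simp
qed

lemma E_lt: "t \<le> k \<Longrightarrow> (i, j) \<in> E t \<Longrightarrow> i < j \<and> j < n"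
  using chord_triangulation_memD[OF tri] by blast

lemma keep_clique:
  assumes "i \<le> m" "m \<le> j" "j \<le> k" "clique (E i) W" "clique (E j) W"
  shows "clique (E m) W"
  using assms(4,5) keep[OF assms(1-3)] unfolding clique_def by blast

lemma triangles:
  assumes "t < k"
  shows "clique (E t) {a t, b t, c t}" "clique (E t) {a t, c t, d t}"
    "clique (E (Suc t)) {a t, b t, d t}" "clique (E (Suc t)) {b t, c t, d t}"
  using flip_corners_triangles[OF corners[OF assms]] by blast+

lemma ac_bd:
  assumes "t < k"
  shows "(a t, c t) \<in> E t" "(a t, c t) \<notin> E (Suc t)" "(b t, d t) \<in> E (Suc t)" "(b t, d t) \<notin> E t"
  using flip_corners_mem[OF corners[OF assms]] by blast+

lemma ac_lt: "t < k \<Longrightarrow> a t < c t \<and> b t < d t"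
  using ac_bd E_lt[of t] E_lt[of "Suc t"] by force

text \<open>The carrier of a point survives every flip whose ball does not lie above the point: a lost
  carrier contains the removed diagonal, so the point would lie on a side of the quadrilateral.\<close>

lemma carrier_survives:
  assumes ij: "i \<le> j" "j \<le> k" and U: "clique (E i) U" and x: "x \<in> chull U"
    and min: "\<And>U'. U' \<subseteq> U \<Longrightarrow> x \<in> chull U' \<Longrightarrow> U' = U" and eq: "h i x = h j x"
  shows "clique (E j) U"
  using ij eq
proof (induction j rule: dec_induct)
  case base
  then show ?case using U by simp
next
  case (step m)
  have xP: "x \<in> chull {..<n}" using chull_P clique_sub[OF U] x by blast
  have m: "m < k" "m \<le> k" using step by auto
  have "h i x \<le> h m x" "h m x \<le> h (Suc m) x" using h_mono[of i m x] h_step[OF m(1) xP] step xP by auto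
  then have e: "h i x = h m x" "h m x = h (Suc m) x" using step.prems by auto
  have Um: "clique (E m) U" using step.IH m e by simp
  note fc = corners[OF m(1)]
  show ?case
  proof (rule ccontr)
    assume "\<not> clique (E (Suc m)) U"
    then obtain u v where uv: "u \<in> U" "v \<in> U" "u < v" "(u, v) \<notin> E (Suc m)"
      using Um unfolding clique_def by blast
    then have "(u, v) \<in> E m - E (Suc m)" using cliqueD[OF Um] by blast
    then have "(u, v) = (a m, c m)" using fc unfolding flip_corners_def by (metis singletonD)
    then have ac: "a m \<in> U" "c m \<in> U" using uv by auto
    have "U \<subseteq> V m"
    proof
      fix w assume "w \<in> U"
      then have "clique (E m) {a m, c m, w}" using ac by (intro clique_mono[OF Um]) auto
      then show "w \<in> V m" using flip_corners_apex[OF fc tri[OF m(2)]] by (simp add: V_def)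
    qed
    then have "x \<in> chull {a m, b m, c m, d m}" using x chull_mono by (auto simp: V_def)
    moreover have "x \<notin> interior (chull {a m, b m, c m, d m})" using up[OF m(1)] e by fastforce
    ultimately obtain s where s: "s \<in> {{a m, b m}, {b m, c m}, {c m, d m}, {a m, d m}}" "x \<in> chull s"
      by (rule flip_corners_frontier[OF fc])
    have "clique (E m) s" using s(1) flip_corners_sides(1-4)[OF fc] by auto
    \<comment> \<open>Minimality of the carrier puts all of \<open>U\<close> into the side
      \<open>s\<close>, but no side contains both ends of the removed diagonal.\<close>
    then have "x \<in> chull (U \<inter> s)" using chull_clique_Int[OF tri[OF m(2)] Um] x s(2) by blast
    then have "U \<inter> s = U" using min by simp
    then have "a m \<in> s" "c m \<in> s" using ac by auto
    then show False using s(1) flip_corners_distinct[OF fc] by auto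
  qed
qed

text \<open>By \<open>keep\<close> the clique is present throughout, so it contains neither diagonal
  of a flip in between. It therefore meets the quadrilateral inside one side, where the flip does
  not change the height.\<close>

lemma h_eq_clique:
  assumes ij: "i \<le> j" "j \<le> k" and U: "clique (E i) U" "clique (E j) U" and x: "x \<in> chull U"
  shows "h i x = h j x"
proof -
  have xP: "x \<in> chull {..<n}" using chull_P clique_sub[OF U(1)] x by blast
  have step: "h (Suc m) x = h m x" if m: "i \<le> m" "m < j" for m
  proof -
    have mk: "m < k" "m \<le> k" "Suc m \<le> k" using m ij by auto
    note fc = corners[OF mk(1)]
    have c1: "clique (E m) U" and c2: "clique (E (Suc m)) U"
      using keep_clique[OF _ _ ij(2) U] m by auto
    have "x \<notin> interior (chull {a m, b m, c m, d m})"
    proof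
      assume xi: "x \<in> interior (chull {a m, b m, c m, d m})"
      then have xV: "x \<in> chull (V m)" using interior_subset by (auto simp: V_def)
      have "chull U \<inter> chull (V m) = chull (U \<inter> V m)"
      proof (rule chull_Int[OF clique_sub[OF U(1)] V_sub[OF mk(1)]])
        fix u v y z assume u: "u \<in> U" "v \<in> U" and y: "y \<in> V m" "z \<in> V m"
        show "\<not> interleaved (u, v) (y, z)"
        proof
          assume I: "interleaved (u, v) (y, z)"
          then have "u < v" "y < z" by auto
          then have uE: "(u, v) \<in> E m" "(u, v) \<in> E (Suc m)"
            using cliqueD[OF c1] cliqueD[OF c2] u by auto
          have "clique (E m) {y, z} \<or> clique (E (Suc m)) {y, z}"
          proof (cases "{y, z} \<subseteq> {a m, b m, c m} \<or> {y, z} \<subseteq> {a m, c m, d m}")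
            case True
            then show ?thesis using clique_mono[OF triangles(1)[OF mk(1)]] clique_mono[OF triangles(2)[OF mk(1)]] by blast
          next
            case False
            then have "{y, z} \<subseteq> {a m, b m, d m}" using y unfolding V_def by auto
            then show ?thesis using clique_mono[OF triangles(3)[OF mk(1)]] by blast
          qed
          then have "(y, z) \<in> E m \<or> (y, z) \<in> E (Suc m)" using \<open>y < z\<close> cliqueD by blast
          then show False
            using I uE chord_triangulation_noncrossing[OF tri[OF mk(2)]]
              chord_triangulation_noncrossing[OF tri[OF mk(3)]] by blast
        qed
      qed
      then have xUV: "x \<in> chull (U \<inter> V m)" using x xV by blast
      have "\<not> (a m \<in> U \<and> c m \<in> U)" "\<not> (b m \<in> U \<and> d m \<in> U)"
        using ac_bd[OF mk(1)] ac_lt[OF mk(1)] cliqueD[OF c1] cliqueD[OF c2] by blast+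
      then have "\<exists>s\<in>{{a m, b m}, {b m, c m}, {c m, d m}, {a m, d m}}. U \<inter> V m \<subseteq> s"
        unfolding V_def by auto
      then obtain s where s: "s \<in> {{a m, b m}, {b m, c m}, {c m, d m}, {a m, d m}}" "U \<inter> V m \<subseteq> s" by blast
      then have "x \<in> chull s" using xUV chull_mono by blast
      then show False using flip_corners_side[OF fc s(1)] xi by blast
    qed
    then show ?thesis using same[OF mk(1) xP] by blast
  qed
  show ?thesis using ij(1) step
  proof (induction j rule: dec_induct)
    case (step m)
    then show ?case by (metis less_SucI lessI)
  qed simp
qed

lemma Face_cong:
  assumes "i \<le> j" "j \<le> k" "clique (E i) U" "clique (E j) U"
  shows "Face i U = Face j U"
  unfolding Face_def graph_over_def using h_eq_clique[OF assms] by (intro image_cong) auto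

text \<open>A common point has the same height at both times. Its smallest carrier in
  \<open>U\<close> is still present at time \<open>j\<close> by \<open>carrier_survives\<close>, can
  be compared with \<open>W\<close> inside one triangulation, and is therefore contained in
  \<open>W\<close>.\<close>

lemma Face_Int:
  assumes ij: "i \<le> j" "j \<le> k" and U: "clique (E i) U" and W: "clique (E j) W"
  shows "Face i U \<inter> Face j W = Face i (U \<inter> W)" "Face i (U \<inter> W) = Face j (U \<inter> W)"
proof -
  show eq: "Face i (U \<inter> W) = Face j (U \<inter> W)"
  proof (cases "U \<inter> W = {}")
    case False
    then show ?thesis
      using clique_mono[OF U, of "U \<inter> W"] clique_mono[OF W, of "U \<inter> W"] by (intro Face_cong[OF ij]) auto
  qed simp
  have mono: "Face t A \<subseteq> Face t B" if "A \<subseteq> B" for t A B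
    using chull_mono[OF that] unfolding Face_def graph_over_def by blast
  show "Face i U \<inter> Face j W = Face i (U \<inter> W)"
  proof
    show "Face i (U \<inter> W) \<subseteq> Face i U \<inter> Face j W"
      using mono[of "U \<inter> W" U i] mono[of "U \<inter> W" W j] eq by blast
    show "Face i U \<inter> Face j W \<subseteq> Face i (U \<inter> W)"
    proof
      fix y assume y: "y \<in> Face i U \<inter> Face j W"
      obtain x z where xz: "y = (x, z)" by (cases y)
      have x: "x \<in> chull U" "x \<in> chull W" "z = h i x" "h i x = h j x"
        using y xz by (auto simp: mem_Face)
      obtain U0 where U0: "U0 \<subseteq> U \<and> x \<in> chull U0"
        and least: "\<And>U'. U' \<subseteq> U \<and> x \<in> chull U' \<Longrightarrow> card U0 \<le> card U'"
        using ex_has_least_nat[of "\<lambda>U'. U' \<subseteq> U \<and> x \<in> chull U'" U card] x(1) by blast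
      have fin: "finite U0" using U0 clique_finite[OF U] finite_subset by blast
      have min: "U' = U0" if "U' \<subseteq> U0" "x \<in> chull U'" for U'
        using least[of U'] that U0 card_seteq[OF fin that(1)] by blast
      have "U0 \<noteq> {}" using U0 by auto
      then have c0: "clique (E i) U0" using U0 by (intro clique_mono[OF U]) auto
      have "clique (E j) U0"
        by (rule carrier_survives[OF ij c0 _ min x(4)]) (use U0 in auto)
      then have "x \<in> chull (U0 \<inter> W)"
        using chull_clique_Int[OF tri[OF ij(2)] _ W] U0 x(2) by blast
      then have "U0 \<inter> W = U0" using min by simp
      then have "x \<in> chull (U \<inter> W)" using U0 chull_mono[of U0 "U \<inter> W"] by blast
      then show "y \<in> Face i (U \<inter> W)" using xz x(3) by (simp add: mem_Face)
    qed
  qed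
qed

lemma quad_covered:
  assumes "t < k" "x \<in> chull (V t)"
  shows "\<exists>U\<in>{{a t, b t, c t}, {a t, c t, d t}}. x \<in> chull U"
    "\<exists>U\<in>{{a t, b t, d t}, {b t, c t, d t}}. x \<in> chull U"
  using flip_corners_split[OF corners[OF assms(1)]] assms(2) by (auto simp: V_def)

text \<open>A face from a time up to \<open>t\<close> meets the ball only in its lower disk. It
  cannot contain both \<open>b t\<close> and \<open>d t\<close>, since that arc would then be absent
  at time \<open>t\<close> and return with the flip; so its vertices in \<open>V t\<close> belong to
  a single lower triangle.\<close>

lemma Face_Int_tet_lower:
  assumes jt: "j \<le> t" "t < k" and W: "clique (E j) W"
  shows "Face j W \<inter> tet t = Face j (W \<inter> V t)" "Face j (W \<inter> V t) = Face t (W \<inter> V t)"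
    "\<not> {b t, d t} \<subseteq> W"
proof -
  have tk: "t \<le> k" "Suc t \<le> k" "j \<le> k" using jt by auto
  show nb: "\<not> {b t, d t} \<subseteq> W"
  proof
    assume "{b t, d t} \<subseteq> W"
    then have "(b t, d t) \<in> E j" using cliqueD[OF W] ac_lt[OF jt(2)] by blast
    then have "(b t, d t) \<in> E t" using keep[of j t "Suc t"] jt ac_bd(3)[OF jt(2)] by simp
    then show False using ac_bd(4)[OF jt(2)] by blast
  qed
  define L where "L = (if b t \<in> W then {a t, b t, c t} else {a t, c t, d t})"
  have L: "clique (E t) L" "W \<inter> V t = W \<inter> L" "L \<subseteq> V t"
    using triangles[OF jt(2)] nb by (auto simp: L_def V_def)
  have I: "Face j W \<inter> Face t U = Face j (W \<inter> U)" "Face j (W \<inter> U) = Face t (W \<inter> U)" if "clique (E t) U" for U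
    using Face_Int[OF jt(1) tk(1) W that] by blast+
  show "Face j (W \<inter> V t) = Face t (W \<inter> V t)" using I(2)[OF L(1)] L(2) by simp
  show "Face j W \<inter> tet t = Face j (W \<inter> V t)"
  proof
    show "Face j (W \<inter> V t) \<subseteq> Face j W \<inter> tet t"
    proof
      fix y assume y: "y \<in> Face j (W \<inter> V t)"
      then have yy: "y \<in> Face j W" "y \<in> Face t L" using I(1)[OF L(1)] L(2) by auto
      obtain x z where xz: "y = (x, z)" by (cases y)
      have x: "x \<in> chull L" "z = h t x" using yy xz by (auto simp: mem_Face)
      then have "x \<in> chull (V t)" using chull_mono[OF L(3)] by blast
      then have "y \<in> tet t" using x xz h_step[OF jt(2) chull_P[OF V_sub[OF jt(2)]]] by (simp add: mem_tet)
      then show "y \<in> Face j W \<inter> tet t" using yy by blast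
    qed
    show "Face j W \<inter> tet t \<subseteq> Face j (W \<inter> V t)"
    proof
      fix y assume y: "y \<in> Face j W \<inter> tet t"
      obtain x z where xz: "y = (x, z)" by (cases y)
      have x: "x \<in> chull W" "z = h j x" "x \<in> chull (V t)" "h t x \<le> h j x"
        using y xz by (auto simp: mem_Face mem_tet)
      have "h j x \<le> h t x" using h_mono[OF jt(1) tk(1)] chull_P[OF V_sub[OF jt(2)] x(3)] by blast
      then have e: "h t x = h j x" using x by simp
      obtain U where U: "U \<in> {{a t, b t, c t}, {a t, c t, d t}}" "x \<in> chull U"
        using quad_covered(1)[OF jt(2) x(3)] by blast
      have "clique (E t) U" "U \<subseteq> V t" using U(1) triangles[OF jt(2)] by (auto simp: V_def)
      moreover have "y \<in> Face j W \<inter> Face t U" using y xz x e U by (auto simp: mem_Face)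
      ultimately have "y \<in> Face j (W \<inter> U)" using I(1) by blast
      then show "y \<in> Face j (W \<inter> V t)"
        using chull_mono[of "W \<inter> U" "W \<inter> V t"] \<open>U \<subseteq> V t\<close> xz by (auto simp: mem_Face)
    qed
  qed
qed

text \<open>The counterpart after the flip: the contact is with the upper disk, and the removed
  diagonal cannot return.\<close>

lemma Face_Int_tet_upper:
  assumes jt: "t < j" "j \<le> k" and W: "clique (E j) W"
  shows "Face j W \<inter> tet t = Face j (W \<inter> V t)" "Face j (W \<inter> V t) = Face (Suc t) (W \<inter> V t)"
    "\<not> {a t, c t} \<subseteq> W"
proof -
  have tk: "t < k" "Suc t \<le> k" "Suc t \<le> j" using jt by auto
  show nb: "\<not> {a t, c t} \<subseteq> W"
  proof
    assume "{a t, c t} \<subseteq> W"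
    then have "(a t, c t) \<in> E j" using cliqueD[OF W] ac_lt[OF tk(1)] by blast
    then have "(a t, c t) \<in> E (Suc t)" using keep[of t "Suc t" j] jt ac_bd(1)[OF tk(1)] by simp
    then show False using ac_bd(2)[OF tk(1)] by blast
  qed
  define L where "L = (if a t \<in> W then {a t, b t, d t} else {b t, c t, d t})"
  have L: "clique (E (Suc t)) L" "W \<inter> V t = W \<inter> L" "L \<subseteq> V t"
    using triangles[OF tk(1)] nb by (auto simp: L_def V_def)
  have I: "Face j W \<inter> Face (Suc t) U = Face j (W \<inter> U)" "Face j (W \<inter> U) = Face (Suc t) (W \<inter> U)"
    if "clique (E (Suc t)) U" for U
    using Face_Int[OF tk(3) jt(2) that W] by (simp_all add: Int_commute)
  show "Face j (W \<inter> V t) = Face (Suc t) (W \<inter> V t)" using I(2)[OF L(1)] L(2) by simp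
  show "Face j W \<inter> tet t = Face j (W \<inter> V t)"
  proof
    show "Face j (W \<inter> V t) \<subseteq> Face j W \<inter> tet t"
    proof
      fix y assume y: "y \<in> Face j (W \<inter> V t)"
      then have yy: "y \<in> Face j W" "y \<in> Face (Suc t) L" using I(1)[OF L(1)] L(2) by auto
      obtain x z where xz: "y = (x, z)" by (cases y)
      have x: "x \<in> chull L" "z = h (Suc t) x" using yy xz by (auto simp: mem_Face)
      then have "x \<in> chull (V t)" using chull_mono[OF L(3)] by blast
      then have "y \<in> tet t" using x xz h_step[OF tk(1) chull_P[OF V_sub[OF tk(1)]]] by (simp add: mem_tet)
      then show "y \<in> Face j W \<inter> tet t" using yy by blast
    qed
    show "Face j W \<inter> tet t \<subseteq> Face j (W \<inter> V t)"
    proof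
      fix y assume y: "y \<in> Face j W \<inter> tet t"
      obtain x z where xz: "y = (x, z)" by (cases y)
      have x: "x \<in> chull W" "z = h j x" "x \<in> chull (V t)" "h j x \<le> h (Suc t) x"
        using y xz by (auto simp: mem_Face mem_tet)
      have "h (Suc t) x \<le> h j x" using h_mono[OF tk(3) jt(2)] chull_P[OF V_sub[OF tk(1)] x(3)] by blast
      then have e: "h (Suc t) x = h j x" using x by simp
      obtain U where U: "U \<in> {{a t, b t, d t}, {b t, c t, d t}}" "x \<in> chull U"
        using quad_covered(2)[OF tk(1) x(3)] by blast
      have "clique (E (Suc t)) U" "U \<subseteq> V t" using U(1) triangles[OF tk(1)] by (auto simp: V_def)
      moreover have "y \<in> Face j W \<inter> Face (Suc t) U" using y xz x e U by (auto simp: mem_Face)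
      ultimately have "y \<in> Face j (W \<inter> U)" using I(1) by blast
      then show "y \<in> Face j (W \<inter> V t)"
        using chull_mono[of "W \<inter> U" "W \<inter> V t"] \<open>U \<subseteq> V t\<close> xz by (auto simp: mem_Face)
    qed
  qed
qed

lemma pair_in_V:
  assumes t: "t < k" and uv: "u \<in> V t" "v \<in> V t" "u < v"
  shows "(u, v) \<in> E t \<or> (u, v) \<in> E (Suc t)"
proof -
  have "{u, v} \<subseteq> {a t, b t, c t} \<or> {u, v} \<subseteq> {a t, c t, d t} \<or> {u, v} \<subseteq> {a t, b t, d t}"
    using uv unfolding V_def by auto
  then show ?thesis using triangles[OF t] cliqueD uv(3) by (metis insert_subset)
qed

text \<open>The earlier ball lies weakly below the later one, so they touch only in the lower disk
  of the later. The arc inserted by the later flip does not join two corners of the earlier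
  quadrilateral, as it would have to be present already; the common corners thus span a face of a
  lower triangle.\<close>

lemma tet_Int_tet:
  assumes ij: "i < j" "j < k"
  shows "tet i \<inter> tet j = Face j (V i \<inter> V j)" "V i \<inter> V j \<noteq> {} \<Longrightarrow> clique (E j) (V i \<inter> V j)"
proof -
  have ik: "i < k" "Suc i \<le> k" "Suc i \<le> j" "j \<le> k" "Suc j \<le> k" using ij by auto
  have nac: "\<not> {a i, c i} \<subseteq> V j"
  proof
    assume "{a i, c i} \<subseteq> V j"
    then have "(a i, c i) \<in> E j \<or> (a i, c i) \<in> E (Suc j)" using pair_in_V[OF ij(2)] ac_lt[OF ik(1)] by blast
    then have "(a i, c i) \<in> E (Suc i)"
      using keep[of i "Suc i" j] keep[of i "Suc i" "Suc j"] ac_bd(1)[OF ik(1)] ij by auto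
    then show False using ac_bd(2)[OF ik(1)] by blast
  qed
  have nbd: "\<not> {b j, d j} \<subseteq> V i"
  proof
    assume "{b j, d j} \<subseteq> V i"
    then have "(b j, d j) \<in> E i \<or> (b j, d j) \<in> E (Suc i)" using pair_in_V[OF ik(1)] ac_lt[OF ij(2)] by blast
    then have "(b j, d j) \<in> E j"
      using keep[of i j "Suc j"] keep[of "Suc i" j "Suc j"] ac_bd(3)[OF ij(2)] ij by auto
    then show False using ac_bd(4)[OF ij(2)] by blast
  qed
  define L where "L = (if b j \<in> V i then {a j, b j, c j} else {a j, c j, d j})"
  have L: "clique (E j) L" "V i \<inter> V j = V i \<inter> L" "L \<subseteq> V j"
    using triangles[OF ij(2)] nbd by (auto simp: L_def V_def[of j])
  show "clique (E j) (V i \<inter> V j)" if "V i \<inter> V j \<noteq> {}"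
    using clique_mono[OF L(1), of "V i \<inter> V j"] L(2) that by auto
  have up': "Face j U \<inter> tet i = Face j (U \<inter> V i)" if "clique (E j) U" for U
    using Face_Int_tet_upper(1)[OF ij(1) ik(4) that] .
  show "tet i \<inter> tet j = Face j (V i \<inter> V j)"
  proof
    show "tet i \<inter> tet j \<subseteq> Face j (V i \<inter> V j)"
    proof
      fix y assume y: "y \<in> tet i \<inter> tet j"
      obtain x z where xz: "y = (x, z)" by (cases y)
      have x: "x \<in> chull (V i)" "z \<le> h (Suc i) x" "x \<in> chull (V j)" "h j x \<le> z"
        using y xz by (auto simp: mem_tet)
      have "h (Suc i) x \<le> h j x" using h_mono[OF ik(3,4)] chull_P[OF V_sub[OF ij(2)] x(3)] by blast
      then have z: "z = h j x" using x by simp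
      obtain U where U: "U \<in> {{a j, b j, c j}, {a j, c j, d j}}" "x \<in> chull U"
        using quad_covered(1)[OF ij(2) x(3)] by blast
      have c: "clique (E j) U" "U \<subseteq> V j" using U(1) triangles[OF ij(2)] by (auto simp: V_def)
      have "y \<in> Face j U \<inter> tet i" using y xz z U by (auto simp: mem_Face)
      then have "y \<in> Face j (U \<inter> V i)" using up'[OF c(1)] by blast
      then show "y \<in> Face j (V i \<inter> V j)"
        using chull_mono[of "U \<inter> V i" "V i \<inter> V j"] c(2) xz by (auto simp: mem_Face)
    qed
    show "Face j (V i \<inter> V j) \<subseteq> tet i \<inter> tet j"
    proof
      fix y assume y: "y \<in> Face j (V i \<inter> V j)"
      then have yy: "y \<in> Face j L" "y \<in> tet i" using up'[OF L(1)] L(2) by (auto simp: Int_commute)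
      obtain x z where xz: "y = (x, z)" by (cases y)
      have x: "x \<in> chull L" "z = h j x" using yy xz by (auto simp: mem_Face)
      then have "x \<in> chull (V j)" using chull_mono[OF L(3)] by blast
      then have "y \<in> tet j" using x xz h_step[OF ij(2) chull_P[OF V_sub[OF ij(2)]]] by (simp add: mem_tet)
      then show "y \<in> tet i \<inter> tet j" using yy by blast
    qed
  qed
qed

lemma Face_in_K: "t \<le> k \<Longrightarrow> clique (E t) W \<Longrightarrow> Face t W \<in> K"
  unfolding K_eq by blast

lemma tet_in_K: "t < k \<Longrightarrow> tet t \<in> K"
  unfolding K_eq by blast

lemma K_cases:
  assumes "\<sigma> \<in> K"
  obtains (face) t W where "\<sigma> = Face t W" "t \<le> k" "clique (E t) W" | (tet) t where "\<sigma> = tet t" "t < k"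
  using assms unfolding K_eq by blast

lemma Face_Int_tet_in_K:
  assumes "j \<le> k" "clique (E j) W" "t < k"
  shows "Face j W \<inter> tet t = {} \<or> Face j W \<inter> tet t \<in> K"
proof -
  have "Face j W \<inter> tet t = Face j (W \<inter> V t)"
    using Face_Int_tet_lower(1)[OF _ assms(3,2)] Face_Int_tet_upper(1)[OF _ assms(1,2)] by (cases "j \<le> t") auto
  moreover have "Face j (W \<inter> V t) \<in> K" if "W \<inter> V t \<noteq> {}"
    using clique_mono[OF assms(2) _ that] Face_in_K[OF assms(1)] by blast
  ultimately show ?thesis by (cases "W \<inter> V t = {}") auto
qed

lemma K_Int:
  assumes "\<sigma> \<in> K" "\<tau> \<in> K"
  shows "\<sigma> \<inter> \<tau> = {} \<or> \<sigma> \<inter> \<tau> \<in> K"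
proof -
  have ff: "Face i U \<inter> Face j W = {} \<or> Face i U \<inter> Face j W \<in> K"
    if "i \<le> j" "j \<le> k" "clique (E i) U" "clique (E j) W" for i j U W
  proof -
    have "Face i (U \<inter> W) \<in> K" if "U \<inter> W \<noteq> {}"
      using that \<open>i \<le> j\<close> \<open>j \<le> k\<close> clique_mono[OF \<open>clique (E i) U\<close>, of "U \<inter> W"] by (intro Face_in_K) auto
    then show ?thesis using Face_Int(1)[OF that] by (cases "U \<inter> W = {}") auto
  qed
  have tt: "tet i \<inter> tet j = {} \<or> tet i \<inter> tet j \<in> K" if "i < j" "j < k" for i j
    using tet_Int_tet[OF that] Face_in_K[of j] that by (cases "V i \<inter> V j = {}") auto
  from assms(1) show ?thesis
  proof (cases rule: K_cases)
    case s: (face i U)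
    from assms(2) show ?thesis
    proof (cases rule: K_cases)
      case (face j W)
      then show ?thesis using ff[of i j U W] ff[of j i W U] s by (cases "i \<le> j") (auto simp: Int_commute)
    next
      case (tet j)
      then show ?thesis using Face_Int_tet_in_K s by blast
    qed
  next
    case s: (tet i)
    from assms(2) show ?thesis
    proof (cases rule: K_cases)
      case (face j W)
      then show ?thesis using Face_Int_tet_in_K s by (metis Int_commute)
    next
      case (tet j)
      consider "i < j" | "j < i" | "i = j" by linarith
      then show ?thesis
      proof cases
        case 1 then show ?thesis using tt s tet by blast
      next
        case 2 then show ?thesis using tt[of j i] s tet by (simp add: Int_commute)
      next
        case 3 then show ?thesis using assms(1) s tet by simp
      qed
    qed
  qed
qed

end

lemma nonempty_subsets_image:
  "{G W | W. W \<subseteq> g ` A \<and> W \<noteq> {}} = {G (g ` U) | U. U \<subseteq> A \<and> U \<noteq> {}}"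
proof
  show "{G W | W. W \<subseteq> g ` A \<and> W \<noteq> {}} \<subseteq> {G (g ` U) | U. U \<subseteq> A \<and> U \<noteq> {}}"
  proof clarify
    fix W assume W: "W \<subseteq> g ` A" "W \<noteq> {}"
    obtain U where U: "U \<subseteq> A" "W = g ` U" using W(1) by (rule subset_imageE)
    then have "U \<noteq> {}" using W(2) by blast
    then show "\<exists>U. G W = G (g ` U) \<and> U \<subseteq> A \<and> U \<noteq> {}" using U by blast
  qed
  show "{G (g ` U) | U. U \<subseteq> A \<and> U \<noteq> {}} \<subseteq> {G W | W. W \<subseteq> g ` A \<and> W \<noteq> {}}"
  proof clarify
    fix U assume "U \<subseteq> A" "U \<noteq> {}"
    then show "\<exists>W. G (g ` U) = G W \<and> W \<subseteq> g ` A \<and> W \<noteq> {}"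
      by (intro exI[of _ "g ` U"] conjI refl image_mono) simp_all
  qed
qed

lemma linear_embed: "linear embed"
  by (rule linearI) auto

section \<open>Every face is a curved simplex with the right subfaces\<close>

context blow_up_path
begin

lemma quadrilateral_V:
  assumes "t < k"
  obtains o' \<kappa> \<mu> where "quadrilateral (p (a t)) (p (b t)) (p (c t)) (p (d t)) o' \<kappa> \<mu>"
  by (rule flip_corners_quadrilateral[OF corners[OF assms]])

lemma chull_V: "chull (V t) = convex hull {p (a t), p (b t), p (c t), p (d t)}"
  by (simp add: V_def chull_quad)

text \<open>Over the crossing point of the diagonals the ball contains a vertical segment of
  positive length, while a face has one point above each point.\<close>

lemma tet_not_subset_Face:
  assumes "t < k" shows "\<not> tet t \<subseteq> Face s W"
proof
  assume sub: "tet t \<subseteq> Face s W"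
  obtain o' \<kappa> \<mu> where "quadrilateral (p (a t)) (p (b t)) (p (c t)) (p (d t)) o' \<kappa> \<mu>"
    by (rule quadrilateral_V[OF assms])
  then interpret q: quadrilateral "p (a t)" "p (b t)" "p (c t)" "p (d t)" o' \<kappa> \<mu> .
  have "o' \<in> interior (chull (V t))" using q.center_interior by (simp add: q.Q_def chull_V)
  moreover from this have "o' \<in> chull (V t)" using interior_subset by blast
  moreover have lt: "h t o' < h (Suc t) o'" using up[OF assms] calculation(1) by (simp add: V_def)
  ultimately have "(o', h t o') \<in> Face s W" "(o', h (Suc t) o') \<in> Face s W"
    using sub mem_tet[of o' _ t] by auto
  then show False using lt by (simp add: mem_Face)
qed

text \<open>A face contained in \<open>Face t W\<close> may come from another time, but its
  projection forces its vertices into \<open>W\<close> and its heights agree with those at time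
  \<open>t\<close>.\<close>

lemma faces_of_Face:
  assumes t: "t \<le> k" and W: "clique (E t) W"
  shows "faces_of K (Face t W) = {Face t U | U. U \<subseteq> W \<and> U \<noteq> {}}"
proof
  show "faces_of K (Face t W) \<subseteq> {Face t U | U. U \<subseteq> W \<and> U \<noteq> {}}"
  proof
    fix \<tau> assume \<tau>: "\<tau> \<in> faces_of K (Face t W)"
    then have "\<tau> \<in> K" and sub: "\<tau> \<subseteq> Face t W" by (auto simp: faces_of_def)
    then show "\<tau> \<in> {Face t U | U. U \<subseteq> W \<and> U \<noteq> {}}"
    proof (cases rule: K_cases)
      case (face j U)
      have pt: "x \<in> chull W \<and> h j x = h t x" if "x \<in> chull U" for x
      proof -
        have "(x, h j x) \<in> Face t W" using sub that face(1) mem_Face by blast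
        then show ?thesis by (simp add: mem_Face)
      qed
      then have "chull U \<subseteq> chull W" by blast
      then have "U \<subseteq> W" using chull_subset_iff clique_sub[OF face(3)] clique_sub[OF W] by blast
      moreover have "\<tau> = Face t U"
        unfolding face(1) Face_def graph_over_def using pt by (intro image_cong) auto
      moreover have "U \<noteq> {}" using face(3) by (simp add: clique_def)
      ultimately show ?thesis by blast
    next
      case (tet j)
      then show ?thesis using tet_not_subset_Face sub by blast
    qed
  qed
  show "{Face t U | U. U \<subseteq> W \<and> U \<noteq> {}} \<subseteq> faces_of K (Face t W)"
  proof clarify
    fix U assume U: "U \<subseteq> W" "U \<noteq> {}"
    have "Face t U \<in> K" using clique_mono[OF W U] Face_in_K[OF t] by blast
    moreover have "Face t U \<subseteq> Face t W"
      unfolding Face_def graph_over_def using chull_mono[OF U(1)] by (rule image_mono)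
    ultimately show "Face t U \<in> faces_of K (Face t W)" by (simp add: faces_of_def)
  qed
qed

lemma Face_subset_tet:
  assumes t: "t < k" and U: "U \<subseteq> V t"
  shows "Face t U \<subseteq> tet t" "Face (Suc t) U \<subseteq> tet t"
proof -
  have x: "x \<in> chull (V t)" "h t x \<le> h (Suc t) x" if "x \<in> chull U" for x
    using chull_mono[OF U] h_step[OF t chull_P[OF V_sub[OF t]]] that by auto
  show "Face t U \<subseteq> tet t" "Face (Suc t) U \<subseteq> tet t"
    using x by (auto simp: mem_Face mem_tet)
qed

text \<open>Proper faces of the ball are tagged by the disk that contains them: corner sets without
  the inserted diagonal give faces of the lower disk, those without the removed diagonal faces of
  the upper one. Sides and vertices occur in both descriptions.\<close>

lemma faces_of_tet:
  assumes t: "t < k"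
  shows "faces_of K (tet t) = {Face t U | U. U \<subseteq> V t \<and> U \<noteq> {} \<and> \<not> {b t, d t} \<subseteq> U} \<union>
    {Face (Suc t) U | U. U \<subseteq> V t \<and> U \<noteq> {} \<and> \<not> {a t, c t} \<subseteq> U} \<union> {tet t}" (is "_ = ?L \<union> ?R \<union> _")
proof
  show "faces_of K (tet t) \<subseteq> ?L \<union> ?R \<union> {tet t}"
  proof
    fix \<tau> assume \<tau>: "\<tau> \<in> faces_of K (tet t)"
    then have "\<tau> \<in> K" and sub: "\<tau> \<subseteq> tet t" by (auto simp: faces_of_def)
    then show "\<tau> \<in> ?L \<union> ?R \<union> {tet t}"
    proof (cases rule: K_cases)
      case (face j W)
      then have i: "\<tau> = Face j W \<inter> tet t" using sub by blast
      have "W \<noteq> {}" using face(3) by (simp add: clique_def)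
      then have "\<tau> \<noteq> {}" using Face_nonempty face(1) by simp
      show ?thesis
      proof (cases "j \<le> t")
        case True
        note l = Face_Int_tet_lower[OF True t face(3)]
        have "\<tau> = Face t (W \<inter> V t)" using i l by simp
        moreover have "W \<inter> V t \<noteq> {}" using calculation \<open>\<tau> \<noteq> {}\<close> by auto
        moreover have "\<not> {b t, d t} \<subseteq> W \<inter> V t" using l(3) by blast
        ultimately show ?thesis by blast
      next
        case False
        then have "t < j" by simp
        note l = Face_Int_tet_upper[OF this face(2,3)]
        have "\<tau> = Face (Suc t) (W \<inter> V t)" using i l by simp
        moreover have "W \<inter> V t \<noteq> {}" using calculation \<open>\<tau> \<noteq> {}\<close> by auto
        moreover have "\<not> {a t, c t} \<subseteq> W \<inter> V t" using l(3) by blast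
        ultimately show ?thesis by blast
      qed
    next
      case (tet j)
      have "tet j \<inter> tet t = tet j" using sub tet(1) by blast
      then have "\<not> j < t" "\<not> t < j"
        using tet_Int_tet(1)[of j t] tet_Int_tet(1)[of t j] tet_not_subset_Face[OF tet(2)] t tet(2)
        by (metis Int_commute order_refl)+
      then show ?thesis using tet(1) by auto
    qed
  qed
  have c1: "clique (E t) U" if "U \<subseteq> V t" "U \<noteq> {}" "\<not> {b t, d t} \<subseteq> U" for U
  proof -
    have "U \<subseteq> {a t, b t, c t} \<or> U \<subseteq> {a t, c t, d t}" using that by (auto simp: V_def)
    then show ?thesis using clique_mono triangles[OF t] that(2) by blast
  qed
  have c2: "clique (E (Suc t)) U" if "U \<subseteq> V t" "U \<noteq> {}" "\<not> {a t, c t} \<subseteq> U" for U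
  proof -
    have "U \<subseteq> {a t, b t, d t} \<or> U \<subseteq> {b t, c t, d t}" using that by (auto simp: V_def)
    then show ?thesis using clique_mono triangles[OF t] that(2) by blast
  qed
  have tk: "t \<le> k" "Suc t \<le> k" using t by auto
  have "?L \<subseteq> faces_of K (tet t)"
  proof
    fix \<tau> assume "\<tau> \<in> ?L"
    then obtain U where \<tau>: "\<tau> = Face t U" and U: "U \<subseteq> V t" "U \<noteq> {}" "\<not> {b t, d t} \<subseteq> U" by blast
    show "\<tau> \<in> faces_of K (tet t)"
      unfolding \<tau> faces_of_def using Face_in_K[OF tk(1) c1[OF U]] Face_subset_tet(1)[OF t U(1)] by simp
  qed
  moreover have "?R \<subseteq> faces_of K (tet t)"
  proof
    fix \<tau> assume "\<tau> \<in> ?R"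
    then obtain U where \<tau>: "\<tau> = Face (Suc t) U" and U: "U \<subseteq> V t" "U \<noteq> {}" "\<not> {a t, c t} \<subseteq> U" by blast
    show "\<tau> \<in> faces_of K (tet t)"
      unfolding \<tau> faces_of_def using Face_in_K[OF tk(2) c2[OF U]] Face_subset_tet(2)[OF t U(1)] by simp
  qed
  moreover have "tet t \<in> faces_of K (tet t)" using tet_in_K[OF t] by (simp add: faces_of_def)
  ultimately show "?L \<union> ?R \<union> {tet t} \<subseteq> faces_of K (tet t)"
    by (simp only: Un_subset_iff insert_subset empty_subsetI simp_thms)
qed

text \<open>The model is the flat simplex at height 0, raised by the height function.\<close>

lemma Face_simplex:
  assumes t: "t \<le> k" and W: "clique (E t) W"
  shows "\<exists>m (\<Delta>::space set) f g. m simplex \<Delta> \<and> homeomorphism \<Delta> (Face t W) f g \<and>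
    faces_of K (Face t W) = {f ` F | F. F face_of \<Delta> \<and> F \<noteq> {}}"
proof -
  define \<Delta> where "\<Delta> = convex hull (embed ` p ` W)"
  define f where "f y = (fst y, h t (fst y))" for y :: space
  note sc = simplex_clique[OF tri[OF t] W]
  have emb: "convex hull (embed ` p ` U) = embed ` chull U" for U
    unfolding chull_def by (rule convex_hull_linear_image[OF linear_embed, symmetric])
  have fU: "f ` (convex hull (embed ` p ` U)) = Face t U" for U
    unfolding emb by (simp add: Face_def graph_over_def image_image f_def)
  have "int (card W - 1) simplex \<Delta>"
  proof -
    have "0 < card W" using W clique_finite by (simp add: card_gt_0_iff clique_def)
    then show ?thesis
      unfolding simplex_def \<Delta>_def using sc by (intro exI[of _ "embed ` p ` W"]) auto
  qed
  moreover have "homeomorphism \<Delta> (Face t W) f (\<lambda>y. (fst y, 0))"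
    unfolding homeomorphism_def
  proof (intro conjI ballI)
    have \<Delta>: "\<Delta> = embed ` chull W" by (simp add: \<Delta>_def emb)
    show "f ` \<Delta> = Face t W" unfolding \<Delta>_def by (rule fU)
    show "(\<lambda>y. (fst y, 0)) ` Face t W = \<Delta>"
      unfolding \<Delta> Face_def graph_over_def image_image by simp
    have "continuous_on (chull W) (h t)"
      using cont[OF t] chull_mono[OF clique_sub[OF W]] by (rule continuous_on_subset)
    then have "continuous_on \<Delta> (\<lambda>y. h t (fst y))"
      by (rule continuous_on_compose2[OF _ continuous_on_fst[OF continuous_on_id]]) (auto simp: \<Delta>)
    then show "continuous_on \<Delta> f" unfolding f_def by (intro continuous_intros)
    show "continuous_on (Face t W) (\<lambda>y. (fst y, 0))" by (intro continuous_intros)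
    show "(fst (f y), 0) = y" if "y \<in> \<Delta>" for y using that by (auto simp: \<Delta> f_def)
    show "f (fst y, 0) = y" if "y \<in> Face t W" for y using that by (auto simp: Face_def graph_over_def f_def)
  qed
  moreover have "faces_of K (Face t W) = {f ` F | F. F face_of \<Delta> \<and> F \<noteq> {}}"
  proof -
    have F: "F face_of \<Delta> \<and> F \<noteq> {} \<longleftrightarrow> (\<exists>C. F = convex hull C \<and> C \<subseteq> embed ` p ` W \<and> C \<noteq> {})" for F
      unfolding \<Delta>_def face_of_convex_hull_affine_independent[OF sc(1)] by auto
    have "{f ` F | F. F face_of \<Delta> \<and> F \<noteq> {}} = {f ` (convex hull C) | C. C \<subseteq> embed ` p ` W \<and> C \<noteq> {}}"
      unfolding F by blast
    also have "\<dots> = {f ` (convex hull (embed ` U)) | U. U \<subseteq> p ` W \<and> U \<noteq> {}}"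
      by (rule nonempty_subsets_image)
    also have "\<dots> = {f ` (convex hull (embed ` p ` U)) | U. U \<subseteq> W \<and> U \<noteq> {}}"
      by (rule nonempty_subsets_image)
    finally have "{f ` F | F. F face_of \<Delta> \<and> F \<noteq> {}} = {f ` (convex hull (embed ` p ` U)) | U. U \<subseteq> W \<and> U \<noteq> {}}" .
    then show ?thesis unfolding fU faces_of_Face[OF t W] by simp
  qed
  ultimately show ?thesis by blast
qed

text \<open>The model is the straight tetrahedron of the quadrilateral, mapped by
  \<open>q.stretch\<close>. Its lower and upper boundary graphs go to the two disks, which matches
  proper faces by their corner sets.\<close>

lemma tet_simplex:
  assumes t: "t < k"
  shows "\<exists>m (\<Delta>::space set) f g. m simplex \<Delta> \<and> homeomorphism \<Delta> (tet t) f g \<and>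
    faces_of K (tet t) = {f ` F | F. F face_of \<Delta> \<and> F \<noteq> {}}"
proof -
  obtain o' \<kappa> \<mu> where "quadrilateral (p (a t)) (p (b t)) (p (c t)) (p (d t)) o' \<kappa> \<mu>"
    by (rule quadrilateral_V[OF t])
  then interpret q: quadrilateral "p (a t)" "p (b t)" "p (c t)" "p (d t)" o' \<kappa> \<mu> .
  have Q: "q.Q = chull (V t)" by (simp add: q.Q_def chull_V)
  have QP: "chull (V t) \<subseteq> chull {..<n}" by (rule chull_mono[OF V_sub[OF t]])
  have c: "continuous_on q.Q (h t)" "continuous_on q.Q (h (Suc t))"
    unfolding Q using cont[of t] cont[of "Suc t"] t continuous_on_subset[OF _ QP] by auto
  have eq: "h t x = h (Suc t) x" if "x \<in> q.Q - interior q.Q" for x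
    using same[OF t, of x] that QP unfolding Q by (auto simp: V_def)
  have lt: "h t x < h (Suc t) x" if "x \<in> interior q.Q" for x
    using up[OF t, of x] that unfolding Q by (simp add: V_def)
  let ?f = "q.stretch (h t) (h (Suc t))"
  obtain g where hom: "homeomorphism q.\<Delta> (region_between (h t) (h (Suc t)) q.Q) ?f g"
    by (rule q.homeomorphism_stretch[OF c eq lt])
  have reg: "region_between (h t) (h (Suc t)) q.Q = tet t" by (simp add: tet_def Q)
  have pV: "p ` V t = {p (a t), p (b t), p (c t), p (d t)}" by (simp add: V_def)
  have bdU: "{p (b t), p (d t)} \<subseteq> p ` U \<longleftrightarrow> {b t, d t} \<subseteq> U"
    and acU: "{p (a t), p (c t)} \<subseteq> p ` U \<longleftrightarrow> {a t, c t} \<subseteq> U" if "U \<subseteq> V t" for U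
  proof -
    have inj: "inj_on p {..<n}" using bij by (simp add: bij_betw_def)
    have U: "U \<subseteq> {..<n}" using that V_sub[OF t] by blast
    have m: "p v \<in> p ` U \<longleftrightarrow> v \<in> U" if "v \<in> V t" for v
      using inj_on_image_mem_iff[OF inj _ U] that V_sub[OF t] by blast
    show "{p (b t), p (d t)} \<subseteq> p ` U \<longleftrightarrow> {b t, d t} \<subseteq> U" "{p (a t), p (c t)} \<subseteq> p ` U \<longleftrightarrow> {a t, c t} \<subseteq> U"
      using m by (simp_all add: V_def)
  qed
  have lower: "?f ` (convex hull (q.lift ` p ` U)) = Face t U" if U: "U \<subseteq> V t" "\<not> {b t, d t} \<subseteq> U" for U
  proof -
    have "p ` U \<subseteq> {p (a t), p (b t), p (c t), p (d t)}" unfolding pV[symmetric] using U(1) by (rule image_mono)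
    moreover have "\<not> {p (b t), p (d t)} \<subseteq> p ` U" using U(2) unfolding bdU[OF U(1)] .
    ultimately have E: "convex hull (q.lift ` p ` U) = (\<lambda>x. (x, q.B x)) ` chull U"
      unfolding chull_def by (rule q.hull_lift_lower)
    have "?f ` (convex hull (q.lift ` p ` U)) = (\<lambda>x. ?f (x, q.B x)) ` chull U"
      unfolding E by (simp only: image_image)
    also have "\<dots> = Face t U"
      unfolding Face_def graph_over_def
    proof (rule image_cong)
      show "?f (x, q.B x) = (x, h t x)" if "x \<in> chull U" for x
      proof -
        have "x \<in> q.Q" using chull_mono[OF U(1)] that unfolding Q by blast
        then show ?thesis by (rule q.stretch_faces(1)[OF _ eq])
      qed
    qed simp
    finally show ?thesis .
  qed
  have upper: "?f ` (convex hull (q.lift ` p ` U)) = Face (Suc t) U" if U: "U \<subseteq> V t" "\<not> {a t, c t} \<subseteq> U" for U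
  proof -
    have "p ` U \<subseteq> {p (a t), p (b t), p (c t), p (d t)}" unfolding pV[symmetric] using U(1) by (rule image_mono)
    moreover have "\<not> {p (a t), p (c t)} \<subseteq> p ` U" using U(2) unfolding acU[OF U(1)] .
    ultimately have E: "convex hull (q.lift ` p ` U) = (\<lambda>x. (x, 1 - q.A x)) ` chull U"
      unfolding chull_def by (rule q.hull_lift_upper)
    have "?f ` (convex hull (q.lift ` p ` U)) = (\<lambda>x. ?f (x, 1 - q.A x)) ` chull U"
      unfolding E by (simp only: image_image)
    also have "\<dots> = Face (Suc t) U"
      unfolding Face_def graph_over_def
    proof (rule image_cong)
      show "?f (x, 1 - q.A x) = (x, h (Suc t) x)" if "x \<in> chull U" for x
      proof -
        have "x \<in> q.Q" using chull_mono[OF U(1)] that unfolding Q by blast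
        then show ?thesis by (rule q.stretch_faces(2)[OF _ eq])
      qed
    qed simp
    finally show ?thesis .
  qed
  have all: "?f ` (convex hull (q.lift ` p ` V t)) = tet t"
    using homeomorphism_image1[OF hom] unfolding reg pV q.lift_hull_all .
  have faces: "{?f ` F | F. F face_of q.\<Delta> \<and> F \<noteq> {}} = {?f ` (convex hull (q.lift ` p ` U)) | U. U \<subseteq> V t \<and> U \<noteq> {}}"
  proof -
    have "{?f ` F | F. F face_of q.\<Delta> \<and> F \<noteq> {}} = {?f ` F | F. F \<in> {F. F face_of q.\<Delta> \<and> F \<noteq> {}}}" by simp
    also have "\<dots> = {?f ` (convex hull (q.lift ` W)) | W. W \<subseteq> p ` V t \<and> W \<noteq> {}}"
      unfolding q.faces_\<Delta> pV by blast
    also have "\<dots> = {?f ` (convex hull (q.lift ` p ` U)) | U. U \<subseteq> V t \<and> U \<noteq> {}}"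
      by (rule nonempty_subsets_image)
    finally show ?thesis .
  qed
  also have "\<dots> = faces_of K (tet t)"
  proof
    show "{?f ` (convex hull (q.lift ` p ` U)) | U. U \<subseteq> V t \<and> U \<noteq> {}} \<subseteq> faces_of K (tet t)"
    proof clarify
      fix U assume U: "U \<subseteq> V t" "U \<noteq> {}"
      consider "\<not> {b t, d t} \<subseteq> U" | "\<not> {a t, c t} \<subseteq> U" | "U = V t" using U(1) unfolding V_def by blast
      then show "?f ` (convex hull (q.lift ` p ` U)) \<in> faces_of K (tet t)"
      proof cases
        case 1 then show ?thesis using lower[OF U(1)] U unfolding faces_of_tet[OF t] by blast
      next
        case 2 then show ?thesis using upper[OF U(1)] U unfolding faces_of_tet[OF t] by blast
      next
        case 3 then show ?thesis using all unfolding faces_of_tet[OF t] by blast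
      qed
    qed
    show "faces_of K (tet t) \<subseteq> {?f ` (convex hull (q.lift ` p ` U)) | U. U \<subseteq> V t \<and> U \<noteq> {}}"
    proof
      fix \<tau> assume "\<tau> \<in> faces_of K (tet t)"
      then consider U where "\<tau> = Face t U" "U \<subseteq> V t" "U \<noteq> {}" "\<not> {b t, d t} \<subseteq> U"
        | U where "\<tau> = Face (Suc t) U" "U \<subseteq> V t" "U \<noteq> {}" "\<not> {a t, c t} \<subseteq> U" | "\<tau> = tet t"
        unfolding faces_of_tet[OF t] by blast
      then show "\<tau> \<in> {?f ` (convex hull (q.lift ` p ` U)) | U. U \<subseteq> V t \<and> U \<noteq> {}}"
      proof cases
        case (1 U) then show ?thesis using lower[of U] by blast
      next
        case (2 U) then show ?thesis using upper[of U] by blast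
      next
        case 3
        have "V t \<noteq> {}" by (simp add: V_def)
        then show ?thesis using all 3 by blast
      qed
    qed
  qed
  finally have "faces_of K (tet t) = {?f ` F | F. F face_of q.\<Delta> \<and> F \<noteq> {}}" by simp
  then show ?thesis using q.simplex_\<Delta> hom unfolding reg by blast
qed

lemma finite_K: "finite K"
proof -
  have "finite {W. W \<subseteq> {..<n}}" by simp
  moreover have "{W. clique (E t) W} \<subseteq> {W. W \<subseteq> {..<n}}" for t using clique_sub by blast
  ultimately have "finite (Face t ` {W. clique (E t) W})" for t
    by (meson finite_imageI finite_subset)
  then have 1: "finite (\<Union>t\<le>k. Face t ` {W. clique (E t) W})" by blast
  have "K = (\<Union>t\<le>k. Face t ` {W. clique (E t) W}) \<union> tet ` {..<k}"
    unfolding K_eq by auto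
  then show ?thesis using 1 by simp
qed

lemma tet_nonempty: "t < k \<Longrightarrow> tet t \<noteq> {}"
  using tet_not_subset_Face[of t t "{}"] by auto

lemma curved_complex: "curved_simplicial_complex K"
  unfolding curved_simplicial_complex_def
proof (intro conjI ballI)
  show "finite K" by (rule finite_K)
  show "{} \<notin> K"
  proof
    assume "{} \<in> K"
    then show False
    proof (cases rule: K_cases)
      case (face t W)
      then have "W \<noteq> {}" by (simp add: clique_def)
      from Face_nonempty[OF this, of t] show ?thesis using face(1) by simp
    next
      case (tet t) then show ?thesis using tet_nonempty by blast
    qed
  qed
  show "\<exists>m (\<Delta>::space set) f g. m simplex \<Delta> \<and> homeomorphism \<Delta> \<sigma> f g \<and>
    faces_of K \<sigma> = {f ` F | F. F face_of \<Delta> \<and> F \<noteq> {}}" if "\<sigma> \<in> K" for \<sigma>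
    using that
  proof (cases rule: K_cases)
    case (face t W) then show ?thesis using Face_simplex by simp
  next
    case (tet t) then show ?thesis using tet_simplex by simp
  qed
  show "\<sigma> \<inter> \<tau> = {} \<or> \<sigma> \<inter> \<tau> \<in> faces_of K \<sigma> \<inter> faces_of K \<tau>" if "\<sigma> \<in> K" "\<tau> \<in> K" for \<sigma> \<tau>
    using K_Int[OF that] by (auto simp: faces_of_def)
qed

section \<open>Vertices and edges of the complex\<close>

definition vert :: "nat \<Rightarrow> space" where "vert v = (p v, 0)"

lemma vert_eq: "u < n \<Longrightarrow> v < n \<Longrightarrow> vert u = vert v \<longleftrightarrow> u = v"
  by (simp add: vert_def p_inj)

lemma Face_single: "t \<le> k \<Longrightarrow> v < n \<Longrightarrow> Face t {v} = {vert v}"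
  by (simp add: Face_def graph_over_def vert_def h_vertex)

text \<open>A ball is never a single point, because the heights of its two disks would then agree
  there and place it inside a graph.\<close>

lemma single_in_K: "{y} \<in> K \<longleftrightarrow> (\<exists>v<n. y = vert v)"
proof
  assume "{y} \<in> K"
  then show "\<exists>v<n. y = vert v"
  proof (cases rule: K_cases)
    case (face t W)
    then obtain v where v: "v \<in> W" "v < n" unfolding clique_def by blast
    then have "(p v, h t (p v)) \<in> Face t W" using vertex_in_chull mem_Face by blast
    then have "vert v \<in> {y}" using face h_vertex[OF face(2) v(2)] by (simp add: vert_def)
    then show ?thesis using v by auto
  next
    case (tet t)
    obtain x z where y: "y = (x, z)" by (cases y)
    have "y \<in> tet t" using tet(1) by blast
    then have x: "x \<in> chull (V t)" "h t x \<le> h (Suc t) x" using y by (auto simp: mem_tet)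
    then have "(x, h t x) \<in> {y}" "(x, h (Suc t) x) \<in> {y}" unfolding tet(1) by (auto simp: mem_tet)
    then have "h t x = h (Suc t) x" "z = h t x" using y by auto
    moreover have "{y} \<subseteq> Face t (V t)" using y x calculation by (simp add: mem_Face)
    ultimately show ?thesis using tet_not_subset_Face[OF tet(2)] tet(1) by metis
  qed
next
  assume "\<exists>v<n. y = vert v"
  then obtain v where "v < n" "y = vert v" by blast
  then show "{y} \<in> K" using Face_in_K[of 0 "{v}"] Face_single[of 0 v] clique_single by auto
qed

lemma face_vertices_Face:
  assumes "t \<le> k" "clique (E t) W"
  shows "face_vertices K (Face t W) = vert ` W"
proof -
  have "vert v \<in> Face t W \<longleftrightarrow> v \<in> W" if "v < n" for v
    using vertex_in_chull_iff[OF clique_sub[OF assms(2)] that] h_vertex[OF assms(1) that]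
    by (simp add: vert_def mem_Face)
  then show ?thesis
    using clique_sub[OF assms(2)] unfolding face_vertices_def faces_of_def
    by (auto simp: single_in_K)
qed

lemma face_vertices_tet:
  assumes "t < k"
  shows "face_vertices K (tet t) = vert ` V t"
proof -
  have "vert v \<in> tet t \<longleftrightarrow> v \<in> V t" if "v < n" for v
    using vertex_in_chull_iff[OF V_sub[OF assms] that] h_vertex[of t v] h_vertex[of "Suc t" v] assms that
    by (simp add: vert_def mem_tet)
  then show ?thesis
    using V_sub[OF assms] unfolding face_vertices_def faces_of_def
    by (auto simp: single_in_K)
qed

lemma vert_image_eq:
  assumes "U \<subseteq> {..<n}" "W \<subseteq> {..<n}"
  shows "vert ` U = vert ` W \<longleftrightarrow> U = W"
proof -
  have "inj_on vert {..<n}" using vert_eq by (auto intro: inj_onI)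
  then show ?thesis using inj_on_image_eq_iff assms by blast
qed

text \<open>A ball has four vertices, so an edge of the complex can only be an arc of some
  triangulation on the path.\<close>

lemma skeleton_adjacentD:
  assumes "u < v" "v < n" "skeleton_adjacent K (vert u) (vert v)"
  shows "\<exists>t\<le>k. (u, v) \<in> E t"
proof -
  obtain e where e: "e \<in> K" "face_vertices K e = vert ` {u, v}"
    using assms(3) unfolding skeleton_adjacent_def by auto
  have uv: "{u, v} \<subseteq> {..<n}" using assms by auto
  from e(1) show ?thesis
  proof (cases rule: K_cases)
    case (face t W)
    then have "W = {u, v}"
      using e(2) face_vertices_Face[OF face(2,3)] vert_image_eq[OF clique_sub[OF face(3)] uv] by simp
    then show ?thesis using face assms clique_pair by blast
  next
    case (tet t)
    then have "V t = {u, v}"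
      using e(2) face_vertices_tet[OF tet(2)] vert_image_eq[OF V_sub[OF tet(2)] uv] by simp
    then have "card (V t) \<le> 2" by (simp add: card_insert_if)
    moreover have "card (V t) = 4"
      using flip_corners_distinct[OF corners[OF tet(2)]] by (simp add: V_def)
    ultimately show ?thesis by simp
  qed
qed

end

section \<open>Flagness\<close>

lemma lost_between:
  fixes Z :: "nat \<Rightarrow> bool"
  assumes "i < j" "Z i" "\<not> Z j"
  obtains s where "i \<le> s" "s < j" "Z s" "\<not> Z (Suc s)"
proof -
  have "\<exists>s. i \<le> s \<and> s < j \<and> Z s \<and> \<not> Z (Suc s)"
  proof (rule ccontr)
    assume no: "\<not> ?thesis"
    have "s \<le> j \<longrightarrow> Z s" if "i \<le> s" for s
      using that by (induction s rule: dec_induct) (use assms(2) no in auto)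
    then show False using assms by auto
  qed
  then show ?thesis using that by blast
qed

context blow_up_path
begin

text \<open>\<open>uw\<close> and \<open>vz\<close> are never present together and each is present
  during an interval of times, so every given time for \<open>uw\<close> precedes every given time
  for \<open>vz\<close>. In between all four sides persist, and the flip that removes
  \<open>uw\<close> has \<open>v\<close> and \<open>z\<close> as its other corners.\<close>

lemma tetrahedron_of_triangles:
  assumes di: "u \<noteq> v" "u \<noteq> w" "u \<noteq> z" "v \<noteq> w" "v \<noteq> z" "w \<noteq> z"
    and le: "x1 \<le> k" "x2 \<le> k" "y1 \<le> k" "y2 \<le> k"
    and cl: "clique (E x1) {u, v, w}" "clique (E x2) {u, w, z}" "clique (E y1) {u, v, z}" "clique (E y2) {v, w, z}"
    and cross: "\<And>t. t \<le> k \<Longrightarrow> \<not> (clique (E t) {u, w} \<and> clique (E t) {v, z})"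
    and lt: "x1 < y1"
  shows "\<exists>t<k. V t = {u, v, w, z}"
proof -
  have uw: "clique (E x1) {u, w}" "clique (E x2) {u, w}" and vz: "clique (E y1) {v, z}" "clique (E y2) {v, z}"
    using clique_mono[OF cl(1), of "{u, w}"] clique_mono[OF cl(2), of "{u, w}"]
      clique_mono[OF cl(3), of "{v, z}"] clique_mono[OF cl(4), of "{v, z}"] by simp_all
  have o1: "x1 < y2"
  proof (rule ccontr)
    assume "\<not> x1 < y2"
    then have "clique (E x1) {v, z}" using keep_clique[of y2 x1 y1 "{v, z}"] vz lt le by simp
    then show False using cross uw le by blast
  qed
  have o2: "x2 < y1"
  proof (rule ccontr)
    assume "\<not> x2 < y1"
    then have "clique (E y1) {u, w}" using keep_clique[of x1 y1 x2 "{u, w}"] uw lt le by simp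
    then show False using cross vz le by blast
  qed
  have o3: "x2 < y2"
  proof (rule ccontr)
    assume "\<not> x2 < y2"
    then have "clique (E y2) {u, w}" using keep_clique[of x1 y2 x2 "{u, w}"] uw o1 le by simp
    then show False using cross vz le by blast
  qed
  let ?M = "max x1 x2" and ?m = "min y1 y2"
  have Mm: "?M < ?m" "?m \<le> k" using lt o1 o2 o3 le by auto
  have sides: "clique (E s) {u, v}" "clique (E s) {v, w}" "clique (E s) {w, z}" "clique (E s) {u, z}"
    if s: "?M \<le> s" "s \<le> ?m" for s
  proof -
    have c: "clique (E x1) {u, v}" "clique (E y1) {u, v}" "clique (E x1) {v, w}" "clique (E y2) {v, w}"
      "clique (E x2) {w, z}" "clique (E y2) {w, z}" "clique (E x2) {u, z}" "clique (E y1) {u, z}"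
      using clique_mono[OF cl(1), of "{u, v}"] clique_mono[OF cl(3), of "{u, v}"]
        clique_mono[OF cl(1), of "{v, w}"] clique_mono[OF cl(4), of "{v, w}"]
        clique_mono[OF cl(2), of "{w, z}"] clique_mono[OF cl(4), of "{w, z}"]
        clique_mono[OF cl(2), of "{u, z}"] clique_mono[OF cl(3), of "{u, z}"] by simp_all
    have b: "x1 \<le> s" "x2 \<le> s" "s \<le> y1" "s \<le> y2" using s by auto
    show "clique (E s) {u, v}" by (rule keep_clique[OF b(1,3) le(3) c(1,2)])
    show "clique (E s) {v, w}" by (rule keep_clique[OF b(1,4) le(4) c(3,4)])
    show "clique (E s) {w, z}" by (rule keep_clique[OF b(2,4) le(4) c(5,6)])
    show "clique (E s) {u, z}" by (rule keep_clique[OF b(2,3) le(3) c(7,8)])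
  qed
  \<comment> \<open>A flip removing \<open>uw\<close> is sought between the last given time for
    \<open>uw\<close> and the first one for \<open>vz\<close>.\<close>
  have "clique (E ?M) {u, w}" using uw by (simp add: max_def)
  moreover have "\<not> clique (E ?m) {u, w}" using vz cross le by (auto simp: min_def)
  ultimately obtain s where s: "?M \<le> s" "s < ?m" "clique (E s) {u, w}" "\<not> clique (E (Suc s)) {u, w}"
    using lost_between[OF Mm(1), of "\<lambda>t. clique (E t) {u, w}"] by blast
  have sk: "s < k" "s \<le> k" using s Mm by auto
  note fc = corners[OF sk(1)]
  have "(min u w, max u w) \<in> E s" "(min u w, max u w) \<notin> E (Suc s)"
    using s(3,4) di(2) unfolding clique_def by (auto simp: min_def max_def)
  then have "(min u w, max u w) \<in> E s - E (Suc s)" by blast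
  then have "(min u w, max u w) = (a s, c s)" using fc unfolding flip_corners_def by (metis singletonD)
  then have ac: "{u, w} = {a s, c s}" by (auto simp: min_def max_def split: if_splits)
  \<comment> \<open>The sides make \<open>v\<close> and \<open>z\<close> common neighbours of the
    ends of the removed diagonal just before the flip, and only the corners of its quadrilateral are
    such neighbours.\<close>
  have apex: "y \<in> {b s, d s}" if "clique (E s) {u, y}" "clique (E s) {w, y}" "y \<noteq> u" "y \<noteq> w" for y
  proof -
    have "clique (E s) {u, w, y}" by (rule clique_insert[OF s(3) that(2,1)])
    moreover have "{u, w, y} = {a s, c s, y}" using ac by blast
    ultimately have "y \<in> {a s, b s, c s, d s}" using flip_corners_apex[OF fc tri[OF sk(2)]] by simp
    moreover have "y \<notin> {a s, c s}" using ac that(3,4) by blast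
    ultimately show ?thesis by blast
  qed
  have "v \<in> {b s, d s}" "z \<in> {b s, d s}"
    using apex[of v] apex[of z] sides[of s] s(1,2) di by (auto simp: insert_commute)
  then have "{v, z} = {b s, d s}" using di(5) by auto
  then have "V s = {u, v, w, z}" using ac unfolding V_def by blast
  then show ?thesis using sk by blast
qed

text \<open>\<open>e0\<close> and \<open>e2\<close> are both absent at \<open>s1\<close> because
  they cross \<open>e1\<close>. If \<open>s1\<close> lay between \<open>s0\<close> and
  \<open>s2\<close>, the common time \<open>s\<close> would fall on one side of \<open>s1\<close>,
  and one of the two would be present on both sides of it.\<close>

lemma crossing_order:
  assumes le: "s0 \<le> k" "s1 \<le> k" "s2 \<le> k" "s \<le> k"
    and e: "e0 \<in> E s0" "e1 \<in> E s1" "e2 \<in> E s2" "e0 \<in> E s" "e2 \<in> E s"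
    and cross: "interleaved e0 e1" "interleaved e1 e2"
  shows "\<not> (s0 < s1 \<and> s1 < s2) \<and> \<not> (s2 < s1 \<and> s1 < s0)"
proof -
  have n: "e0 \<notin> E s1" "e2 \<notin> E s1"
    using chord_triangulation_noncrossing[OF tri[OF le(2)]] e(2) cross by blast+
  have "s \<le> s1 \<or> s1 \<le> s" by linarith
  then show ?thesis
    using n keep[of s s1 s2 e2] keep[of s0 s1 s e0] keep[of s2 s1 s e2] keep[of s s1 s0 e0] e le
    by (meson less_imp_le)
qed

text \<open>In a clique with five vertices, each of the five diagonals of the pentagon crosses its two
  neighbours, which occur together in a triangle; hence it comes either before both or after both
  of them. This is impossible around a cycle of odd length.\<close>

lemma no_pentagon:
  assumes o: "v0 < v1" "v1 < v2" "v2 < v3" "v3 < v4"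
    and t: "\<And>u v w. {u, v, w} \<subseteq> {v0, v1, v2, v3, v4} \<Longrightarrow> u < v \<Longrightarrow> v < w \<Longrightarrow> \<exists>t\<le>k. clique (E t) {u, v, w}"
  shows False
proof -
  have t': "\<exists>t\<le>k. (u, v) \<in> E t \<and> (v, w) \<in> E t \<and> (u, w) \<in> E t"
    if h: "{u, v, w} \<subseteq> {v0, v1, v2, v3, v4}" "u < v" "v < w" for u v w
  proof -
    obtain t where "t \<le> k" "clique (E t) {u, v, w}" using t[OF h] by blast
    then show ?thesis using cliqueD[of "E t" "{u, v, w}"] h by (intro exI[of _ t]) auto
  qed
  obtain x0 where x0: "x0 \<le> k" "(v1, v3) \<in> E x0" "(v1, v4) \<in> E x0" using t'[of v1 v3 v4] o by auto
  obtain x1 where x1: "x1 \<le> k" "(v0, v2) \<in> E x1" "(v2, v4) \<in> E x1" using t'[of v0 v2 v4] o by auto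
  obtain x2 where x2: "x2 \<le> k" "(v0, v3) \<in> E x2" "(v1, v3) \<in> E x2" using t'[of v0 v1 v3] o by auto
  obtain x3 where x3: "x3 \<le> k" "(v2, v4) \<in> E x3" "(v1, v4) \<in> E x3" using t'[of v1 v2 v4] o by auto
  obtain x4 where x4: "x4 \<le> k" "(v0, v3) \<in> E x4" "(v0, v2) \<in> E x4" using t'[of v0 v2 v3] o by auto
  have ne: "s \<noteq> s'" if "e \<in> E s" "f \<in> E s'" "s \<le> k" "interleaved e f" for e f s s'
    using chord_triangulation_noncrossing[OF tri[OF that(3)]] that by blast
  have c: "interleaved (v0, v2) (v1, v3)" "interleaved (v1, v3) (v2, v4)" "interleaved (v2, v4) (v0, v3)"
    "interleaved (v0, v3) (v1, v4)" "interleaved (v1, v4) (v0, v2)" using o by auto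
  text \<open>The diagonals occur at the times \<open>x1\<close>, \<open>x0\<close>, \<open>x3\<close>, \<open>x2\<close>, \<open>x3\<close> in cyclic order.\<close>
  have 1: "\<not> (x1 < x0 \<and> x0 < x3) \<and> \<not> (x3 < x0 \<and> x0 < x1)"
    by (rule crossing_order[OF x1(1) x0(1) x3(1) x1(1) x1(2) x0(2) x3(2) x1(2,3) c(1,2)])
  have 2: "\<not> (x0 < x3 \<and> x3 < x2) \<and> \<not> (x2 < x3 \<and> x3 < x0)"
    by (rule crossing_order[OF x0(1) x3(1) x2(1) x2(1) x0(2) x3(2) x2(2) x2(3,2) c(2,3)])
  \<comment> \<open>The condition at \<open>(v0, v3)\<close> is automatic: both its neighbours
    \<open>(v2, v4)\<close> and \<open>(v1, v4)\<close> were given the common time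
    \<open>x3\<close>.\<close>
  have 4: "\<not> (x2 < x3 \<and> x3 < x1) \<and> \<not> (x1 < x3 \<and> x3 < x2)"
    by (rule crossing_order[OF x2(1) x3(1) x1(1) x4(1) x2(2) x3(3) x1(2) x4(2,3) c(4,5)])
  have 5: "\<not> (x3 < x1 \<and> x1 < x0) \<and> \<not> (x0 < x1 \<and> x1 < x3)"
    by (rule crossing_order[OF x3(1) x1(1) x0(1) x0(1) x3(3) x1(2) x0(2) x0(3,2) c(5,1)])
  have n: "x1 \<noteq> x0" "x0 \<noteq> x3" "x3 \<noteq> x2" "x2 \<noteq> x3" "x3 \<noteq> x1"
    using ne[OF x1(2) x0(2) x1(1) c(1)] ne[OF x0(2) x3(2) x0(1) c(2)] ne[OF x3(2) x2(2) x3(1) c(3)]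
      ne[OF x3(3) x1(2) x3(1) c(5)] by auto
  show False using 1 2 4 5 n by linarith
qed

lemma flag_K: "flag K"
  unfolding flag_def
proof (intro allI impI, elim conjE)
  fix A assume A: "A \<subseteq> complex_vertices K" "A \<noteq> {}" "pairwise (skeleton_adjacent K) A"
  define W where "W = {v. v < n \<and> vert v \<in> A}"
  have AW: "A = vert ` W"
    using A(1) unfolding W_def complex_vertices_def by (auto simp: single_in_K)
  have W: "finite W" "W \<noteq> {}" "W \<subseteq> {..<n}"
  proof -
    show "W \<subseteq> {..<n}" by (auto simp: W_def)
    then show "finite W" using finite_subset by blast
    show "W \<noteq> {}" using AW A(2) by auto
  qed
  have adj: "\<exists>t\<le>k. (u, v) \<in> E t" if "u \<in> W" "v \<in> W" "u < v" for u v
  proof (rule skeleton_adjacentD)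
    have "vert u \<noteq> vert v" using vert_eq that W(3) by auto
    then show "skeleton_adjacent K (vert u) (vert v)" using A(3) AW that by (auto simp: pairwise_def)
  qed (use that W in auto)
  have three: "\<exists>t\<le>k. clique (E t) {u, v, w}" if h: "{u, v, w} \<subseteq> W" "u < v" "v < w" for u v w
  proof -
    have m: "u \<in> W" "v \<in> W" "w \<in> W" "u < w" "w < n" using h W(3) by auto
    obtain s1 where s1: "s1 \<le> k" "(u, v) \<in> E s1" using adj[OF m(1,2) h(2)] by blast
    obtain s2 where s2: "s2 \<le> k" "(v, w) \<in> E s2" using adj[OF m(2,3) h(3)] by blast
    obtain s3 where s3: "s3 \<le> k" "(u, w) \<in> E s3" using adj[OF m(1,3,4)] by blast
    obtain t where t: "t \<le> k" "(u, v) \<in> E t" "(v, w) \<in> E t" "(u, w) \<in> E t"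
      using triangle[OF h(2,3) m(5) s1(1) s2(1) s3(1) s1(2) s2(2) s3(2)] by blast
    have "clique (E t) {u, v, w}"
      using t h m by (intro clique_insert) (auto simp: clique_pair)
    then show ?thesis using t(1) by blast
  qed
  have face: "\<exists>\<sigma>\<in>K. face_vertices K \<sigma> = A" if "t \<le> k" "clique (E t) W" for t
    using Face_in_K[OF that] face_vertices_Face[OF that] AW by blast
  from W(1,2) show "\<exists>\<sigma>\<in>K. face_vertices K \<sigma> = A"
  proof (cases rule: nat_set_cases)
    case (1 i)
    then have "clique (E 0) W" using W(3) clique_single by simp
    then show ?thesis using face by blast
  next
    case (2 i j)
    then have m: "i \<in> W" "j \<in> W" "j < n" using W(3) by auto
    obtain t where "t \<le> k" "(i, j) \<in> E t" using adj[OF m(1,2) 2(2)] by blast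
    then show ?thesis using face[of t] 2 clique_pair[OF 2(2) m(3)] by simp
  next
    case (3 i j l)
    then obtain t where "t \<le> k" "clique (E t) {i, j, l}" using three[of i j l] by blast
    then show ?thesis using face[of t] 3 by simp
  next
    case (4 i j l m)
    obtain x1 where x1: "x1 \<le> k" "clique (E x1) {i, j, l}" using three[of i j l] 4 by auto
    obtain x2 where x2: "x2 \<le> k" "clique (E x2) {i, l, m}" using three[of i l m] 4 by auto
    obtain y1 where y1: "y1 \<le> k" "clique (E y1) {i, j, m}" using three[of i j m] 4 by auto
    obtain y2 where y2: "y2 \<le> k" "clique (E y2) {j, l, m}" using three[of j l m] 4 by auto
    have o: "i < j" "j < l" "l < m" using 4 by auto
    have cross: "\<not> (clique (E t) {i, l} \<and> clique (E t) {j, m})" if t: "t \<le> k" for t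
    proof
      assume "clique (E t) {i, l} \<and> clique (E t) {j, m}"
      then have "(i, l) \<in> E t" "(j, m) \<in> E t" using cliqueD[of "E t" "{i, l}"] cliqueD[of "E t" "{j, m}"] o by auto
      then show False using chord_triangulation_noncrossing[OF tri[OF t], of "(i, l)" "(j, m)"] o by simp
    qed
    have "x1 \<noteq> y1"
    proof
      assume "x1 = y1"
      then have "clique (E x1) {i, l}" "clique (E x1) {j, m}"
        using clique_mono[OF x1(2), of "{i, l}"] clique_mono[OF y1(2), of "{j, m}"] by simp_all
      then show False using cross x1(1) by blast
    qed
    then consider "x1 < y1" | "y1 < x1" by linarith
    then have "\<exists>t<k. V t = {i, j, l, m}"
    proof cases
      case 1
      show ?thesis
        by (rule tetrahedron_of_triangles[of i j l m, OF _ _ _ _ _ _ x1(1) x2(1) y1(1) y2(1) x1(2) x2(2) y1(2) y2(2) cross 1])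
          (use o in auto)
    next
      case 2
      \<comment> \<open>If \<open>jm\<close> comes first, the quadrilateral is read as
        \<open>j, i, m, l\<close>, which exchanges the roles of the two diagonals.\<close>
      have cl: "clique (E y1) {j, i, m}" "clique (E y2) {j, m, l}" "clique (E x1) {j, i, l}" "clique (E x2) {i, m, l}"
        using x1(2) x2(2) y1(2) y2(2) by (simp_all add: insert_commute)
      have cross': "\<not> (clique (E t) {j, m} \<and> clique (E t) {i, l})" if "t \<le> k" for t
        using cross[OF that] by blast
      have "\<exists>t<k. V t = {j, i, m, l}"
        by (rule tetrahedron_of_triangles[of j i m l, OF _ _ _ _ _ _ y1(1) y2(1) x1(1) x2(1) cl cross' 2])
          (use o in auto)
      then show ?thesis by (simp add: insert_commute)
    qed
    then obtain t where "t < k" "V t = W" using 4(1) by blast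
    then show ?thesis using tet_in_K face_vertices_tet AW by blast
  next
    case (5 i j l m q)
    have "\<exists>t\<le>k. clique (E t) {u, v, w}" if h: "{u, v, w} \<subseteq> {i, j, l, m, q}" "u < v" "v < w" for u v w
      using three[OF subset_trans[OF h(1) 5(1)] h(2,3)] .
    then show ?thesis using no_pentagon[OF 5(2-5)] by blast
  qed
qed

end

section \<open>Blow-up triangulations built from geodesics\<close>

text \<open>For each of the six orders of the times, the vertex shared by the earliest and the
  latest arc is put into the second place of \<open>geodesic_triangle\<close>.\<close>

lemma geodesic_triangle_any_order:
  assumes fin: "finite X" and ext: "\<And>x. x \<in> X \<Longrightarrow> x \<notin> convex hull (X - {x})"
    and geo: "geodesic_flip_path X k T" and abc: "a \<in> X" "b \<in> X" "c \<in> X" "a \<noteq> b" "b \<noteq> c" "a \<noteq> c"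
    and s: "s1 \<le> k" "s2 \<le> k" "s3 \<le> k"
    and e: "closed_segment a b \<in> T s1" "closed_segment b c \<in> T s2" "closed_segment a c \<in> T s3"
  shows "\<exists>t\<le>k. closed_segment a b \<in> T t \<and> closed_segment b c \<in> T t \<and> closed_segment a c \<in> T t"
proof -
  have e': "closed_segment b a \<in> T s1" "closed_segment c b \<in> T s2" "closed_segment c a \<in> T s3"
    using e by (simp_all add: closed_segment_commute)
  note g = geodesic_triangle[OF fin ext geo]
  consider "s1 \<le> s2" "s2 \<le> s3" | "s1 \<le> s3" "s3 \<le> s2" | "s2 \<le> s1" "s1 \<le> s3" | "s2 \<le> s3" "s3 \<le> s1"
    | "s3 \<le> s1" "s1 \<le> s2" | "s3 \<le> s2" "s2 \<le> s1" by linarith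
  then have "\<exists>t\<le>k. (closed_segment a b \<in> T t \<or> closed_segment b a \<in> T t) \<and>
    (closed_segment b c \<in> T t \<or> closed_segment c b \<in> T t) \<and> (closed_segment a c \<in> T t \<or> closed_segment c a \<in> T t)"
  proof cases
    case 1 then show ?thesis using g[of b a c s1 s2 s3] abc s e e' by auto
  next
    case 2 then show ?thesis using g[of a b c s1 s3 s2] abc s e e' by auto
  next
    case 3 then show ?thesis using g[of b c a s2 s1 s3] abc s e e' by auto
  next
    case 4 then show ?thesis using g[of c b a s2 s3 s1] abc s e e' by auto
  next
    case 5 then show ?thesis using g[of a c b s3 s1 s2] abc s e e' by auto
  next
    case 6 then show ?thesis using g[of c a b s3 s2 s1] abc s e e' by auto
  qed
  then show ?thesis by (simp add: closed_segment_commute)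
qed

lemma (in convex_numbering) flip_quad_chull:
  assumes fc: "flip_corners (code T) (code T') a b c d" and T: "T \<subseteq> arcs X" "T' \<subseteq> arcs X"
  shows "flip_quad T T' = chull {a, b, c, d}"
proof -
  have diff: "A - B = decode (code A - code B)" if "A \<subseteq> arcs X" for A B
  proof -
    have "code A - code B = code (A - B)" by (auto simp: code_def)
    then show ?thesis using decode_code[of "A - B"] that by auto
  qed
  have "code T - code T' = {(a, c)}" "code T' - code T = {(b, d)}"
    using fc unfolding flip_corners_def by - ((elim conjE, assumption)+)
  then have d: "T - T' = {chull {a, c}}" "T' - T = {chull {b, d}}"
    unfolding diff[OF T(1)] diff[OF T(2)] by (simp_all add: decode_def)
  have "convex hull (chull {a, c} \<union> chull {b, d}) = convex hull (p ` {a, c} \<union> p ` {b, d})"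
    unfolding chull_def by (rule hull_Un[symmetric]) (rule convex_Inter, blast)
  also have "\<dots> = chull {a, b, c, d}" unfolding chull_def by (rule arg_cong[of _ _ "(hull) convex"]) auto
  finally show ?thesis unfolding flip_quad_def d by simp
qed

theorem theorem1p2:
  fixes P X :: "plane set" and k :: nat and T :: "nat \<Rightarrow> plane set set" and K :: "space set set"
  assumes "convex_polygon P"
    and "X = polygon_vertices P"
    and "geodesic_flip_path X k T"
    and "blow_up_triangulation P X k T K"
  shows "curved_simplicial_complex K \<and> flag K"
proof -
  note X = assms(2)[unfolded polygon_vertices_def] and geo = assms(3)
  have poly: "polytope P" and dim: "aff_dim P = 2" using assms(1) unfolding convex_polygon_def by auto
  have P: "convex P" "compact P" using poly polytope_imp_convex polytope_imp_compact by auto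
  have "affine hull P = UNIV" using dim aff_dim_eq_full[of P] by simp
  moreover have "P \<noteq> {}" using dim by auto
  ultimately have intP: "interior P \<noteq> {}"
    using rel_interior_interior[of P] rel_interior_eq_empty[OF P(1)] by simp
  have fin: "finite X"
  proof -
    obtain V where "finite V" "P = convex hull V" using poly unfolding polytope_def by blast
    then show ?thesis using extreme_points_of_convex_hull[of V] finite_subset unfolding X by blast
  qed
  have PX: "P = convex hull X" unfolding X by (rule Krein_Milman_Minkowski[OF P(2,1)])
  have ext: "x \<notin> convex hull (X - {x})" if "x \<in> X" for x
  proof -
    have x: "x extreme_point_of P" using that X by simp
    \<comment> \<open>Deleting an extreme point leaves a convex set, so the hull of the other
      vertices cannot reach \<open>x\<close>.\<close>
    have "convex hull (X - {x}) \<subseteq> P - {x}"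
    proof (rule hull_minimal)
      show "X - {x} \<subseteq> P - {x}" using PX hull_subset[of X convex] by blast
      show "convex (P - {x})" using x extreme_point_of_stillconvex[OF P(1)] by blast
    qed
    then show ?thesis by blast
  qed
  have notint: "x \<notin> interior P" if "x \<in> X" for x
  proof -
    have "{x} face_of P" using that X by (simp add: face_of_singleton)
    moreover have "{x} \<noteq> P" using intP by auto
    ultimately have "{x} \<subseteq> rel_frontier P" by (rule face_of_subset_rel_frontier)
    then show ?thesis using interior_subset_rel_interior unfolding rel_frontier_def by blast
  qed
  have "X \<noteq> {}" using PX \<open>P \<noteq> {}\<close> by auto
  then obtain v where "v \<in> X" by blast
  then obtain p where num: "convex_numbering X p (card X)" using exists_convex_numbering[OF fin ext] by metis
  define n where "n = card X"
  interpret convex_numbering X p n using num unfolding n_def .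
  have pX: "p ` {..<n} = X" using bij by (simp add: bij_betw_def)
  have Pc: "P = chull {..<n}" unfolding chull_def pX by (rule PX)
  define E where "E t = code (T t)" for t
  have T: "triangulation X (T t)" if "t \<le> k" for t
    using geo that unfolding geodesic_flip_path_def flip_path_def by blast
  have flip: "(E t, E (Suc t)) \<in> chord_flip {..<n}" if "t < k" for t
    unfolding E_def using geo that flip_code unfolding geodesic_flip_path_def flip_path_def by blast
  \<comment> \<open>The corners are collected in one quadruple per time so that a single choice
    yields all four sequences.\<close>
  have "\<exists>q. t < k \<longrightarrow> flip_corners (E t) (E (Suc t)) (fst q) (fst (snd q)) (fst (snd (snd q))) (snd (snd (snd q)))" for t
    using flip_corners_exist[OF flip] by (metis fst_conv snd_conv)
  then obtain q where q: "\<And>t. t < k \<Longrightarrow>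
      flip_corners (E t) (E (Suc t)) (fst (q t)) (fst (snd (q t))) (fst (snd (snd (q t)))) (snd (snd (snd (q t))))"
    by metis
  define a b c d where "a t = fst (q t)" and "b t = fst (snd (q t))" and "c t = fst (snd (snd (q t)))"
    and "d t = snd (snd (snd (q t)))" for t
  have corners: "flip_corners (E t) (E (Suc t)) (a t) (b t) (c t) (d t)" if "t < k" for t
    using q[OF that] by (simp add: a_def b_def c_def d_def)
  define Q where "Q t = chull {a t, b t, c t, d t}" for t
  have Q: "flip_quad (T t) (T (Suc t)) = Q t" if "t < k" for t
    unfolding Q_def using corners[OF that, unfolded E_def] T[of t] T[of "Suc t"] that
    by (intro flip_quad_chull triangulation_arcs) auto
  have Qp: "Q t \<subseteq> P \<and> convex (Q t) \<and> compact (Q t) \<and> interior (Q t) \<noteq> {}" if t: "t < k" for t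
  proof -
    obtain o' \<kappa> \<mu> where "quadrilateral (p (a t)) (p (b t)) (p (c t)) (p (d t)) o' \<kappa> \<mu>"
      by (rule flip_corners_quadrilateral[OF corners[OF t]])
    then interpret q: quadrilateral "p (a t)" "p (b t)" "p (c t)" "p (d t)" o' \<kappa> \<mu> .
    have "interior (Q t) \<noteq> {}" using q.center_interior by (auto simp: q.Q_def Q_def chull_quad)
    moreover have "Q t \<subseteq> P"
      unfolding Q_def Pc using flip_corners_distinct(7)[OF corners[OF t]] by (rule chull_mono)
    ultimately show ?thesis
      by (auto simp: Q_def chull_def intro!: finite_imp_compact_convex_hull)
  qed
  obtain S D where surf: "blow_up_surfaces P k T S D" and K: "K = blow_up_faces X k T S D"
    using assms(4) unfolding blow_up_triangulation_def by blast
  \<comment> \<open>Surfaces number the flips from 1 to \<open>k\<close>, whereas here a flip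
    carries the time before it; hence the shift by one.\<close>
  have Qi: "Q (i - 1) = flip_quad (T (i - 1)) (T i)" if "1 \<le> i" "i \<le> k" for i
    using Q[of "i - 1"] that by simp
  have Qpi: "Q (i - 1) \<subseteq> P \<and> convex (Q (i - 1)) \<and> compact (Q (i - 1)) \<and> interior (Q (i - 1)) \<noteq> {}"
    if "1 \<le> i" "i \<le> k" for i using Qp[of "i - 1"] that by simp
  obtain h where h: "\<And>i. i \<le> k \<Longrightarrow> continuous_on P (h i) \<and> S i = graph_over (h i) P"
    and hD: "\<And>i. 1 \<le> i \<Longrightarrow> i \<le> k \<Longrightarrow> D i = graph_over (h i) (Q (i - 1))"
    and hup: "\<And>i x. 1 \<le> i \<Longrightarrow> i \<le> k \<Longrightarrow> x \<in> interior (Q (i - 1)) \<Longrightarrow> h (i - 1) x < h i x"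
    and hsame: "\<And>i x. 1 \<le> i \<Longrightarrow> i \<le> k \<Longrightarrow> x \<in> P - interior (Q (i - 1)) \<Longrightarrow> h i x = h (i - 1) x"
    and h0: "\<And>x. x \<in> frontier P \<Longrightarrow> h 0 x = 0"
    using blow_up_surfaces_graphs[OF P intP surf, of "\<lambda>i. Q (i - 1)", OF Qi Qpi] by blast
  have K1: "{portion (S i) \<sigma> | i \<sigma>. i \<le> k \<and> \<sigma> \<in> cells X (T i)} =
      {graph_over (h t) (chull W) | t W. t \<le> k \<and> clique (E t) W}"
  proof -
    have po: "portion (S t) (chull W) = graph_over (h t) (chull W)" if "t \<le> k" "clique (E t) W" for t W
      using h[OF that(1)] portion_graph[of "chull W" P] chull_mono[OF clique_sub[OF that(2)]] Pc by simp
    have ce: "cells X (T t) = {chull W | W. clique (E t) W}" if "t \<le> k" for t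
      unfolding E_def by (rule cells_cliques[OF T[OF that]])
    show ?thesis
    proof (rule set_eqI, rule iffI)
      fix y assume "y \<in> {portion (S i) \<sigma> | i \<sigma>. i \<le> k \<and> \<sigma> \<in> cells X (T i)}"
      then obtain t \<sigma> where t: "y = portion (S t) \<sigma>" "t \<le> k" "\<sigma> \<in> cells X (T t)" by blast
      obtain W where W: "\<sigma> = chull W" "clique (E t) W" using t(3) unfolding ce[OF t(2)] by blast
      have "y = graph_over (h t) (chull W)" using po[OF t(2) W(2)] t(1) W(1) by simp
      then show "y \<in> {graph_over (h t) (chull W) | t W. t \<le> k \<and> clique (E t) W}" using t(2) W(2) by blast
    next
      fix y assume "y \<in> {graph_over (h t) (chull W) | t W. t \<le> k \<and> clique (E t) W}"
      then obtain t W where t: "y = graph_over (h t) (chull W)" "t \<le> k" "clique (E t) W" by blast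
      have "y = portion (S t) (chull W)" using po[OF t(2,3)] t(1) by simp
      moreover have "chull W \<in> cells X (T t)" unfolding ce[OF t(2)] using t(3) by blast
      ultimately show "y \<in> {portion (S i) \<sigma> | i \<sigma>. i \<le> k \<and> \<sigma> \<in> cells X (T i)}" using t(2) by blast
    qed
  qed
  have K2: "{ball_bounded_by (portion (S (i - 1)) (flip_quad (T (i - 1)) (T i)) \<union> D i) | i. i \<in> {1..k}} =
      {region_between (h t) (h (Suc t)) (Q t) | t. t < k}"
  proof -
    have ball: "ball_bounded_by (portion (S t) (flip_quad (T t) (T (Suc t))) \<union> D (Suc t)) =
        region_between (h t) (h (Suc t)) (Q t)" if t: "t < k" for t
    proof -
      note Qt = Qp[OF t]
      have "portion (S t) (Q t) = graph_over (h t) (Q t)" using h[of t] t portion_graph Qt by simp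
      moreover have "D (Suc t) = graph_over (h (Suc t)) (Q t)" using hD[of "Suc t"] t by simp
      moreover have "ball_bounded_by (graph_over (h t) (Q t) \<union> graph_over (h (Suc t)) (Q t)) =
          region_between (h t) (h (Suc t)) (Q t)"
      proof (rule ball_bounded_by_graphs)
        show "compact (Q t)" using Qt by blast
        show "continuous_on (Q t) (h t)" "continuous_on (Q t) (h (Suc t))"
          using h[of t] h[of "Suc t"] t Qt continuous_on_subset by (metis less_imp_le Suc_leI)+
        show "h t x = h (Suc t) x" if "x \<in> Q t - interior (Q t)" for x
          using hsame[of "Suc t" x] t that Qt by auto
        show "h t x < h (Suc t) x" if "x \<in> interior (Q t)" for x
          using hup[of "Suc t" x] t that by simp
      qed
      ultimately show ?thesis unfolding Q[OF t] by simp
    qed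
    have im: "{1..k} = Suc ` {..<k}" by (simp add: image_Suc_lessThan)
    have "{ball_bounded_by (portion (S (i - 1)) (flip_quad (T (i - 1)) (T i)) \<union> D i) | i. i \<in> {1..k}} =
       (\<lambda>i. ball_bounded_by (portion (S (i - 1)) (flip_quad (T (i - 1)) (T i)) \<union> D i)) ` {1..k}"
      by (rule Setcompr_eq_image)
    also have "\<dots> = (\<lambda>t. ball_bounded_by (portion (S t) (flip_quad (T t) (T (Suc t))) \<union> D (Suc t))) ` {..<k}"
      unfolding im image_image diff_Suc_1 ..
    also have "\<dots> = (\<lambda>t. region_between (h t) (h (Suc t)) (Q t)) ` {..<k}"
      using ball by (intro image_cong) auto
    finally show ?thesis by auto
  qed
  have seg: "(i, j) \<in> E t \<longleftrightarrow> i < j \<and> j < n \<and> closed_segment (p i) (p j) \<in> T t" for i j t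
    by (simp add: E_def chull_pair)
  \<comment> \<open>The two consequences of shortness and the properties of the height functions are
    handed over; from here on neither distances nor disks are mentioned.\<close>
  interpret blow_up_path X p n k E h a b c d K
  proof
    show "chord_triangulation {..<n} (E t)" if "t \<le> k" for t
      unfolding E_def by (rule triangulation_code[OF T[OF that]])
    show "e \<in> E m" if "i \<le> m" "m \<le> j" "j \<le> k" "e \<in> E i" "e \<in> E j" for i m j e
    proof -
      obtain u w where e: "e = (u, w)" by (cases e)
      have "u < w" "w < n" "closed_segment (p u) (p w) \<in> T i" "closed_segment (p u) (p w) \<in> T j"
        using that(4,5) seg e by auto
      then show ?thesis
        using geodesic_keeps_arc[OF fin ext geo p_mem p_mem _ that(1-3), of u w] p_inj[of u w] seg e by simp
    qed
    show "\<exists>t\<le>k. (u, v) \<in> E t \<and> (v, w) \<in> E t \<and> (u, w) \<in> E t"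
      if o: "u < v" "v < w" "w < n" and s: "s1 \<le> k" "s2 \<le> k" "s3 \<le> k"
        and e: "(u, v) \<in> E s1" "(v, w) \<in> E s2" "(u, w) \<in> E s3" for u v w s1 s2 s3
    proof -
      have ne: "p u \<noteq> p v" "p v \<noteq> p w" "p u \<noteq> p w" using p_inj o by auto
      have m: "p u \<in> X" "p v \<in> X" "p w \<in> X" using p_mem o by auto
      have "closed_segment (p u) (p v) \<in> T s1" "closed_segment (p v) (p w) \<in> T s2" "closed_segment (p u) (p w) \<in> T s3"
        using e seg by auto
      from geodesic_triangle_any_order[OF fin ext geo m ne s this]
      show ?thesis using o unfolding seg by auto
    qed
    show "flip_corners (E t) (E (Suc t)) (a t) (b t) (c t) (d t)" if "t < k" for t by (rule corners[OF that])
    show "continuous_on (chull {..<n}) (h t)" if "t \<le> k" for t using h[OF that] Pc by simp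
    show "h t x < h (Suc t) x" if "t < k" "x \<in> interior (chull {a t, b t, c t, d t})" for t x
      using hup[of "Suc t" x] that by (simp add: Q_def)
    show "h (Suc t) x = h t x" if "t < k" "x \<in> chull {..<n}" "x \<notin> interior (chull {a t, b t, c t, d t})" for t x
      using hsame[of "Suc t" x] that Pc by (simp add: Q_def)
    show "p v \<notin> interior (chull {..<n})" if "v < n" for v using notint[OF p_mem[OF that]] Pc by simp
    show "h 0 (p v) = 0" if "v < n" for v
    proof -
      have "p v \<in> P" using that vertex_in_chull[of v "{..<n}"] Pc by simp
      then have "p v \<in> frontier P" using notint[OF p_mem[OF that]] closure_subset[of P] by (auto simp: frontier_def)
      then show ?thesis by (rule h0)
    qed
    show "0 < n" using fin \<open>X \<noteq> {}\<close> by (simp add: n_def card_gt_0_iff)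
    show "K = {graph_over (h t) (chull W) | t W. t \<le> k \<and> clique (E t) W} \<union>
      {region_between (h t) (h (Suc t)) (chull {a t, b t, c t, d t}) | t. t < k}"
      unfolding K blow_up_faces_def K1 K2 Q_def ..
  qed
  show ?thesis using curved_complex flag_K by blast
qed

end
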